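(* Let $\varepsilon>0$ and let $D^\varepsilon$ be a trace class operator on $L^2(\mathbb{R}^n)$ with corresponding Wigner function $W^\varepsilon=W^\varepsilon[D^\varepsilon]$. Then $$\|W^\varepsilon\|_{\mathcal{A}'}\leq\|D^\varepsilon\|_{tr}=tr(|D^\varepsilon|).$$ Moreover, if $D^\varepsilon\geq0$, then $$\|W^\varepsilon\|_{\mathcal{A}'}=\|D^\varepsilon\|_{tr}=tr(D^\varepsilon).$$
   Context: Wigner transform: for an operator $D$ on $L^2(\mathbb{R}^n)$ with integral kernel $\kappa(x,y)$, its Wigner function is $W^\varepsilon[D](x,k)=\int_{\mathbb{R}^n}e^{-2\pi i y\cdot k}\,\kappa(x+\varepsilon\frac y2,x-\varepsilon\frac y2)\,dy$. Partial Fourier transform: $\mathcal{F}_2 f(x,K)=\int_{\mathbb{R}^n}e^{-2\pi i k\cdot K}f(x,k)\,dk$. The space $\mathcal{A}$ is the completion of $C_c^\infty(\mathbb{R}^{2n})$ under $\|f\|_{\mathcal{A}}=\int_{\mathbb{R}^n}\sup_x|\mathcal{F}_2f(x,K)|\,dK$, and the norm of the dual is given by $$\|f\|_{\mathcal{A}'}=\sup_{K}\int_{\mathbb{R}^n}|\mathcal{F}_2f(x,K)|\,dx.$$ *)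

theory Defs
  imports "HOL-Analysis.Analysis" "HOL-Probability.Essential_Supremum"
begin

text \<open>
  Elements of \<open>L\<^sup>2\<close> are represented by Borel functions, so identities between them hold
  almost everywhere. An operator is a map on such functions; only its values on \<open>L2\<close> matter.
\<close>

definition L2 :: "('a::euclidean_space \<Rightarrow> complex) set"
  where "L2 = {f \<in> borel_measurable lborel. integrable lborel (\<lambda>x. (cmod (f x))\<^sup>2)}"

definition l2_inner :: "('a::euclidean_space \<Rightarrow> complex) \<Rightarrow> ('a \<Rightarrow> complex) \<Rightarrow> complex"
  where "l2_inner f g = (\<integral>x. f x * cnj (g x) \<partial>lborel)"

definition l2_norm :: "('a::euclidean_space \<Rightarrow> complex) \<Rightarrow> real"
  where "l2_norm f = sqrt (\<integral>x. (cmod (f x))\<^sup>2 \<partial>lborel)"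

text \<open>
  Linearity up to null sets together with boundedness implies that the operator respects
  almost everywhere equality.
\<close>

definition bounded_op :: "(('a::euclidean_space \<Rightarrow> complex) \<Rightarrow> 'a \<Rightarrow> complex) \<Rightarrow> bool"
  where "bounded_op D \<longleftrightarrow>
    (\<forall>f\<in>L2. D f \<in> L2) \<and>
    (\<forall>f\<in>L2. \<forall>g\<in>L2. \<forall>a b. AE x in lborel.
        D (\<lambda>y. a * f y + b * g y) x = a * D f x + b * D g x) \<and>
    (\<exists>C. \<forall>f\<in>L2. l2_norm (D f) \<le> C * l2_norm f)"

text \<open>
  Over the complex numbers a nonnegative quadratic form forces self-adjointness.
\<close>

definition positive_op :: "(('a::euclidean_space \<Rightarrow> complex) \<Rightarrow> 'a \<Rightarrow> complex) \<Rightarrow> bool"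
  where "positive_op A \<longleftrightarrow> bounded_op A \<and> (\<forall>f\<in>L2. l2_inner (A f) f \<in> \<real>\<^sub>\<ge>\<^sub>0)"

text \<open>
  \<open>|D|\<close> is the positive square root of \<open>D\<^sup>* D\<close>; the equation \<open>|D|\<^sup>2 = D\<^sup>* D\<close> is tested
  against all pairs \<open>f\<close>, \<open>g\<close>. It determines \<open>|D| f\<close> up to null sets.
\<close>

definition op_abs ::
    "(('a::euclidean_space \<Rightarrow> complex) \<Rightarrow> 'a \<Rightarrow> complex) \<Rightarrow> ('a \<Rightarrow> complex) \<Rightarrow> 'a \<Rightarrow> complex"
  where "op_abs D = (SOME A. positive_op A \<and>
    (\<forall>f\<in>L2. \<forall>g\<in>L2. l2_inner (A (A f)) g = l2_inner (D f) (D g)))"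

definition orthonormal_basis :: "('a::euclidean_space \<Rightarrow> complex) set \<Rightarrow> bool"
  where "orthonormal_basis E \<longleftrightarrow>
    E \<subseteq> L2 \<and>
    (\<forall>e\<in>E. \<forall>e'\<in>E. l2_inner e e' = (if e = e' then 1 else 0)) \<and>
    (\<forall>f\<in>L2. (\<forall>e\<in>E. l2_inner f e = 0) \<longrightarrow> (AE x in lborel. f x = 0))"

text \<open>
  The trace does not depend on the basis, so an arbitrary one is fixed.
\<close>

definition l2_basis :: "('a::euclidean_space \<Rightarrow> complex) set"
  where "l2_basis = (SOME E. orthonormal_basis E)"

definition op_trace :: "(('a::euclidean_space \<Rightarrow> complex) \<Rightarrow> 'a \<Rightarrow> complex) \<Rightarrow> complex"
  where "op_trace A = (\<Sum>\<^sub>\<infinity>e\<in>l2_basis. l2_inner (A e) e)"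

definition trace_class :: "(('a::euclidean_space \<Rightarrow> complex) \<Rightarrow> 'a \<Rightarrow> complex) \<Rightarrow> bool"
  where "trace_class D \<longleftrightarrow>
    bounded_op D \<and> (\<lambda>e. l2_inner (op_abs D e) e) summable_on l2_basis"

definition trace_norm :: "(('a::euclidean_space \<Rightarrow> complex) \<Rightarrow> 'a \<Rightarrow> complex) \<Rightarrow> real"
  where "trace_norm D = Re (op_trace (op_abs D))"

definition has_integral_kernel ::
    "(('a::euclidean_space \<Rightarrow> complex) \<Rightarrow> 'a \<Rightarrow> complex) \<Rightarrow> ('a \<times> 'a \<Rightarrow> complex) \<Rightarrow> bool"
  where "has_integral_kernel D \<kappa> \<longleftrightarrow>
    \<kappa> \<in> borel_measurable lborel \<and>
    (\<forall>f\<in>L2. AE x in lborel.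
        integrable lborel (\<lambda>y. \<kappa> (x, y) * f y) \<and> D f x = (\<integral>y. \<kappa> (x, y) * f y \<partial>lborel))"

text \<open>
  The kernel is unique up to null sets; every trace class operator has one.
\<close>

definition op_kernel ::
    "(('a::euclidean_space \<Rightarrow> complex) \<Rightarrow> 'a \<Rightarrow> complex) \<Rightarrow> 'a \<times> 'a \<Rightarrow> complex"
  where "op_kernel D = (SOME \<kappa>. has_integral_kernel D \<kappa>)"

text \<open>
  For trace class \<open>D\<close> the integral converges absolutely for almost every \<open>x\<close> and all \<open>k\<close>,
  whichever representative of the kernel is used.
\<close>

definition wigner ::
    "real \<Rightarrow> (('a::euclidean_space \<Rightarrow> complex) \<Rightarrow> 'a \<Rightarrow> complex) \<Rightarrow> 'a \<times> 'a \<Rightarrow> complex"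
  where "wigner \<epsilon> D = (\<lambda>(x, k). \<integral>y. exp (- 2 * of_real pi * \<i> * of_real (y \<bullet> k)) *
            op_kernel D (x + \<epsilon> *\<^sub>R (y /\<^sub>R 2), x - \<epsilon> *\<^sub>R (y /\<^sub>R 2)) \<partial>lborel)"

definition partial_fourier_integral ::
    "('a::euclidean_space \<times> 'a \<Rightarrow> complex) \<Rightarrow> 'a \<times> 'a \<Rightarrow> complex"
  where "partial_fourier_integral f =
    (\<lambda>(x, K). \<integral>k. exp (- 2 * of_real pi * \<i> * of_real (k \<bullet> K)) * f (x, k) \<partial>lborel)"

definition l2_tendsto ::
    "(nat \<Rightarrow> 'a::euclidean_space \<Rightarrow> complex) \<Rightarrow> ('a \<Rightarrow> complex) \<Rightarrow> bool"
  where "l2_tendsto \<phi> f \<longleftrightarrow>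
    (\<lambda>m. \<integral>\<^sup>+z. ennreal ((cmod (\<phi> m z - f z))\<^sup>2) \<partial>lborel) \<longlonglongrightarrow> 0"

text \<open>
  A Wigner function is square integrable but need not be integrable in \<open>k\<close>, so its
  partial Fourier transform is the usual (Plancherel) extension of the integral from
  \<open>L\<^sup>1 \<inter> L\<^sup>2\<close> to \<open>L\<^sup>2\<close> by continuity. It is defined up to null sets.
\<close>

definition partial_fourier ::
    "('a::euclidean_space \<times> 'a \<Rightarrow> complex) \<Rightarrow> 'a \<times> 'a \<Rightarrow> complex"
  where "partial_fourier f = (SOME G. G \<in> L2 \<and>
    (\<exists>\<phi>. (\<forall>m. \<phi> m \<in> L2 \<and> integrable lborel (\<phi> m)) \<and>
         l2_tendsto \<phi> f \<and> l2_tendsto (\<lambda>m. partial_fourier_integral (\<phi> m)) G))"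

text \<open>
  This is the norm of the dual space for functions \<open>f\<close> in \<open>L\<^sup>2\<close>. Since the transform is only
  defined up to null sets, the supremum over \<open>K\<close> is an essential supremum.
\<close>

definition dual_A_norm :: "('a::euclidean_space \<times> 'a \<Rightarrow> complex) \<Rightarrow> ennreal"
  where "dual_A_norm f =
    esssup lborel (\<lambda>K. \<integral>\<^sup>+x. ennreal (cmod (partial_fourier f (x, K))) \<partial>lborel)"

end

(* A trace class operator D factors as D = B C with C the positive square root of |D| and B, C
   Hilbert-Schmidt, so its kernel is the sum over an orthonormal basis of B e (x) * cnj (C e (y)),
   with |B e| <= |C e| and the squares of |C e| summing to tr |D|. Fourier inversion turns the partial
   Fourier transform of the Wigner function into the kernel along a shifted diagonal,
   (x, K) |-> k(x - eps K/2, x + eps K/2), whose L1 norm in x is bounded by the sum of |B e| |C e|.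
   If D >= 0, one can take B = C; then the integral along the diagonal tends to tr D as K -> 0 because
   translations are continuous in L2, so the bound is attained. *)

theory Submission
  imports Defs "HOL-Probability.Characteristic_Functions"
begin

section \<open>Square roots of positive operators\<close>

text \<open>Operators are given on Borel functions and are linear only up to null sets, so square
  roots, adjoints and the factorization are built on the quotient \<open>'a lsq\<close>, taken as a
  real Hilbert space. Multiplication by the imaginary unit becomes the bounded operator
  \<open>lsq_i\<close>, and complex linearity becomes commutation with it; this is why the root and
  the factor are produced together with a commutation clause. The factorization rests on one
  identity: D x and C (C x) have equal norms, so D x depends only on C x. The kernel and the partial
  Fourier transform are arbitrary choices, fixed only up to null sets; uniqueness of each lets an
  explicit representative replace the chosen one. Inversion uses Gaussian cutoffs because they are
  integrable and their transforms are explicit approximate identities. The dual norm is an essential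
  supremum and does not see the value at K = 0. Equality for D >= 0 therefore comes from points K
  tending to 0, and that limit is exchanged with the sum over the basis, whose terms are bounded
  uniformly in K.\<close>

lemma inner_eq_zero_of_quadratic_nonneg:
  fixes a b :: real
  assumes "\<And>t. 0 \<le> 2 * t * a + t\<^sup>2 * b"
  shows "a = 0"
proof (rule ccontr)
  assume "a \<noteq> 0"
  have "b \<ge> 0"
    using assms[of 1] assms[of "-1"] by simp
  \<comment> \<open>The denominator b + 1, in place of the b of the exact minimizer, stays positive
    when b = 0; at this t the quadratic times (b + 1)^2 equals -a^2 (b + 2).\<close>
  define t where "t = - a / (b + 1)"
  have t: "t * (b + 1) = - a"
    using \<open>b \<ge> 0\<close> by (simp add: t_def)
  have "0 \<le> (2 * t * a + t\<^sup>2 * b) * (b + 1)\<^sup>2"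
    by (intro mult_nonneg_nonneg assms) simp
  also have "\<dots> = 2 * (t * (b + 1)) * a * (b + 1) + (t * (b + 1))\<^sup>2 * b"
    by algebra
  also have "\<dots> = - (a\<^sup>2 * (b + 2))"
    unfolding t by (simp add: power2_eq_square algebra_simps)
  finally have "a\<^sup>2 * (b + 2) \<le> 0"
    by simp
  moreover have "a\<^sup>2 * (b + 2) > 0"
    using \<open>a \<noteq> 0\<close> \<open>b \<ge> 0\<close> by simp
  ultimately show False
    by simp
qed

section \<open>Orthogonality and Riesz representation on subspaces that need not be closed\<close>

lemma orthogonal_closure:
  fixes z :: "'h::real_inner"
  assumes "\<And>s. s \<in> S \<Longrightarrow> z \<bullet> s = 0" and "x \<in> closure S"
  shows "z \<bullet> x = 0"
proof -
  have "closed {y. z \<bullet> y = 0}"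
    by (intro closed_Collect_eq continuous_intros)
  moreover have "S \<subseteq> {y. z \<bullet> y = 0}"
    using assms(1) by auto
  ultimately show ?thesis
    using assms(2) closure_minimal by blast
qed

lemma closure_subspace:
  fixes S :: "'h::real_normed_vector set"
  assumes "subspace S"
  shows "subspace (closure S)"
  unfolding subspace_def
proof (intro conjI ballI allI)
  show "0 \<in> closure S"
    using subspace_0[OF assms] closure_subset by blast
  show "x + y \<in> closure S" if xy: "x \<in> closure S" "y \<in> closure S" for x y
  proof -
    obtain u v where "\<And>n. u n \<in> S" "u \<longlonglongrightarrow> x" "\<And>n. v n \<in> S" "v \<longlonglongrightarrow> y"
      using xy unfolding closure_sequential by blast
    then show ?thesis
      unfolding closure_sequential
      by (intro exI[of _ "\<lambda>n. u n + v n"] conjI allI tendsto_add subspace_add[OF assms])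
  qed
  show "c *\<^sub>R x \<in> closure S" if x: "x \<in> closure S" for c x
  proof -
    obtain u where "\<And>n. u n \<in> S" "u \<longlonglongrightarrow> x"
      using x unfolding closure_sequential by blast
    then show ?thesis
      unfolding closure_sequential
      by (intro exI[of _ "\<lambda>n. c *\<^sub>R u n"] conjI allI tendsto_scaleR tendsto_const subspace_scale[OF assms])
  qed
qed

text \<open>The difference of the two points lies in the closure and is orthogonal to
  \<open>S\<close>, hence to itself. This is the uniqueness half of the Riesz
  representation.\<close>

lemma closure_subspace_eqI:
  fixes z :: "'h::real_inner"
  assumes "subspace S" "z \<in> closure S" "z' \<in> closure S" "\<And>s. s \<in> S \<Longrightarrow> z \<bullet> s = z' \<bullet> s"
  shows "z = z'"
proof -
  have "z - z' \<in> closure S"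
    using assms(1-3) by (intro subspace_diff closure_subspace) auto
  moreover have "(z - z') \<bullet> s = 0" if "s \<in> S" for s
    using assms(4)[OF that] by (simp add: inner_diff_left)
  ultimately have "(z - z') \<bullet> (z - z') = 0"
    by (rule orthogonal_closure[rotated])
  then show ?thesis
    by simp
qed

text \<open>A minimizing sequence of |x|^2 - 2 f x over \<open>S\<close> is Cauchy by the
  parallelogram law, and the first variation at its limit gives the representation. \<open>S\<close>
  is not assumed closed because it will be the range of an operator; the representative is then
  found in the closure.\<close>

lemma riesz_subspace:
  fixes S :: "'h::{real_inner,banach} set"
  assumes S: "subspace S"
    and add: "\<And>x y. x \<in> S \<Longrightarrow> y \<in> S \<Longrightarrow> f (x + y) = f x + f y"
    and scale: "\<And>r x. x \<in> S \<Longrightarrow> f (r *\<^sub>R x) = r * f x"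
    and bound: "\<And>x. x \<in> S \<Longrightarrow> \<bar>f x\<bar> \<le> K * norm x"
  shows "\<exists>z \<in> closure S. \<forall>s\<in>S. z \<bullet> s = f s"
proof -
  define q where "q x = (norm x)\<^sup>2 - 2 * f x" for x
  have q_lower: "- K\<^sup>2 \<le> q x" if "x \<in> S" for x
  proof -
    have "0 \<le> (norm x - K)\<^sup>2" by simp
    then show ?thesis
      using bound[OF that] unfolding q_def by (simp add: power2_eq_square algebra_simps)
  qed
  have "0 \<in> S"
    using S by (rule subspace_0)
  define I where "I = (INF x\<in>S. q x)"
  have bdd: "bdd_below (q ` S)"
    using q_lower by (intro bdd_belowI[of _ "- K\<^sup>2"]) auto
  have I_le: "I \<le> q x" if "x \<in> S" for x
    unfolding I_def using bdd that by (rule cINF_lower)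
  have "\<exists>x\<in>S. q x < I + 1 / real (Suc n)" for n
  proof (rule ccontr)
    assume "\<not> ?thesis"
    then have "I + 1 / real (Suc n) \<le> I"
      unfolding I_def using \<open>0 \<in> S\<close> by (intro cINF_greatest) (auto simp: not_less)
    then show False by simp
  qed
  then obtain s where sS: "\<And>n. s n \<in> S" and sI: "\<And>n. q (s n) < I + 1 / real (Suc n)"
    by metis
  have parallelogram: "(norm (x - y))\<^sup>2 \<le> 2 * (q x - I) + 2 * (q y - I)" if "x \<in> S" "y \<in> S" for x y
  proof -
    have mem: "(1/2) *\<^sub>R (x + y) \<in> S"
      using S that by (intro subspace_scale subspace_add)
    have "4 * q ((1/2) *\<^sub>R (x + y)) = (norm (x + y))\<^sup>2 - 4 * (f x + f y)"
      unfolding q_def scale[OF subspace_add[OF S that]] add[OF that]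
      by (simp add: power2_norm_eq_inner algebra_simps)
    moreover have "(norm (x - y))\<^sup>2 = 2 * (norm x)\<^sup>2 + 2 * (norm y)\<^sup>2 - (norm (x + y))\<^sup>2"
      by (simp add: power2_norm_eq_inner algebra_simps inner_commute)
    ultimately show ?thesis
      using I_le[OF mem] unfolding q_def by (simp add: algebra_simps)
  qed
  have "Cauchy s"
  proof (rule CauchyI)
    fix e :: real assume "0 < e"
    \<comment> \<open>From index \<open>N\<close> on, the excess over the infimum is below e^2/4;
      the two factors 2 in \<open>parallelogram\<close> turn two such excesses into e^2.\<close>
    then obtain N where N: "4 / e\<^sup>2 < real N"
      using reals_Archimedean2 by blast
    have "norm (s m - s n) < e" if "m \<ge> N" "n \<ge> N" for m n
    proof -
      have "N > 0"
        using N \<open>0 < e\<close> by (metis divide_pos_pos gr0I less_le_trans of_nat_0 order_less_asym zero_less_numeral zero_less_power)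
      have aux: "1 / real (Suc k) < e\<^sup>2 / 4" if "k \<ge> N" for k
      proof -
        have "1 / real (Suc k) < 1 / real N"
          using that \<open>N > 0\<close> by (intro divide_strict_left_mono) auto
        also have "\<dots> \<le> e\<^sup>2 / 4"
          using N \<open>N > 0\<close> \<open>0 < e\<close> by (simp add: field_simps)
        finally show ?thesis .
      qed
      have "(norm (s m - s n))\<^sup>2 < e\<^sup>2"
      proof -
        have "q (s m) - I < e\<^sup>2 / 4" "q (s n) - I < e\<^sup>2 / 4"
          using sI[of m] sI[of n] aux[OF that(1)] aux[OF that(2)] by auto
        then show ?thesis
          using parallelogram[OF sS sS, of m n] by argo
      qed
      then show ?thesis
        using \<open>0 < e\<close> by (simp add: power_less_imp_less_base)
    qed
    then show "\<exists>M. \<forall>m\<ge>M. \<forall>n\<ge>M. norm (s m - s n) < e"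
      by blast
  qed
  then obtain z where z: "s \<longlonglongrightarrow> z"
    using Cauchy_convergent convergent_def by blast
  have "z \<in> closure S"
    using z sS closure_sequential by blast
  moreover have "z \<bullet> x = f x" if x: "x \<in> S" for x
  proof -
    \<comment> \<open>The limit \<open>z\<close> may lie outside \<open>S\<close>, where
      \<open>f\<close> is not controlled, so the variation is taken at \<open>s n\<close>; its
      defect of at most 1/(n+1) from minimality vanishes in the limit.\<close>
    have "0 \<le> 2 * t * (z \<bullet> x - f x) + t\<^sup>2 * (norm x)\<^sup>2" for t
    proof -
      have "0 \<le> 1 / real (Suc n) + (2 * t * (s n \<bullet> x - f x) + t\<^sup>2 * (norm x)\<^sup>2)" for n
      proof -
        have "I \<le> q (s n + t *\<^sub>R x)"
          using S x sS by (intro I_le subspace_add subspace_scale)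
        also have "\<dots> = q (s n) + (2 * t * (s n \<bullet> x - f x) + t\<^sup>2 * (norm x)\<^sup>2)"
          unfolding q_def using S x sS[of n]
          by (simp add: add scale subspace_scale power2_norm_eq_inner inner_add inner_commute power2_eq_square[of t] algebra_simps)
        finally show ?thesis
          using sI[of n] by linarith
      qed
      moreover have "(\<lambda>n. 1 / real (Suc n) + (2 * t * (s n \<bullet> x - f x) + t\<^sup>2 * (norm x)\<^sup>2))
          \<longlonglongrightarrow> 0 + (2 * t * (z \<bullet> x - f x) + t\<^sup>2 * (norm x)\<^sup>2)"
        by (intro tendsto_intros z LIMSEQ_Suc[OF lim_1_over_n])
      ultimately show ?thesis
        by (intro LIMSEQ_le_const[where a=0, OF _ exI[of _ 0]]) auto
    qed
    then show ?thesis
      using inner_eq_zero_of_quadratic_nonneg[of "z \<bullet> x - f x" "(norm x)\<^sup>2"] by simp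
  qed
  ultimately show ?thesis
    by blast
qed

text \<open>Uniqueness of the representative inside the closure of \<open>S\<close> turns linearity
  of \<open>F\<close> in its parameter into linearity of the representative. The norm bound comes
  from testing \<open>E x\<close> against itself, a limit of elements of \<open>S\<close>.\<close>

lemma riesz_family:
  fixes S :: "'h::{real_inner,banach} set" and F :: "'k::real_normed_vector \<Rightarrow> 'h \<Rightarrow> real"
  assumes S: "subspace S"
    and add: "\<And>h x y. x \<in> S \<Longrightarrow> y \<in> S \<Longrightarrow> F h (x + y) = F h x + F h y"
    and scale: "\<And>h r x. x \<in> S \<Longrightarrow> F h (r *\<^sub>R x) = r * F h x"
    and bound: "\<And>h x. x \<in> S \<Longrightarrow> \<bar>F h x\<bar> \<le> K * norm h * norm x"
    and add': "\<And>g h x. x \<in> S \<Longrightarrow> F (g + h) x = F g x + F h x"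
    and scale': "\<And>h r x. x \<in> S \<Longrightarrow> F (r *\<^sub>R h) x = r * F h x"
  shows "\<exists>E::'k \<Rightarrow>\<^sub>L 'h. \<forall>h. E h \<in> closure S \<and> (\<forall>s\<in>S. E h \<bullet> s = F h s)"
proof -
  have "\<exists>z. z \<in> closure S \<and> (\<forall>s\<in>S. z \<bullet> s = F h s)" for h
    using riesz_subspace[OF S, of "F h" "K * norm h"] add scale bound by blast
  then obtain E where E: "\<And>h. E h \<in> closure S" "\<And>h s. s \<in> S \<Longrightarrow> E h \<bullet> s = F h s"
    by metis
  have S': "subspace (closure S)"
    using S by (rule closure_subspace)
  have "bounded_linear E"
  \<comment> \<open>No sign is assumed for \<open>K\<close>; truncation at 0 covers the case
    \<open>E x = 0\<close>, where the bound has to be nonnegative.\<close>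
  proof (rule bounded_linear_intro[where K="max K 0"])
    show "E (x + y) = E x + E y" for x y
      using S E S' by (intro closure_subspace_eqI[OF S]) (auto simp: subspace_add inner_add_left add')
    show "E (r *\<^sub>R x) = r *\<^sub>R E x" for r x
      using S E S' by (intro closure_subspace_eqI[OF S]) (auto simp: subspace_scale scale')
    show "norm (E x) \<le> norm x * max K 0" for x
    proof -
      have "closed {y. E x \<bullet> y \<le> max K 0 * norm x * norm y}"
        by (intro closed_Collect_le continuous_intros)
      moreover have "S \<subseteq> {y. E x \<bullet> y \<le> max K 0 * norm x * norm y}"
      proof clarify
        fix y assume y: "y \<in> S"
        have "E x \<bullet> y \<le> K * norm x * norm y"
          using bound[OF y, of x] E(2)[OF y, of x] by linarith
        also have "\<dots> \<le> max K 0 * norm x * norm y"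
          by (intro mult_right_mono) auto
        finally show "E x \<bullet> y \<le> max K 0 * norm x * norm y" .
      qed
      ultimately have "E x \<bullet> E x \<le> max K 0 * norm x * norm (E x)"
        using E(1)[of x] closure_minimal by blast
      then have "norm (E x) * norm (E x) \<le> max K 0 * norm x * norm (E x)"
        by (simp add: power2_norm_eq_inner[symmetric] power2_eq_square)
      then show ?thesis
        by (cases "norm (E x) = 0") (auto simp: mult.commute)
    qed
  qed
  then show ?thesis
    using E by (intro exI[of _ "Blinfun E"]) (simp add: bounded_linear_Blinfun_apply)
qed

text \<open>Riesz representation of the functionals y |-> x . T y on the whole space, with x as the
  parameter of the family.\<close>

lemma adjoint_exists:
  fixes T :: "'h::{real_inner,banach} \<Rightarrow>\<^sub>L 'k::real_inner"
  shows "\<exists>T'::'k \<Rightarrow>\<^sub>L 'h. \<forall>x y. T' x \<bullet> y = x \<bullet> T y"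
proof -
  have "\<exists>T'::'k \<Rightarrow>\<^sub>L 'h. \<forall>x. T' x \<in> closure UNIV \<and> (\<forall>y\<in>UNIV. T' x \<bullet> y = x \<bullet> T y)"
  proof (rule riesz_family[where K="norm T"])
    show "\<bar>h \<bullet> T x\<bar> \<le> norm T * norm h * norm x" for h x
    proof -
      have "\<bar>h \<bullet> T x\<bar> \<le> norm h * norm (T x)"
        by (rule Cauchy_Schwarz_ineq2)
      also have "\<dots> \<le> norm h * (norm T * norm x)"
        by (intro mult_left_mono norm_blinfun) auto
      finally show ?thesis by (simp add: ac_simps)
    qed
  qed (auto simp: blinfun.add_right blinfun.scaleR_right inner_add)
  then show ?thesis by auto
qed

text \<open>By Pythagoras the squared norm of a finite block of the series is the corresponding
  block of the series of squares, so the Cauchy criterion carries over.\<close>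

lemma summable_orthogonal:
  fixes v :: "nat \<Rightarrow> 'h::{real_inner,banach}"
  assumes orth: "\<And>i j. i \<noteq> j \<Longrightarrow> v i \<bullet> v j = 0" and sum: "summable (\<lambda>n. (norm (v n))\<^sup>2)"
  shows "summable v"
proof (subst summable_Cauchy, intro allI impI)
  fix e :: real assume "0 < e"
  then obtain N where N: "\<And>m n. m \<ge> N \<Longrightarrow> norm (\<Sum>i=m..<n. (norm (v i))\<^sup>2) < e\<^sup>2"
    using sum[unfolded summable_Cauchy] by (metis zero_less_power)
  have "norm (\<Sum>i=m..<n. v i) < e" if "m \<ge> N" for m n
  proof -
    have "(norm (\<Sum>i=m..<n. v i))\<^sup>2 = (\<Sum>i=m..<n. (norm (v i))\<^sup>2)"
      using orth by (intro norm_sum_Pythagorean) (auto simp: pairwise_def orthogonal_def)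
    also have "\<dots> < e\<^sup>2"
      using N[OF that, of n] by (simp add: sum_nonneg)
    finally show ?thesis
      using \<open>0 < e\<close> by (simp add: power_less_imp_less_base)
  qed
  then show "\<exists>N. \<forall>m\<ge>N. \<forall>n. norm (\<Sum>i=m..<n. v i) < e"
    by blast
qed

section \<open>Positive operators and their square roots\<close>

text \<open>Over the reals a nonnegative quadratic form does not force symmetry, so symmetry is part
  of the definition.\<close>

definition pos_blinfun :: "('h::real_inner \<Rightarrow>\<^sub>L 'h) \<Rightarrow> bool"
  where "pos_blinfun A \<longleftrightarrow> (\<forall>x y. A x \<bullet> y = x \<bullet> A y) \<and> (\<forall>x. 0 \<le> A x \<bullet> x)"

lemma pos_blinfunD:
  assumes "pos_blinfun A"
  shows "A x \<bullet> y = x \<bullet> A y" "0 \<le> A x \<bullet> x"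
  using assms by (auto simp: pos_blinfun_def)

text \<open>The discriminant argument for the nonnegative polynomial t |-> A (x + t y) . (x + t y).
  When its leading coefficient vanishes the polynomial is affine, and a nonnegative affine function
  has slope 0.\<close>

lemma pos_blinfun_Cauchy_Schwarz:
  assumes "pos_blinfun A"
  shows "(A x \<bullet> y)\<^sup>2 \<le> (A x \<bullet> x) * (A y \<bullet> y)"
proof -
  note A = pos_blinfunD[OF assms]
  have "0 \<le> (A x \<bullet> x) + 2 * t * (A x \<bullet> y) + t\<^sup>2 * (A y \<bullet> y)" for t
    using A(2)[of "x + t *\<^sub>R y"] A(1)[of y x]
    by (simp add: blinfun.add_right blinfun.scaleR_right inner_add inner_commute power2_eq_square algebra_simps)
  note * = this
  show ?thesis
  proof (cases "A y \<bullet> y = 0")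
    case True
    have "A x \<bullet> y = 0"
    proof (rule ccontr)
      assume "A x \<bullet> y \<noteq> 0"
      \<comment> \<open>At this t the affine polynomial would take the value -1.\<close>
      define t where "t = - (A x \<bullet> x + 1) / (2 * (A x \<bullet> y))"
      have "2 * t * (A x \<bullet> y) = - (A x \<bullet> x + 1)"
        using \<open>A x \<bullet> y \<noteq> 0\<close> unfolding t_def by simp
      then show False
        using *[of t] True by simp
    qed
    then show ?thesis
      using True by simp
  next
    case False
    then have pos: "A y \<bullet> y > 0"
      using A(2)[of y] by simp
    have "0 \<le> (A x \<bullet> x) - (A x \<bullet> y)\<^sup>2 / (A y \<bullet> y)"
      using *[of "- (A x \<bullet> y) / (A y \<bullet> y)"] pos by (simp add: power2_eq_square field_simps)
    then show ?thesis
      using pos by (simp add: field_simps)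
  qed
qed

text \<open>Cauchy-Schwarz for the form of \<open>A\<close>, tested against \<open>A x\<close>,
  bounds the fourth power of the norm of \<open>A x\<close> by 0.\<close>

lemma pos_blinfun_null:
  assumes "pos_blinfun A" "A x \<bullet> x = 0"
  shows "A x = 0"
  using pos_blinfun_Cauchy_Schwarz[OF assms(1), of x "A x"] assms(2) by simp

text \<open>A bound on the quadratic form becomes a bound on the operator: testing Cauchy-Schwarz
  for the form against \<open>A x\<close> gives |A x|^4 <= |x|^2 |A x|^2.\<close>

lemma pos_contraction_norm_le:
  assumes A: "pos_blinfun A" and le: "\<And>x. A x \<bullet> x \<le> (norm x)\<^sup>2"
  shows "norm A \<le> 1"
proof (rule norm_blinfun_bound)
  show "norm (A x) \<le> 1 * norm x" for x
  proof -
    have "((norm (A x))\<^sup>2)\<^sup>2 \<le> (A x \<bullet> x) * (A (A x) \<bullet> A x)"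
      using pos_blinfun_Cauchy_Schwarz[OF A, of x "A x"] by (simp add: power2_norm_eq_inner)
    also have "\<dots> \<le> (norm x)\<^sup>2 * (norm (A x))\<^sup>2"
      by (intro mult_mono le pos_blinfunD(2)[OF A]) auto
    finally have "(norm (A x))\<^sup>2 * (norm (A x))\<^sup>2 \<le> (norm x)\<^sup>2 * (norm (A x))\<^sup>2"
      by (simp only: power2_eq_square)
    then have "(norm (A x))\<^sup>2 \<le> (norm x)\<^sup>2"
    proof (cases "A x = 0")
      case False
      then have "0 < (norm (A x))\<^sup>2"
        by simp
      then show ?thesis
        using \<open>(norm (A x))\<^sup>2 * (norm (A x))\<^sup>2 \<le> (norm x)\<^sup>2 * (norm (A x))\<^sup>2\<close> mult_right_le_imp_le by blast
    qed simp
    then show ?thesis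
      by (auto intro: power2_le_imp_le)
  qed
qed simp

text \<open>
  The limit of \<open>Y \<mapsto> (T + Y\<^sup>2) / 2\<close>, started at \<open>0\<close>, satisfies \<open>(1 - Y)\<^sup>2 = 1 - T\<close>. Its increments are
  dominated by those of the scalar iteration for \<open>T = 1\<close>, which increases to \<open>1\<close>.
\<close>

lemma contraction_square_fixpoint:
  fixes T :: "'h::{real_inner,banach} \<Rightarrow>\<^sub>L 'h"
  assumes T: "norm T \<le> 1" and sym: "\<And>x y. T x \<bullet> y = x \<bullet> T y"
  shows "\<exists>Y::'h \<Rightarrow>\<^sub>L 'h. norm Y \<le> 1 \<and> (\<forall>x y. blinfun_apply Y x \<bullet> y = x \<bullet> blinfun_apply Y y) \<and> 2 *\<^sub>R Y = T + (Y o\<^sub>L Y) \<and>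
    (\<forall>S::'h \<Rightarrow>\<^sub>L 'h. S o\<^sub>L T = T o\<^sub>L S \<longrightarrow> S o\<^sub>L Y = Y o\<^sub>L S)"
proof -
  define Y where "Y = rec_nat (0::'h \<Rightarrow>\<^sub>L 'h) (\<lambda>_ Y. (1/2) *\<^sub>R (T + (Y o\<^sub>L Y)))"
  define y where "y = rec_nat (0::real) (\<lambda>_ y. (1/2) * (1 + y * y))"
  have Y0: "Y 0 = 0" and YS: "Y (Suc n) = (1/2) *\<^sub>R (T + (Y n o\<^sub>L Y n))" for n
    by (simp_all add: Y_def)
  have y0: "y 0 = 0" and yS: "y (Suc n) = (1/2) * (1 + y n * y n)" for n
    by (simp_all add: y_def)
  have y_bounds: "0 \<le> y n \<and> y n \<le> 1" for n
  proof (induction n)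
    case (Suc n)
    then have "y n * y n \<le> 1 * 1"
      by (intro mult_mono) auto
    with Suc show ?case by (auto simp: yS)
  qed (simp add: y0)
  \<comment> \<open>The increment of \<open>y\<close> at \<open>n\<close> is half the square of
    \<open>1 - y n\<close>.\<close>
  have y_Suc_ge: "y n \<le> y (Suc n)" for n
    using zero_le_power2[of "1 - y n"] by (simp add: yS power2_eq_square algebra_simps)
  have Y_le: "norm (Y n) \<le> y n" for n
  proof (induction n)
    case (Suc n)
    have "norm (Y n o\<^sub>L Y n) \<le> norm (Y n) * norm (Y n)"
      by (rule norm_blinfun_compose)
    also have "\<dots> \<le> y n * y n"
      using Suc y_bounds[of n] by (intro mult_mono) auto
    finally have "norm (T + (Y n o\<^sub>L Y n)) \<le> 1 + y n * y n"
      using T norm_triangle_ineq[of T "Y n o\<^sub>L Y n"] by linarith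
    then show ?case by (simp add: YS yS)
  qed (simp add: Y0 y0)
  have diff_Suc: "norm (Y (Suc n) - Y n) \<le> y (Suc n) - y n" for n
  proof (induction n)
    case 0
    then show ?case using T by (simp add: Y0 y0 YS yS)
  next
    case (Suc n)
    let ?U = "Y (Suc n)" and ?V = "Y n" and ?u = "y (Suc n)" and ?v = "y n"
    \<comment> \<open>The difference U^2 - V^2 is split as U (U - V) + (U - V) V, which needs no
      commutation. The scalar sequence satisfies the same identity, so the operator bounds reproduce
      the scalar increments exactly.\<close>
    have eq: "Y (Suc (Suc n)) - Y (Suc n) = (1/2) *\<^sub>R ((?U o\<^sub>L (?U - ?V)) + ((?U - ?V) o\<^sub>L ?V))"
      by (rule blinfun_eqI) (simp add: YS[of "Suc n"] YS[of n] blinfun.bilinear_simps algebra_simps)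
    have "norm (?U o\<^sub>L (?U - ?V)) \<le> norm ?U * norm (?U - ?V)"
      by (rule norm_blinfun_compose)
    also have "\<dots> \<le> ?u * (?u - ?v)"
      using Suc Y_le[of "Suc n"] y_bounds by (intro mult_mono) auto
    finally have 1: "norm (?U o\<^sub>L (?U - ?V)) \<le> ?u * (?u - ?v)" .
    have "norm ((?U - ?V) o\<^sub>L ?V) \<le> norm (?U - ?V) * norm ?V"
      by (rule norm_blinfun_compose)
    also have "\<dots> \<le> (?u - ?v) * ?v"
      using Suc Y_le[of n] y_Suc_ge[of n] by (intro mult_mono) auto
    finally have 2: "norm ((?U - ?V) o\<^sub>L ?V) \<le> (?u - ?v) * ?v" .
    have "norm (Y (Suc (Suc n)) - Y (Suc n)) \<le> (1/2) * (?u * (?u - ?v) + (?u - ?v) * ?v)"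
      unfolding eq using 1 2 norm_triangle_ineq[of "?U o\<^sub>L (?U - ?V)" "(?U - ?V) o\<^sub>L ?V"] by simp
    also have "\<dots> = y (Suc (Suc n)) - y (Suc n)"
      by (simp add: yS[of "Suc n"] yS[of n] algebra_simps)
    finally show ?case .
  qed
  have "convergent y"
    using y_bounds y_Suc_ge
    by (intro Bseq_monoseq_convergent BseqI'[of _ 1]) (auto simp: monoseq_Suc)
  then obtain l where "y \<longlonglongrightarrow> l"
    by (auto simp: convergent_def)
  then have "summable (\<lambda>n. y (Suc n) - y n)"
    by (rule telescope_summable)
  then have "summable (\<lambda>n. Y (Suc n) - Y n)"
    by (rule summable_comparison_test'[where N=0]) (use diff_Suc in auto)
  then have "convergent (\<lambda>n. \<Sum>i<n. Y (Suc i) - Y i)"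
    by (simp add: summable_iff_convergent)
  then have "convergent Y"
    by (simp add: sum_lessThan_telescope Y0)
  then obtain L where L: "Y \<longlonglongrightarrow> L"
    by (auto simp: convergent_def)
  have compose_tendsto: "(\<lambda>n. Y n o\<^sub>L Y n) \<longlonglongrightarrow> (L o\<^sub>L L)"
    using bounded_bilinear.tendsto[OF bounded_bilinear_blinfun_compose L L] .
  have "(\<lambda>n. 2 *\<^sub>R Y (Suc n)) \<longlonglongrightarrow> 2 *\<^sub>R L"
    by (intro tendsto_intros LIMSEQ_Suc[OF L])
  moreover have "(\<lambda>n. 2 *\<^sub>R Y (Suc n)) \<longlonglongrightarrow> T + (L o\<^sub>L L)"
    using tendsto_add[OF tendsto_const compose_tendsto] by (simp add: YS)
  ultimately have fix_L: "2 *\<^sub>R L = T + (L o\<^sub>L L)"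
    by (rule LIMSEQ_unique)
  have "norm L \<le> 1"
    using tendsto_norm[OF L] by (rule LIMSEQ_le_const2) (use Y_le y_bounds order_trans in blast)
  moreover have "L x \<bullet> z = x \<bullet> L z" for x z
  proof -
    have sym_Y: "Y n x \<bullet> z = x \<bullet> Y n z" for n x z
      by (induction n arbitrary: x z) (simp_all add: Y0 YS blinfun.bilinear_simps inner_add sym)
    have "(\<lambda>n. Y n x \<bullet> z) \<longlonglongrightarrow> L x \<bullet> z"
      by (intro tendsto_intros L)
    moreover have "(\<lambda>n. x \<bullet> Y n z) \<longlonglongrightarrow> x \<bullet> L z"
      by (intro tendsto_intros L)
    ultimately show ?thesis
      using LIMSEQ_unique by (simp add: sym_Y)
  qed
  moreover have "S o\<^sub>L L = L o\<^sub>L S" if S: "S o\<^sub>L T = T o\<^sub>L S" for S :: "'h \<Rightarrow>\<^sub>L 'h"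
  proof -
    have ST: "S (T x) = T (S x)" for x
      using S by (metis blinfun_apply_blinfun_compose)
    \<comment> \<open>Every iterate is a polynomial in \<open>T\<close>, so it commutes with
      whatever commutes with \<open>T\<close>.\<close>
    have "S (Y n x) = Y n (S x)" for n x
      by (induction n arbitrary: x) (simp_all add: Y0 YS blinfun.bilinear_simps ST)
    then have comm: "S o\<^sub>L Y n = Y n o\<^sub>L S" for n
      by (intro blinfun_eqI) simp
    have "(\<lambda>n. S o\<^sub>L Y n) \<longlonglongrightarrow> (S o\<^sub>L L)"
      by (intro bounded_bilinear.tendsto[OF bounded_bilinear_blinfun_compose] tendsto_const L)
    moreover have "(\<lambda>n. Y n o\<^sub>L S) \<longlonglongrightarrow> (L o\<^sub>L S)"
      by (intro bounded_bilinear.tendsto[OF bounded_bilinear_blinfun_compose] tendsto_const L)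
    ultimately show ?thesis
      using LIMSEQ_unique by (simp add: comm)
  qed
  ultimately show ?thesis
    using fix_L by blast
qed

text \<open>With T = 1 - A/c the fixed point satisfies (1 - Y)^2 = A/c, so the root is sqrt c (1 -
  Y); it is positive because the norm of \<open>Y\<close> is at most 1. The commutation clause later
  makes the root complex linear and lets it be compared with other roots.\<close>

lemma pos_sqrt_exists:
  fixes A :: "'h::{real_inner,banach} \<Rightarrow>\<^sub>L 'h"
  assumes A: "pos_blinfun A"
  shows "\<exists>C::'h \<Rightarrow>\<^sub>L 'h. pos_blinfun C \<and> C o\<^sub>L C = A \<and> (\<forall>S::'h \<Rightarrow>\<^sub>L 'h. S o\<^sub>L A = A o\<^sub>L S \<longrightarrow> S o\<^sub>L C = C o\<^sub>L S)"
proof -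
  \<comment> \<open>The summand 1 keeps \<open>c\<close> positive for \<open>A = 0\<close>; that
    \<open>c\<close> dominates the form of \<open>A\<close> makes \<open>T\<close> positive.\<close>
  define c where "c = norm A + 1"
  have c: "c > 0"
    unfolding c_def by (smt (verit) norm_ge_zero)
  define T where "T = id_blinfun - (1 / c) *\<^sub>R A"
  have T_apply: "T x = x - (1 / c) *\<^sub>R A x" for x
    by (simp add: T_def blinfun.bilinear_simps)
  note AD = pos_blinfunD[OF A]
  have A_le: "A x \<bullet> x \<le> c * (norm x)\<^sup>2" for x
  proof -
    have "A x \<bullet> x \<le> norm (A x) * norm x"
      by (rule norm_cauchy_schwarz)
    also have "\<dots> \<le> norm A * norm x * norm x"
      by (intro mult_right_mono norm_blinfun) auto
    also have "\<dots> \<le> c * norm x * norm x"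
      unfolding c_def by (intro mult_right_mono) auto
    finally show ?thesis by (simp add: power2_eq_square)
  qed
  have T_sym: "T x \<bullet> y = x \<bullet> T y" for x y
    by (simp add: T_apply inner_diff AD(1))
  have T_form: "T x \<bullet> x = (norm x)\<^sup>2 - A x \<bullet> x / c" for x
    by (simp add: T_apply inner_diff power2_norm_eq_inner)
  have "pos_blinfun T"
    unfolding pos_blinfun_def using T_sym A_le c by (auto simp: T_form field_simps)
  then have "norm T \<le> 1"
    using AD(2) c by (intro pos_contraction_norm_le) (auto simp: T_form)
  then obtain Y :: "'h \<Rightarrow>\<^sub>L 'h" where Y: "norm Y \<le> 1" "\<And>x y. Y x \<bullet> y = x \<bullet> Y y" "2 *\<^sub>R Y = T + (Y o\<^sub>L Y)"
      and comm: "\<And>S. S o\<^sub>L T = T o\<^sub>L S \<Longrightarrow> S o\<^sub>L Y = Y o\<^sub>L S"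
    using contraction_square_fixpoint[OF _ T_sym] by blast
  define C where "C = sqrt c *\<^sub>R (id_blinfun - Y)"
  have C_apply: "C x = sqrt c *\<^sub>R (x - Y x)" for x
    by (simp add: C_def blinfun.bilinear_simps)
  have "pos_blinfun C"
    unfolding pos_blinfun_def
  proof (intro conjI allI)
    show "C x \<bullet> y = x \<bullet> C y" for x y
      by (simp add: C_apply inner_diff Y(2))
    show "0 \<le> C x \<bullet> x" for x
    proof -
      have "Y x \<bullet> x \<le> norm (Y x) * norm x"
        by (rule norm_cauchy_schwarz)
      also have "\<dots> \<le> norm Y * norm x * norm x"
        by (intro mult_right_mono norm_blinfun) auto
      also have "\<dots> \<le> 1 * norm x * norm x"
        using Y(1) by (intro mult_right_mono) auto
      also have "\<dots> = x \<bullet> x"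
        by (simp add: power2_norm_eq_inner[symmetric] power2_eq_square)
      finally show ?thesis
        using c by (simp add: C_apply inner_diff)
    qed
  qed
  moreover have "C o\<^sub>L C = A"
  proof (rule blinfun_eqI)
    fix x
    have "2 *\<^sub>R Y x = T x + Y (Y x)"
      using arg_cong[OF Y(3), of "\<lambda>Z. blinfun_apply Z x"] by (simp add: blinfun.bilinear_simps)
    then have "x - 2 *\<^sub>R Y x + Y (Y x) = (1 / c) *\<^sub>R A x"
      by (simp add: T_apply algebra_simps)
    moreover have "(C o\<^sub>L C) x = c *\<^sub>R (x - 2 *\<^sub>R Y x + Y (Y x))"
      using c by (simp add: C_apply blinfun.bilinear_simps algebra_simps scaleR_2)
    ultimately show "(C o\<^sub>L C) x = A x"
      using c by simp
  qed
  moreover have "S o\<^sub>L C = C o\<^sub>L S" if S: "S o\<^sub>L A = A o\<^sub>L S" for S :: "'h \<Rightarrow>\<^sub>L 'h"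
  proof -
    have SA: "S (A x) = A (S x)" for x
      using S by (metis blinfun_apply_blinfun_compose)
    have "S o\<^sub>L T = T o\<^sub>L S"
      by (rule blinfun_eqI) (simp add: T_apply blinfun.bilinear_simps SA)
    then have "S (Y x) = Y (S x)" for x
      using comm by (metis blinfun_apply_blinfun_compose)
    then show ?thesis
      by (intro blinfun_eqI) (simp add: C_apply blinfun.bilinear_simps)
  qed
  ultimately show ?thesis
    by blast
qed

text \<open>Both roots are compared with the constructed root \<open>C\<close>, which commutes with
  everything that commutes with the common square, in particular with \<open>P\<close> and
  \<open>Q\<close>. For commuting roots R and C, R + C annihilates y = (R - C) x; positivity then
  gives R y = C y = 0, and symmetry gives y . y = 0.\<close>

lemma pos_sqrt_unique:
  fixes P Q :: "'h::{real_inner,banach} \<Rightarrow>\<^sub>L 'h"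
  assumes P: "pos_blinfun P" and Q: "pos_blinfun Q" and eq: "P o\<^sub>L P = Q o\<^sub>L Q"
  shows "P = Q"
proof -
  have agree: "R = C"
    if R: "pos_blinfun R" and C: "pos_blinfun C" and sq: "R o\<^sub>L R = C o\<^sub>L C" and com: "R o\<^sub>L C = C o\<^sub>L R" for R C :: "'h \<Rightarrow>\<^sub>L 'h"
  proof (rule blinfun_eqI)
    fix x
    define y where "y = R x - C x"
    have RC: "R (C z) = C (R z)" "R (R z) = C (C z)" for z
      using com sq by (metis blinfun_apply_blinfun_compose)+
    have "R y + C y = 0"
      by (simp add: y_def blinfun.bilinear_simps RC)
    then have "R y \<bullet> y + C y \<bullet> y = 0"
      by (metis inner_add_left inner_zero_left)
    then have "R y \<bullet> y = 0" "C y \<bullet> y = 0"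
      using pos_blinfunD(2)[OF R, of y] pos_blinfunD(2)[OF C, of y] by linarith+
    then have "R y = 0" "C y = 0"
      using R C by (auto intro: pos_blinfun_null)
    then have "y \<bullet> y = 0"
      using pos_blinfunD(1)[OF R, of y x] pos_blinfunD(1)[OF C, of y x]
      by (subst (2) y_def) (simp add: inner_diff)
    then show "R x = C x"
      by (simp add: y_def)
  qed
  have "pos_blinfun (P o\<^sub>L P)"
    unfolding pos_blinfun_def
  proof (intro conjI allI)
    show "(P o\<^sub>L P) x \<bullet> y = x \<bullet> (P o\<^sub>L P) y" for x y
      by (simp add: pos_blinfunD(1)[OF P])
    show "0 \<le> (P o\<^sub>L P) x \<bullet> x" for x
      using pos_blinfunD(1)[OF P, of "P x" x] by simp
  qed
  then obtain C where C: "pos_blinfun C" "C o\<^sub>L C = P o\<^sub>L P"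
      and comm: "\<And>S. S o\<^sub>L (P o\<^sub>L P) = (P o\<^sub>L P) o\<^sub>L S \<Longrightarrow> S o\<^sub>L C = C o\<^sub>L S"
    using pos_sqrt_exists by blast
  have "P = C"
    by (rule agree[OF P C(1) C(2)[symmetric] comm]) (auto intro!: blinfun_eqI)
  moreover have "Q = C"
    by (rule agree[OF Q C(1) _ comm]) (auto intro!: blinfun_eqI simp: eq C(2))
  ultimately show ?thesis
    by simp
qed

text \<open>
  \<open>B\<close> is the adjoint of \<open>E\<close>, where \<open>E h\<close> represents the functional \<open>C x \<mapsto> h \<bullet> D x\<close> inside the closure of the
  range of \<open>C\<close>; hence \<open>B\<close> vanishes on the orthogonal complement of that range, as \<open>C\<close> does.
\<close>

lemma sqrt_factorization:
  fixes C D :: "'h::{real_inner,banach} \<Rightarrow>\<^sub>L 'h"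
  assumes C: "pos_blinfun C" and CD: "\<And>x. norm (D x) = norm (C (C x))"
  shows "\<exists>B::'h \<Rightarrow>\<^sub>L 'h. (\<forall>x. blinfun_apply B (C x) = D x) \<and> (\<forall>x. norm (blinfun_apply B x) \<le> norm (C x)) \<and>
    (\<forall>J::'h \<Rightarrow>\<^sub>L 'h. J o\<^sub>L C = C o\<^sub>L J \<longrightarrow> J o\<^sub>L D = D o\<^sub>L J \<longrightarrow> (\<forall>x y. blinfun_apply J x \<bullet> y = - (x \<bullet> blinfun_apply J y)) \<longrightarrow> J o\<^sub>L B = B o\<^sub>L J)"
proof -
  let ?S = "range (blinfun_apply C)"
  have S: "subspace ?S"
    by (intro linear_subspace_image blinfun.bounded_linear_right bounded_linear.linear) auto
  define p where "p s = (SOME x. C x = s)" for s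
  have Cp: "C (p s) = s" if "s \<in> ?S" for s
    using that unfolding p_def by (metis (mono_tags, lifting) imageE someI)
  \<comment> \<open>Since \<open>D (x - y)\<close> and \<open>C (C (x - y))\<close> have equal
    norms, \<open>D x\<close> is a function of \<open>C x\<close>. This makes \<open>G\<close> well
    defined on the range of \<open>C\<close>, whichever preimage \<open>p\<close> selects.\<close>
  have D_eq: "D x = D y" if "C x = C y" for x y
  proof -
    have "norm (D (x - y)) = 0"
      unfolding CD using that by (simp add: blinfun.bilinear_simps)
    then show ?thesis
      by (simp add: blinfun.bilinear_simps)
  qed
  define G where "G s = D (p s)" for s
  have G: "G (C x) = D x" for x
    unfolding G_def by (intro D_eq Cp) auto
  have G_norm: "norm (G s) = norm (C s)" if "s \<in> ?S" for s
    using that by (auto simp: G CD)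
  have G_add: "G (s + t) = G s + G t" if "s \<in> ?S" "t \<in> ?S" for s t
    using that by (auto simp: G blinfun.add_right[symmetric])
  have G_scale: "G (r *\<^sub>R s) = r *\<^sub>R G s" if "s \<in> ?S" for s r
    using that by (auto simp: G blinfun.scaleR_right[symmetric])
  have "\<exists>E::'h \<Rightarrow>\<^sub>L 'h. \<forall>h. E h \<in> closure ?S \<and> (\<forall>s\<in>?S. E h \<bullet> s = h \<bullet> G s)"
  proof (rule riesz_family[OF S, where K="norm C"])
    show "\<bar>h \<bullet> G x\<bar> \<le> norm C * norm h * norm x" if "x \<in> ?S" for h x
    proof -
      have "\<bar>h \<bullet> G x\<bar> \<le> norm h * norm (G x)"
        by (rule Cauchy_Schwarz_ineq2)
      also have "\<dots> \<le> norm h * (norm C * norm x)"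
        unfolding G_norm[OF that] by (intro mult_left_mono norm_blinfun) auto
      finally show ?thesis by (simp add: ac_simps)
    qed
  qed (auto simp: G_add G_scale inner_add)
  then obtain E :: "'h \<Rightarrow>\<^sub>L 'h" where E_cl: "\<And>h. E h \<in> closure ?S" and "\<And>h s. s \<in> ?S \<Longrightarrow> E h \<bullet> s = h \<bullet> G s"
    by blast
  then have E: "E h \<bullet> C x = h \<bullet> D x" for h x
    by (simp add: G)
  obtain B :: "'h \<Rightarrow>\<^sub>L 'h" where B: "\<And>x y. B x \<bullet> y = x \<bullet> E y"
    using adjoint_exists[of E] by blast
  have BC: "B (C x) = D x" for x
  proof -
    have "B (C x) \<bullet> y = D x \<bullet> y" for y
      using B[of "C x" y] E[of y x] by (simp only: inner_commute)
    then show ?thesis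
      by (metis vector_eq_rdot)
  qed
  have "norm (B x) \<le> norm (C x)" for x
  proof -
    \<comment> \<open>\<open>z\<close> is the orthogonal projection of \<open>x\<close> onto the
      closure of the range. Both \<open>B\<close> and \<open>C\<close> annihilate
      \<open>x - z\<close>, while on the range B (C u) = D u has the same norm as C (C u).\<close>
    obtain z where z: "z \<in> closure ?S" "\<And>s. s \<in> ?S \<Longrightarrow> z \<bullet> s = x \<bullet> s"
      using riesz_subspace[OF S, of "\<lambda>s. x \<bullet> s" "norm x"] by (auto simp: inner_add Cauchy_Schwarz_ineq2)
    have orth: "(x - z) \<bullet> s = 0" if "s \<in> closure ?S" for s
      using orthogonal_closure[OF _ that, of "x - z"] z(2) by (simp add: inner_diff)
    have "B (x - z) \<bullet> y = 0" for y
      using orth[OF E_cl[of y]] by (simp add: B)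
    then have "B (x - z) = 0"
      by (metis inner_eq_zero_iff)
    moreover have "C (x - z) \<bullet> y = 0" for y
      using orth[of "C y"] closure_subset[of ?S] pos_blinfunD(1)[OF C, of "x - z" y] by auto
    then have "C (x - z) = 0"
      by (metis inner_eq_zero_iff)
    moreover have "closed {s. norm (B s) \<le> norm (C s)}"
      by (intro closed_Collect_le continuous_intros)
    then have "closure ?S \<subseteq> {s. norm (B s) \<le> norm (C s)}"
      by (intro closure_minimal) (auto simp: BC CD)
    ultimately show ?thesis
      using z(1) by (auto simp: blinfun.bilinear_simps)
  qed
  moreover have "J o\<^sub>L B = B o\<^sub>L J"
    if JC: "J o\<^sub>L C = C o\<^sub>L J" and JD: "J o\<^sub>L D = D o\<^sub>L J" and skew: "\<And>x y. J x \<bullet> y = - (x \<bullet> J y)" for J :: "'h \<Rightarrow>\<^sub>L 'h"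
  proof -
    have J: "J (C x) = C (J x)" "J (D x) = D (J x)" for x
      using JC JD by (metis blinfun_apply_blinfun_compose)+
    have JE_cl: "J (E h) \<in> closure ?S" for h
    proof -
      have "J ` closure ?S \<subseteq> closure (J ` ?S)"
        by (intro continuous_image_closure_subset[of UNIV] continuous_intros) auto
      also have "\<dots> \<subseteq> closure ?S"
        by (intro closure_mono) (auto simp: J)
      finally show ?thesis
        using E_cl by blast
    qed
    \<comment> \<open>Both sides represent the same functional on the range of \<open>C\<close>:
      skewness moves \<open>J\<close> across the inner product, and \<open>J\<close> commutes with
      \<open>C\<close> and \<open>D\<close>.\<close>
    have JE: "J (E h) = E (J h)" for h
      using S JE_cl E_cl by (rule closure_subspace_eqI) (auto simp: skew J E)
    have "J (B x) \<bullet> y = B (J x) \<bullet> y" for x y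
      by (simp add: skew B JE[symmetric])
    then show ?thesis
      by (intro blinfun_eqI) (simp, metis vector_eq_rdot)
  qed
  ultimately show ?thesis
    using BC by blast
qed

section \<open>The Hilbert space \<open>L\<^sup>2\<close>\<close>

lemma borel_measurable_cnj [measurable (raw)]:
  "f \<in> borel_measurable M \<Longrightarrow> (\<lambda>x. cnj (f x)) \<in> borel_measurable M"
  by (rule borel_measurable_continuous_on[where f=cnj]) (auto intro: continuous_intros)

lemma L2_measurable [measurable_dest]: "f \<in> L2 \<Longrightarrow> f \<in> borel_measurable borel"
  by (simp add: L2_def)

lemma L2_integrable_square: "f \<in> L2 \<Longrightarrow> integrable lborel (\<lambda>x. (cmod (f x))\<^sup>2)"
  by (simp add: L2_def)

lemma L2_iff_nn_integral:
  "f \<in> L2 \<longleftrightarrow> f \<in> borel_measurable borel \<and> (\<integral>\<^sup>+x. ennreal ((cmod (f x))\<^sup>2) \<partial>lborel) < \<infinity>"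
  by (auto simp: L2_def integrable_iff_bounded)

lemma l2_norm_nonneg [simp]: "0 \<le> l2_norm f"
  by (simp add: l2_norm_def)

lemma l2_norm_square: "(l2_norm f)\<^sup>2 = (\<integral>x. (cmod (f x))\<^sup>2 \<partial>lborel)"
  by (simp add: l2_norm_def)

lemma nn_integral_L2_square:
  assumes "f \<in> L2"
  shows "(\<integral>\<^sup>+x. ennreal ((cmod (f x))\<^sup>2) \<partial>lborel) = ennreal ((l2_norm f)\<^sup>2)"
  unfolding l2_norm_square using L2_integrable_square[OF assms] by (intro nn_integral_eq_integral) auto

lemma cmod_add_square_le: "(cmod (a + b))\<^sup>2 \<le> 2 * (cmod a)\<^sup>2 + 2 * (cmod b)\<^sup>2"
proof -
  have "(cmod (a + b))\<^sup>2 \<le> (cmod a + cmod b)\<^sup>2"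
    by (intro power_mono norm_triangle_ineq) auto
  also have "\<dots> \<le> 2 * (cmod a)\<^sup>2 + 2 * (cmod b)\<^sup>2"
    using zero_le_power2[of "cmod a - cmod b"] by (simp add: power2_eq_square algebra_simps)
  finally show ?thesis .
qed

lemma L2_add:
  assumes f: "f \<in> L2" and g: "g \<in> L2"
  shows "(\<lambda>x. f x + g x) \<in> L2"
proof -
  have [measurable]: "f \<in> borel_measurable borel" "g \<in> borel_measurable borel"
    using f g by (auto dest: L2_measurable)
  have "integrable lborel (\<lambda>x. 2 * (cmod (f x))\<^sup>2 + 2 * (cmod (g x))\<^sup>2)"
    using L2_integrable_square[OF f] L2_integrable_square[OF g] by simp
  then have "integrable lborel (\<lambda>x. (cmod (f x + g x))\<^sup>2)"
    by (rule Bochner_Integration.integrable_bound) (use cmod_add_square_le in \<open>auto intro!: AE_I2\<close>)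
  then show ?thesis
    by (simp add: L2_def)
qed

lemma L2_mult:
  assumes "f \<in> L2"
  shows "(\<lambda>x. a * f x) \<in> L2"
  using assms by (auto simp: L2_def norm_mult power_mult_distrib)

lemma L2_zero [simp]: "(\<lambda>x. 0) \<in> L2"
  by (simp add: L2_def)

lemma L2_uminus: "f \<in> L2 \<Longrightarrow> (\<lambda>x. - f x) \<in> L2"
  by (simp add: L2_def)

lemma L2_diff: "f \<in> L2 \<Longrightarrow> g \<in> L2 \<Longrightarrow> (\<lambda>x. f x - g x) \<in> L2"
  using L2_add[of f "\<lambda>x. - g x"] by (simp add: L2_uminus)

lemma L2_sum: "(\<And>i. i \<in> I \<Longrightarrow> f i \<in> L2) \<Longrightarrow> (\<lambda>x. \<Sum>i\<in>I. f i x) \<in> L2"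
  by (induction I rule: infinite_finite_induct) (auto intro: L2_add)

lemma L2_integrable_mult:
  assumes f: "f \<in> L2" and g: "g \<in> L2"
  shows "integrable lborel (\<lambda>x. f x * g x)"
proof -
  have [measurable]: "f \<in> borel_measurable borel" "g \<in> borel_measurable borel"
    using f g by (auto dest: L2_measurable)
  have *: "a * b \<le> a\<^sup>2 + b\<^sup>2" for a b :: real
    using zero_le_power2[of "a - b"] zero_le_power2[of a] zero_le_power2[of b]
    unfolding power2_diff by linarith
  have "integrable lborel (\<lambda>x. (cmod (f x))\<^sup>2 + (cmod (g x))\<^sup>2)"
    using L2_integrable_square[OF f] L2_integrable_square[OF g] by simp
  then show ?thesis
    by (rule Bochner_Integration.integrable_bound) (use * in \<open>auto intro!: AE_I2 simp: norm_mult\<close>)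
qed

lemma L2_cnj: "f \<in> L2 \<Longrightarrow> (\<lambda>x. cnj (f x)) \<in> L2"
  by (auto simp: L2_def intro: borel_measurable_cnj)

lemma L2_integrable_inner: "f \<in> L2 \<Longrightarrow> g \<in> L2 \<Longrightarrow> integrable lborel (\<lambda>x. f x * cnj (g x))"
  by (intro L2_integrable_mult L2_cnj)

lemma l2_inner_self: "l2_inner f f = of_real ((l2_norm f)\<^sup>2)"
  unfolding l2_inner_def l2_norm_square by (simp add: complex_norm_square[symmetric] flip: integral_complex_of_real)

lemma l2_inner_add_left:
  "f \<in> L2 \<Longrightarrow> g \<in> L2 \<Longrightarrow> h \<in> L2 \<Longrightarrow> l2_inner (\<lambda>x. f x + g x) h = l2_inner f h + l2_inner g h"
  unfolding l2_inner_def by (simp add: distrib_right L2_integrable_inner)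

lemma l2_inner_mult_left: "l2_inner (\<lambda>x. a * f x) h = a * l2_inner f h"
  unfolding l2_inner_def by (simp add: mult.assoc)

lemma l2_inner_mult_right: "l2_inner f (\<lambda>x. a * h x) = cnj a * l2_inner f h"
  unfolding l2_inner_def by (simp add: ac_simps flip: integral_mult_right_zero)

lemma l2_inner_commute: "l2_inner g f = cnj (l2_inner f g)"
proof -
  have "l2_inner g f = (\<integral>x. cnj (f x * cnj (g x)) \<partial>lborel)"
    by (simp add: l2_inner_def mult.commute)
  then show ?thesis
    unfolding l2_inner_def Bochner_Integration.integral_cnj .
qed

lemma l2_inner_cong_AE:
  assumes "f \<in> L2" "f' \<in> L2" "g \<in> L2" "g' \<in> L2"
    and "AE x in lborel. f x = f' x" "AE x in lborel. g x = g' x"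
  shows "l2_inner f g = l2_inner f' g'"
  unfolding l2_inner_def using assms
  by (intro integral_cong_AE borel_measurable_integrable L2_integrable_inner) auto

lemma l2_norm_eq_0_iff:
  assumes "f \<in> L2"
  shows "l2_norm f = 0 \<longleftrightarrow> (AE x in lborel. f x = 0)"
proof -
  have "l2_norm f = 0 \<longleftrightarrow> (\<integral>x. (cmod (f x))\<^sup>2 \<partial>lborel) = 0"
    by (simp add: l2_norm_def)
  also have "\<dots> \<longleftrightarrow> (AE x in lborel. (cmod (f x))\<^sup>2 = 0)"
    using L2_integrable_square[OF assms] by (intro integral_nonneg_eq_0_iff_AE) auto
  finally show ?thesis
    by simp
qed

lemma ennreal_le_suminf: "u k \<le> (\<Sum>k. u k :: ennreal)"
  using sum_le_suminf[OF summableI, of "{k}" u] by simp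

text \<open>The core of the Riesz-Fischer theorem. The hypothesis \<open>fast\<close>, met by
  passing to a subsequence, gives pointwise convergence almost everywhere and thus the limit
  function; \<open>Cauchy\<close> and Fatou's lemma give convergence in norm.\<close>

lemma L2_complete:
  fixes f :: "nat \<Rightarrow> 'a::euclidean_space \<Rightarrow> complex"
  assumes f: "\<And>n. f n \<in> L2"
    and Cauchy: "\<And>e. e > 0 \<Longrightarrow> \<exists>N. \<forall>m\<ge>N. \<forall>n\<ge>N. l2_norm (\<lambda>x. f m x - f n x) < e"
    and fast: "\<And>k. l2_norm (\<lambda>x. f (Suc k) x - f k x) \<le> (1/4) ^ k"
  shows "\<exists>g\<in>L2. (\<lambda>n. l2_norm (\<lambda>x. f n x - g x)) \<longlonglongrightarrow> 0"
proof -
  have [measurable]: "f n \<in> borel_measurable borel" for n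
    using f by (rule L2_measurable)
  \<comment> \<open>The squared norm of \<open>d k\<close> is at most 16^(-k), so the weights 4^k
    leave a convergent series; its finiteness at a point forces |d k x| <= sqrt M 2^(-k), a summable
    bound.\<close>
  define d where "d k x = f (Suc k) x - f k x" for k x
  have dL2: "d k \<in> L2" for k
    unfolding d_def by (intro L2_diff f)
  have [measurable]: "d k \<in> borel_measurable borel" for k
    using dL2 by (rule L2_measurable)
  have "(\<integral>\<^sup>+x. (\<Sum>k. ennreal (4 ^ k * (cmod (d k x))\<^sup>2)) \<partial>lborel)
      = (\<Sum>k. \<integral>\<^sup>+x. ennreal (4 ^ k * (cmod (d k x))\<^sup>2) \<partial>lborel)"
    by (intro nn_integral_suminf) measurable
  also have "\<dots> \<le> (\<Sum>k. ennreal ((1/4) ^ k))"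
  proof (intro suminf_le summableI)
    fix k
    have "(\<integral>\<^sup>+x. ennreal (4 ^ k * (cmod (d k x))\<^sup>2) \<partial>lborel)
        = ennreal (4 ^ k) * (\<integral>\<^sup>+x. ennreal ((cmod (d k x))\<^sup>2) \<partial>lborel)"
      by (subst nn_integral_cmult[symmetric]) (auto simp: ennreal_mult)
    also have "\<dots> = ennreal (4 ^ k * (l2_norm (d k))\<^sup>2)"
      by (simp add: nn_integral_L2_square[OF dL2] ennreal_mult)
    also have "4 ^ k * (l2_norm (d k))\<^sup>2 \<le> 4 ^ k * ((1/4) ^ k)\<^sup>2"
      using fast[of k] unfolding d_def by (intro mult_left_mono power_mono) auto
    also have "4 ^ k * ((1/4) ^ k)\<^sup>2 = (1/4 :: real) ^ k"
      by (simp add: power2_eq_square power_one_over)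
    finally show "(\<integral>\<^sup>+x. ennreal (4 ^ k * (cmod (d k x))\<^sup>2) \<partial>lborel) \<le> ennreal ((1/4) ^ k)"
      by (simp add: ennreal_leI)
  qed
  also have "\<dots> < \<infinity>"
    by (subst suminf_ennreal2) (auto intro!: summable_geometric)
  finally have "AE x in lborel. (\<Sum>k. ennreal (4 ^ k * (cmod (d k x))\<^sup>2)) \<noteq> \<infinity>"
    by (intro nn_integral_PInf_AE) (auto simp: less_top[symmetric])
  then have conv: "AE x in lborel. convergent (\<lambda>k. f k x)"
  proof eventually_elim
    case (elim x)
    have "\<exists>M\<ge>0. s = ennreal M" if "s \<noteq> \<infinity>" for s
      using that by (cases s rule: ennreal_cases) auto
    from this[OF elim] obtain M where M: "0 \<le> M" "(\<Sum>k. ennreal (4 ^ k * (cmod (d k x))\<^sup>2)) = ennreal M"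
      by (elim exE conjE)
    have d_le: "norm (d k x) \<le> sqrt M * (1/2) ^ k" for k
    proof -
      have "ennreal (4 ^ k * (cmod (d k x))\<^sup>2) \<le> (\<Sum>k. ennreal (4 ^ k * (cmod (d k x))\<^sup>2))"
        by (rule ennreal_le_suminf)
      then have "4 ^ k * (cmod (d k x))\<^sup>2 \<le> M"
        unfolding M(2) using M(1) by (simp only: ennreal_le_iff)
      moreover have "(4::real) ^ k = (2 ^ k)\<^sup>2"
        using power_mult[of "2::real" 2 k] by (simp add: power_even_eq)
      ultimately have "(2 ^ k * cmod (d k x))\<^sup>2 \<le> M"
        by (simp only: power_mult_distrib)
      then have "2 ^ k * cmod (d k x) \<le> sqrt M"
        by (rule real_le_rsqrt)
      then show ?thesis
        by (simp add: field_simps power_one_over)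
    qed
    have "summable (\<lambda>k. sqrt M * (1/2) ^ k)"
      by (intro summable_mult summable_geometric) simp
    then have "summable (\<lambda>k. d k x)"
      by (rule summable_comparison_test') (rule d_le)
    then have "convergent (\<lambda>n. \<Sum>k<n. f (Suc k) x - f k x)"
      unfolding d_def by (simp add: summable_iff_convergent)
    then have "convergent (\<lambda>n. f n x - f 0 x)"
      by (simp only: sum_lessThan_telescope[of "\<lambda>k. f k x"])
    then have "convergent (\<lambda>n. (f n x - f 0 x) + f 0 x)"
      by (intro convergent_add convergent_const)
    then show ?case
      by simp
  qed
  define g where "g x = lim (\<lambda>k. f k x)" for x
  have [measurable]: "g \<in> borel_measurable borel"
    unfolding g_def by measurable
  \<comment> \<open>Fatou's lemma in one index of the Cauchy condition, with the other index held
    fixed.\<close>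
  have le: "\<exists>N. \<forall>n\<ge>N. (\<integral>\<^sup>+x. ennreal ((cmod (f n x - g x))\<^sup>2) \<partial>lborel) \<le> ennreal (e\<^sup>2)" if "e > 0" for e
  proof -
    obtain N where N: "\<And>m n. m \<ge> N \<Longrightarrow> n \<ge> N \<Longrightarrow> l2_norm (\<lambda>x. f m x - f n x) < e"
      using Cauchy[OF \<open>e > 0\<close>] by blast
    have "(\<integral>\<^sup>+x. ennreal ((cmod (f n x - g x))\<^sup>2) \<partial>lborel) \<le> ennreal (e\<^sup>2)" if "n \<ge> N" for n
    proof -
      have "(\<integral>\<^sup>+x. ennreal ((cmod (f n x - g x))\<^sup>2) \<partial>lborel)
          = (\<integral>\<^sup>+x. liminf (\<lambda>m. ennreal ((cmod (f n x - f m x))\<^sup>2)) \<partial>lborel)"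
      proof (intro nn_integral_cong_AE, use conv in eventually_elim)
        case (elim x)
        then have "(\<lambda>m. f m x) \<longlonglongrightarrow> g x"
          unfolding g_def by (simp add: convergent_LIMSEQ_iff)
        then have "(\<lambda>m. ennreal ((cmod (f n x - f m x))\<^sup>2)) \<longlonglongrightarrow> ennreal ((cmod (f n x - g x))\<^sup>2)"
          by (intro tendsto_intros)
        then show ?case
          using lim_imp_Liminf[OF trivial_limit_sequentially] by metis
      qed
      also have "\<dots> \<le> liminf (\<lambda>m. \<integral>\<^sup>+x. ennreal ((cmod (f n x - f m x))\<^sup>2) \<partial>lborel)"
        by (intro nn_integral_liminf) measurable
      also have "\<dots> \<le> liminf (\<lambda>m::nat. ennreal (e\<^sup>2))"
      proof (intro Liminf_mono eventually_sequentiallyI[of N])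
        fix m assume "m \<ge> N"
        then show "(\<integral>\<^sup>+x. ennreal ((cmod (f n x - f m x))\<^sup>2) \<partial>lborel) \<le> ennreal (e\<^sup>2)"
          using N[OF \<open>n \<ge> N\<close>, of m] by (simp add: nn_integral_L2_square L2_diff f ennreal_leI power_mono)
      qed
      also have "\<dots> = ennreal (e\<^sup>2)"
        by (simp add: Liminf_const)
      finally show ?thesis .
    qed
    then show ?thesis by blast
  qed
  obtain N where "(\<integral>\<^sup>+x. ennreal ((cmod (f N x - g x))\<^sup>2) \<partial>lborel) \<le> ennreal (1\<^sup>2)"
    using le[of 1] by auto
  then have "(\<lambda>x. f N x - g x) \<in> L2"
    by (auto simp: L2_iff_nn_integral less_top[symmetric] top_unique)
  from L2_diff[OF f[of N] this] have g: "g \<in> L2"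
    by simp
  moreover have "(\<lambda>n. l2_norm (\<lambda>x. f n x - g x)) \<longlonglongrightarrow> 0"
  proof (rule LIMSEQ_I)
    fix r :: real assume "r > 0"
    then obtain N where N: "\<And>n. n \<ge> N \<Longrightarrow> (\<integral>\<^sup>+x. ennreal ((cmod (f n x - g x))\<^sup>2) \<partial>lborel) \<le> ennreal ((r/2)\<^sup>2)"
      using le[of "r/2"] by auto
    have "l2_norm (\<lambda>x. f n x - g x) < r" if "n \<ge> N" for n
    proof -
      have "(l2_norm (\<lambda>x. f n x - g x))\<^sup>2 \<le> (r/2)\<^sup>2"
        using N[OF that] by (simp add: nn_integral_L2_square L2_diff f g)
      then have "l2_norm (\<lambda>x. f n x - g x) \<le> r/2"
        by (rule power2_le_imp_le) (use \<open>r > 0\<close> in simp)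
      then show ?thesis
        using \<open>r > 0\<close> by simp
    qed
    then show "\<exists>no. \<forall>n\<ge>no. norm (l2_norm (\<lambda>x. f n x - g x) - 0) < r"
      by auto
  qed
  ultimately show ?thesis
    by blast
qed

text \<open>By Zorn's lemma there is a maximal orthonormal set; a nonzero function orthogonal to it
  could be normalized and added. The set consists of functions rather than classes, but it cannot
  contain two representatives of one class, since their inner product would be 1 instead of
  0.\<close>

lemma orthonormal_basis_exists: "\<exists>E::('a::euclidean_space \<Rightarrow> complex) set. orthonormal_basis E"
proof -
  let ?on = "\<lambda>E::('a \<Rightarrow> complex) set. E \<subseteq> L2 \<and> (\<forall>e\<in>E. \<forall>e'\<in>E. l2_inner e e' = (if e = e' then 1 else 0))"
  have "\<exists>M\<in>{E. ?on E}. \<forall>X\<in>{E. ?on E}. M \<subseteq> X \<longrightarrow> X = M"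
  proof (rule Zorn_Lemma, intro ballI, unfold mem_Collect_eq)
    fix C assume C: "C \<in> chains {E. ?on E}"
    have "l2_inner e e' = (if e = e' then 1 else 0)" if "e \<in> \<Union>C" "e' \<in> \<Union>C" for e e'
    proof -
      from that obtain X X' where X: "X \<in> C" "e \<in> X" "X' \<in> C" "e' \<in> X'"
        by blast
      then have "X \<subseteq> X' \<or> X' \<subseteq> X"
        using C by (auto simp: chains_def chain_subset_def)
      then obtain Y where "Y \<in> C" "e \<in> Y" "e' \<in> Y"
        using X by blast
      then show ?thesis
        using C by (auto simp: chains_def)
    qed
    moreover have "\<Union>C \<subseteq> L2"
      using C by (auto simp: chains_def)
    ultimately show "?on (\<Union>C)"
      by blast
  qed
  then obtain M where M: "?on M" and max: "\<And>X. ?on X \<Longrightarrow> M \<subseteq> X \<Longrightarrow> X = M"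
    by auto
  have "AE x in lborel. f x = 0" if f: "f \<in> L2" and orth: "\<forall>e\<in>M. l2_inner f e = 0" for f
  proof (rule ccontr)
    assume "\<not> ?thesis"
    then have pos: "l2_norm f > 0"
      using l2_norm_eq_0_iff[OF f] l2_norm_nonneg[of f] by linarith
    define g where "g x = of_real (1 / l2_norm f) * f x" for x
    have g: "g \<in> L2"
      unfolding g_def using f by (rule L2_mult)
    have gg: "l2_inner g g = 1"
      using pos unfolding g_def l2_inner_mult_left l2_inner_mult_right
      unfolding l2_inner_self by (simp add: power2_eq_square)
    have ge: "l2_inner g e = 0" if "e \<in> M" for e
      using orth that unfolding g_def by (simp only: l2_inner_mult_left) simp
    have eg: "l2_inner e g = 0" if "e \<in> M" for e
      using ge[OF that] l2_inner_commute[of e g] by simp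
    have "g \<notin> M"
      using ge gg by force
    have "?on (insert g M)"
      using M g gg ge eg \<open>g \<notin> M\<close> by auto
    then have "insert g M = M"
      by (rule max) auto
    then show False
      using \<open>g \<notin> M\<close> by auto
  qed
  then show ?thesis
    using M unfolding orthonormal_basis_def by blast
qed

\<comment> \<open>The relation is partial, so every representative is in \<open>L2\<close>. The
  quotient is made a real inner product space to meet the operator theory above; the complex
  structure is carried separately by \<open>lsq_cinner\<close> and
  \<open>lsq_cscale\<close>.\<close>
quotient_type (overloaded) 'a lsq = "'a::euclidean_space \<Rightarrow> complex" /
  partial: "\<lambda>f g. f \<in> L2 \<and> g \<in> L2 \<and> (AE x in lborel. f x = g x)"
proof (rule part_equivpI)
  show "\<exists>f::'a \<Rightarrow> complex. f \<in> L2 \<and> f \<in> L2 \<and> (AE x in lborel. f x = f x)"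
    by (intro exI[of _ "\<lambda>x. 0"]) simp
  show "symp (\<lambda>f g. f \<in> L2 \<and> g \<in> L2 \<and> (AE x in lborel. f x = g x))"
    by (auto simp: symp_def elim: eventually_mono)
  show "transp (\<lambda>f g. f \<in> L2 \<and> g \<in> L2 \<and> (AE x in lborel. f x = g x))"
    by (rule transpI) auto
qed

lift_definition lsq_cinner :: "'a::euclidean_space lsq \<Rightarrow> 'a lsq \<Rightarrow> complex" is l2_inner
  by (blast intro: l2_inner_cong_AE)

lift_definition lsq_cscale :: "complex \<Rightarrow> 'a::euclidean_space lsq \<Rightarrow> 'a lsq" is "\<lambda>a f x. a * f x"
  by (auto simp: L2_mult elim: eventually_mono)

instantiation lsq :: (euclidean_space) real_inner
begin

lift_definition zero_lsq :: "'a lsq" is "\<lambda>x. 0"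
  by simp

lift_definition plus_lsq :: "'a lsq \<Rightarrow> 'a lsq \<Rightarrow> 'a lsq" is "\<lambda>f g x. f x + g x"
  by (auto simp: L2_add)

lift_definition uminus_lsq :: "'a lsq \<Rightarrow> 'a lsq" is "\<lambda>f x. - f x"
  by (auto simp: L2_uminus elim: eventually_mono)

lift_definition minus_lsq :: "'a lsq \<Rightarrow> 'a lsq \<Rightarrow> 'a lsq" is "\<lambda>f g x. f x - g x"
  by (auto simp: L2_diff)

definition scaleR_lsq :: "real \<Rightarrow> 'a lsq \<Rightarrow> 'a lsq"
  where "scaleR_lsq r x = lsq_cscale (of_real r) x"

definition inner_lsq :: "'a lsq \<Rightarrow> 'a lsq \<Rightarrow> real"
  where "inner_lsq x y = Re (lsq_cinner x y)"

definition norm_lsq :: "'a lsq \<Rightarrow> real"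
  where "norm_lsq x = sqrt (inner x x)"

definition sgn_lsq :: "'a lsq \<Rightarrow> 'a lsq"
  where "sgn_lsq x = inverse (norm x) *\<^sub>R x"

definition dist_lsq :: "'a lsq \<Rightarrow> 'a lsq \<Rightarrow> real"
  where "dist_lsq x y = norm (x - y)"

definition uniformity_lsq :: "('a lsq \<times> 'a lsq) filter"
  where "uniformity_lsq = (INF e\<in>{0<..}. principal {(x, y). dist x y < e})"

definition open_lsq :: "'a lsq set \<Rightarrow> bool"
  where "open_lsq U \<longleftrightarrow> (\<forall>x\<in>U. eventually (\<lambda>(x', y). x' = x \<longrightarrow> y \<in> U) uniformity)"

instance
proof
  fix x y z :: "'a lsq" and r s :: real
  show "x + y + z = x + (y + z)"
    by transfer (auto simp: L2_add add.assoc)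
  show "x + y = y + x"
    by transfer (auto simp: L2_add add.commute)
  show "0 + x = x"
    by transfer simp
  show "- x + x = 0"
    by transfer simp
  show "x - y = x + - y"
    by transfer (auto simp: L2_diff)
  show "r *\<^sub>R (x + y) = r *\<^sub>R x + r *\<^sub>R y"
    unfolding scaleR_lsq_def by transfer (auto simp: L2_add L2_mult distrib_left)
  show "(r + s) *\<^sub>R x = r *\<^sub>R x + s *\<^sub>R x"
    unfolding scaleR_lsq_def by transfer (auto simp: L2_add L2_mult distrib_right)
  show "r *\<^sub>R s *\<^sub>R x = (r * s) *\<^sub>R x"
    unfolding scaleR_lsq_def by transfer (auto simp: L2_mult mult.assoc)
  show "1 *\<^sub>R x = x"
    unfolding scaleR_lsq_def by transfer simp
  show "dist x y = norm (x - y)"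
    by (rule dist_lsq_def)
  show "sgn x = inverse (norm x) *\<^sub>R x"
    by (rule sgn_lsq_def)
  show "uniformity = (INF e\<in>{0<..}. principal {(x, y :: 'a lsq). dist x y < e})"
    by (rule uniformity_lsq_def)
  show "open U \<longleftrightarrow> (\<forall>x\<in>U. eventually (\<lambda>(x', y). x' = x \<longrightarrow> y \<in> U) uniformity)" for U :: "'a lsq set"
    by (rule open_lsq_def)
  show "inner x y = inner y x"
    unfolding inner_lsq_def by transfer (subst l2_inner_commute, simp)
  show "inner (x + y) z = inner x z + inner y z"
    unfolding inner_lsq_def by transfer (simp add: l2_inner_add_left)
  show "inner (r *\<^sub>R x) y = r * inner x y"
    unfolding inner_lsq_def scaleR_lsq_def by transfer (simp add: l2_inner_mult_left)
  show "0 \<le> inner x x"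
    unfolding inner_lsq_def by transfer (simp add: l2_inner_self)
  show "inner x x = 0 \<longleftrightarrow> x = 0"
    unfolding inner_lsq_def by transfer (simp add: l2_inner_self l2_norm_eq_0_iff)
  show "norm x = sqrt (inner x x)"
    by (rule norm_lsq_def)
qed

end

lemma rep_lsq_L2 [simp]: "rep_lsq x \<in> L2"
  using Quotient3_rep_reflp[OF Quotient3_lsq] by blast

lemma abs_rep_lsq [simp]: "abs_lsq (rep_lsq x) = x"
  by (rule Quotient3_abs_rep[OF Quotient3_lsq])

lemma abs_lsq_eq_iff:
  assumes "f \<in> L2" "g \<in> L2"
  shows "abs_lsq f = abs_lsq g \<longleftrightarrow> (AE x in lborel. f x = g x)"
  using Quotient3_rel[OF Quotient3_lsq, of f g] assms by auto

lemma abs_lsq_eq_0_iff: "f \<in> L2 \<Longrightarrow> abs_lsq f = 0 \<longleftrightarrow> (AE x in lborel. f x = 0)"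
  by (simp add: zero_lsq.abs_eq abs_lsq_eq_iff)

lemma abs_lsq_add: "f \<in> L2 \<Longrightarrow> g \<in> L2 \<Longrightarrow> abs_lsq (\<lambda>x. f x + g x) = abs_lsq f + abs_lsq g"
  by (simp add: plus_lsq.abs_eq)

lemma abs_lsq_diff: "f \<in> L2 \<Longrightarrow> g \<in> L2 \<Longrightarrow> abs_lsq (\<lambda>x. f x - g x) = abs_lsq f - abs_lsq g"
  by (simp add: minus_lsq.abs_eq)

lemma abs_lsq_mult: "f \<in> L2 \<Longrightarrow> abs_lsq (\<lambda>x. a * f x) = lsq_cscale a (abs_lsq f)"
  by (simp add: lsq_cscale.abs_eq)

lemma abs_lsq_sum:
  "(\<And>i. i \<in> I \<Longrightarrow> f i \<in> L2) \<Longrightarrow> abs_lsq (\<lambda>x. \<Sum>i\<in>I. f i x) = (\<Sum>i\<in>I. abs_lsq (f i))"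
  by (induction I rule: infinite_finite_induct) (auto simp: zero_lsq.abs_eq abs_lsq_add L2_sum)

lemma lsq_cinner_abs: "f \<in> L2 \<Longrightarrow> g \<in> L2 \<Longrightarrow> lsq_cinner (abs_lsq f) (abs_lsq g) = l2_inner f g"
  by (simp add: lsq_cinner.abs_eq)

lemma norm_abs_lsq: "f \<in> L2 \<Longrightarrow> norm (abs_lsq f) = l2_norm f"
  by (simp add: norm_lsq_def inner_lsq_def lsq_cinner_abs l2_inner_self)

instance lsq :: (euclidean_space) banach
proof
  fix X :: "nat \<Rightarrow> 'a lsq"
  assume X: "Cauchy X"
  have "\<exists>N. \<forall>m\<ge>N. \<forall>n\<ge>N. norm (X m - X n) < (1/4) ^ k" for k
    using CauchyD[OF X, of "(1/4) ^ k"] by simp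
  then obtain N where N: "\<And>k m n. m \<ge> N k \<Longrightarrow> n \<ge> N k \<Longrightarrow> norm (X m - X n) < (1/4) ^ k"
    by metis
  \<comment> \<open>The partial sums dominate each \<open>N k\<close>, and the extra summand
    \<open>k\<close> makes \<open>r\<close> strictly increasing; along \<open>r\<close> the
    increments are below 4^(-k).\<close>
  define r where "r k = (\<Sum>i\<le>k. N i) + k" for k
  have r: "strict_mono r"
    by (rule strict_mono_Suc_iff[THEN iffD2]) (simp add: r_def)
  have rN: "r k \<ge> N k" for k
    unfolding r_def by (intro trans_le_add1 member_le_sum) auto
  define f where "f k = rep_lsq (X (r k))" for k
  have f: "f k \<in> L2" for k
    by (simp add: f_def)
  have norm_f: "l2_norm (\<lambda>x. f m x - f n x) = norm (X (r m) - X (r n))" for m n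
    by (simp add: norm_abs_lsq[symmetric] L2_diff f abs_lsq_diff) (simp add: f_def)
  have "\<exists>g\<in>L2. (\<lambda>n. l2_norm (\<lambda>x. f n x - g x)) \<longlonglongrightarrow> 0"
  proof (rule L2_complete[OF f])
    show "\<exists>N. \<forall>m\<ge>N. \<forall>n\<ge>N. l2_norm (\<lambda>x. f m x - f n x) < e" if "e > 0" for e
      unfolding norm_f using CauchyD[OF Cauchy_subseq_Cauchy[OF X r] that] by (simp add: o_def)
    show "l2_norm (\<lambda>x. f (Suc k) x - f k x) \<le> (1/4) ^ k" for k
      unfolding norm_f using rN[of k] strict_mono_leD[OF r, of k "Suc k"]
      by (intro N[THEN less_imp_le]) linarith+
  qed
  then obtain g where g: "g \<in> L2" "(\<lambda>n. l2_norm (\<lambda>x. f n x - g x)) \<longlonglongrightarrow> 0"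
    by blast
  have "l2_norm (\<lambda>x. f n x - g x) = norm ((X \<circ> r) n - abs_lsq g)" for n
    by (simp add: norm_abs_lsq[symmetric] L2_diff f g abs_lsq_diff) (simp add: f_def)
  then have "(X \<circ> r) \<longlonglongrightarrow> abs_lsq g"
    using g(2) by (simp only: tendsto_norm_zero_iff LIM_zero_iff)
  then have "X \<longlonglongrightarrow> abs_lsq g"
    using X r Cauchy_converges_subseq by blast
  then show "convergent X"
    by (auto simp: convergent_def)
qed

section \<open>Trace class operators\<close>

lemma l2_norm_mult: "l2_norm (\<lambda>x. a * f x) = cmod a * l2_norm f"
  unfolding l2_norm_def by (simp add: norm_mult power_mult_distrib real_sqrt_mult)

lemma norm_lsq_cscale: "norm (lsq_cscale a x) = cmod a * norm x"
proof -
  have "norm (lsq_cscale a (abs_lsq (rep_lsq x))) = cmod a * norm (abs_lsq (rep_lsq x))"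
    by (simp only: abs_lsq_mult[symmetric] rep_lsq_L2 norm_abs_lsq L2_mult l2_norm_mult)
  then show ?thesis
    by simp
qed

lemma lsq_cscale_add: "lsq_cscale a (x + y) = lsq_cscale a x + lsq_cscale a y"
  by transfer (auto simp: L2_add L2_mult distrib_left)

lemma lsq_cscale_cscale: "lsq_cscale a (lsq_cscale b x) = lsq_cscale (a * b) x"
  by transfer (auto simp: L2_mult mult.assoc)

lemma lsq_cscale_add_left: "lsq_cscale (a + b) x = lsq_cscale a x + lsq_cscale b x"
  by transfer (auto simp: L2_add L2_mult distrib_right)

lemma bounded_linear_lsq_cscale: "bounded_linear (lsq_cscale a)"
proof (rule bounded_linear_intro[where K="cmod a"])
  show "lsq_cscale a (r *\<^sub>R x) = r *\<^sub>R lsq_cscale a x" for r x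
    by (simp add: scaleR_lsq_def lsq_cscale_cscale mult.commute)
qed (simp_all add: lsq_cscale_add norm_lsq_cscale mult.commute)

text \<open>Multiplication by the imaginary unit as a bounded real operator: a real linear operator
  is complex linear exactly when it commutes with \<open>lsq_i\<close>.\<close>

definition lsq_i :: "'a::euclidean_space lsq \<Rightarrow>\<^sub>L 'a lsq"
  where "lsq_i = Blinfun (lsq_cscale \<i>)"

lemma lsq_i_apply: "lsq_i x = lsq_cscale \<i> x"
  by (simp add: lsq_i_def bounded_linear_Blinfun_apply bounded_linear_lsq_cscale)

lemma lsq_cscale_conv: "lsq_cscale a x = Re a *\<^sub>R x + Im a *\<^sub>R lsq_i x"
  by (simp add: lsq_i_apply scaleR_lsq_def lsq_cscale_cscale lsq_cscale_add_left[symmetric]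
      complex_eq[symmetric] mult.commute)

lemma lsq_i_i: "lsq_i (lsq_i x) = - x"
  using lsq_cscale_conv[of "-1" x] by (simp add: lsq_i_apply lsq_cscale_cscale)

lemma lsq_cinner_commute: "lsq_cinner y x = cnj (lsq_cinner x y)"
  by transfer (rule l2_inner_commute)

lemma lsq_cinner_cscale_left: "lsq_cinner (lsq_cscale a x) y = a * lsq_cinner x y"
  by transfer (rule l2_inner_mult_left)

lemma lsq_cinner_cscale_right: "lsq_cinner x (lsq_cscale a y) = cnj a * lsq_cinner x y"
  by transfer (rule l2_inner_mult_right)

lemma Re_lsq_cinner: "Re (lsq_cinner x y) = x \<bullet> y"
  by (simp add: inner_lsq_def)

text \<open>The inner product is conjugate linear in its second argument, so its imaginary part is
  the real inner product with \<open>lsq_i y\<close>. Real statements about operators thus transfer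
  to complex ones.\<close>

lemma lsq_cinner_conv: "lsq_cinner x y = Complex (x \<bullet> y) (x \<bullet> lsq_i y)"
  by (simp add: complex_eq_iff Re_lsq_cinner[symmetric] lsq_i_apply lsq_cinner_cscale_right)

lemma lsq_i_skew: "lsq_i x \<bullet> y = - (x \<bullet> lsq_i y)"
  by (simp add: Re_lsq_cinner[symmetric] lsq_i_apply lsq_cinner_cscale_right lsq_cinner_cscale_left)

lemma lsq_cinner_add_left: "lsq_cinner (x + y) z = lsq_cinner x z + lsq_cinner y z"
  by (simp add: lsq_cinner_conv inner_add_left complex_eq_iff)

lemma lsq_cinner_diff_left: "lsq_cinner (x - y) z = lsq_cinner x z - lsq_cinner y z"
  by (simp add: lsq_cinner_conv inner_diff_left complex_eq_iff)

lemma lsq_cinner_self: "lsq_cinner x x = of_real ((norm x)\<^sup>2)"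
  using lsq_i_skew[of x x]
  by (simp add: lsq_cinner_conv complex_eq_iff power2_norm_eq_inner inner_commute)

lemma norm_lsq_cinner_le: "cmod (lsq_cinner x y) \<le> norm x * norm y"
proof -
  \<comment> \<open>The phase \<open>z\<close> rotates the inner product onto the nonnegative axis,
    where the real Cauchy-Schwarz inequality applies.\<close>
  define z where "z = cnj (sgn (lsq_cinner x y))"
  have "z * lsq_cinner x y = of_real (cmod (lsq_cinner x y))"
    by (cases "lsq_cinner x y = 0")
      (auto simp: z_def sgn_div_norm complex_norm_square[symmetric] power2_eq_square scaleR_conv_of_real field_simps)
  then have "cmod (lsq_cinner x y) = Re (lsq_cinner (lsq_cscale z x) y)"
    by (simp add: lsq_cinner_cscale_left)
  also have "\<dots> \<le> norm (lsq_cscale z x) * norm y"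
    unfolding Re_lsq_cinner by (rule norm_cauchy_schwarz)
  also have "\<dots> \<le> 1 * norm x * norm y"
    unfolding norm_lsq_cscale by (intro mult_right_mono) (auto simp: z_def norm_sgn)
  finally show ?thesis
    by simp
qed

lemma cmod_l2_inner_le: "f \<in> L2 \<Longrightarrow> g \<in> L2 \<Longrightarrow> cmod (l2_inner f g) \<le> l2_norm f * l2_norm g"
  using norm_lsq_cinner_le[of "abs_lsq f" "abs_lsq g"] by (simp add: lsq_cinner_abs norm_abs_lsq)

lemma bounded_linear_lsq_cinner_left: "bounded_linear (\<lambda>x. lsq_cinner x y)"
proof (rule bounded_linear_intro[where K="norm y"])
  show "lsq_cinner (r *\<^sub>R x) y = r *\<^sub>R lsq_cinner x y" for r x
    by (simp add: scaleR_lsq_def lsq_cinner_cscale_left scaleR_conv_of_real)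
qed (simp_all add: lsq_cinner_add_left norm_lsq_cinner_le)

lemma blinfun_cscale:
  fixes T :: "'a::euclidean_space lsq \<Rightarrow>\<^sub>L 'a lsq"
  assumes "lsq_i o\<^sub>L T = T o\<^sub>L lsq_i"
  shows "T (lsq_cscale a x) = lsq_cscale a (T x)"
proof -
  have "T (lsq_i x) = lsq_i (T x)"
    using assms by (metis blinfun_apply_blinfun_compose)
  then show ?thesis
    by (simp add: lsq_cscale_conv blinfun.bilinear_simps)
qed

text \<open>Real symmetry handles the real part, and commutation with \<open>lsq_i\<close> reduces
  the imaginary part to it; together they give complex self-adjointness.\<close>

lemma lsq_cinner_pos_commute:
  fixes T :: "'a::euclidean_space lsq \<Rightarrow>\<^sub>L 'a lsq"
  assumes "pos_blinfun T" "lsq_i o\<^sub>L T = T o\<^sub>L lsq_i"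
  shows "lsq_cinner (T x) y = lsq_cinner x (T y)"
proof -
  have "T (lsq_i y) = lsq_i (T y)" for y
    using assms by (metis blinfun_apply_blinfun_compose)
  then show ?thesis
    by (simp add: lsq_cinner_conv pos_blinfunD[OF assms(1)])
qed

section \<open>Operators on functions and operators on classes\<close>

definition lsq_op :: "(('a::euclidean_space \<Rightarrow> complex) \<Rightarrow> 'a \<Rightarrow> complex) \<Rightarrow> 'a lsq \<Rightarrow>\<^sub>L 'a lsq"
  where "lsq_op D = Blinfun (\<lambda>x. abs_lsq (D (rep_lsq x)))"

definition fun_op :: "('a::euclidean_space lsq \<Rightarrow>\<^sub>L 'a lsq) \<Rightarrow> ('a \<Rightarrow> complex) \<Rightarrow> 'a \<Rightarrow> complex"
  where "fun_op T f = rep_lsq (T (abs_lsq f))"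

lemma bounded_opD:
  assumes "bounded_op D"
  shows "f \<in> L2 \<Longrightarrow> D f \<in> L2"
    and "f \<in> L2 \<Longrightarrow> g \<in> L2 \<Longrightarrow> AE x in lborel. D (\<lambda>y. a * f y + b * g y) x = a * D f x + b * D g x"
    and "\<exists>C. \<forall>f\<in>L2. l2_norm (D f) \<le> C * l2_norm f"
  using assms by (auto simp: bounded_op_def)

lemma abs_lsq_bounded_op_combination:
  assumes D: "bounded_op D" and f: "f \<in> L2" and g: "g \<in> L2"
  shows "abs_lsq (D (\<lambda>y. a * f y + b * g y)) = lsq_cscale a (abs_lsq (D f)) + lsq_cscale b (abs_lsq (D g))"
proof -
  have "abs_lsq (D (\<lambda>y. a * f y + b * g y)) = abs_lsq (\<lambda>x. a * D f x + b * D g x)"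
    using bounded_opD[OF D] f g by (subst abs_lsq_eq_iff) (auto intro!: L2_add L2_mult)
  then show ?thesis
    using bounded_opD(1)[OF D] f g by (simp add: abs_lsq_add abs_lsq_mult L2_mult)
qed

text \<open>The difference of \<open>f\<close> and \<open>g\<close> has norm 0, so boundedness makes
  its image null; almost everywhere linearity splits that image. Hence \<open>lsq_op\<close> does
  not depend on the representatives picked by \<open>rep_lsq\<close>.\<close>

lemma abs_lsq_bounded_op_cong:
  assumes D: "bounded_op D" and f: "f \<in> L2" and g: "g \<in> L2" and eq: "abs_lsq f = abs_lsq g"
  shows "abs_lsq (D f) = abs_lsq (D g)"
proof -
  obtain C where C: "\<And>f. f \<in> L2 \<Longrightarrow> l2_norm (D f) \<le> C * l2_norm f"
    using bounded_opD(3)[OF D] by blast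
  let ?d = "\<lambda>y. 1 * f y + (-1) * g y"
  have d: "?d \<in> L2"
    using f g by (intro L2_add L2_mult)
  have "norm (abs_lsq ?d) = 0"
    using f g eq by (simp add: abs_lsq_diff)
  then have "norm (abs_lsq (D ?d)) \<le> 0"
    using C[OF d] bounded_opD(1)[OF D d] d by (simp only: norm_abs_lsq mult_zero_right)
  then have "abs_lsq (D ?d) = 0"
    by simp
  then show ?thesis
    unfolding abs_lsq_bounded_op_combination[OF D f g] by (simp add: lsq_cscale_conv)
qed

lemma bounded_linear_lsq_op:
  assumes D: "bounded_op D"
  shows "bounded_linear (\<lambda>x. abs_lsq (D (rep_lsq x)))"
proof -
  obtain C where C: "\<And>f. f \<in> L2 \<Longrightarrow> l2_norm (D f) \<le> C * l2_norm f"
    using bounded_opD(3)[OF D] by blast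
  show ?thesis
  proof (rule bounded_linear_intro[where K=C])
    fix x y :: "'a lsq" and r :: real
    have "abs_lsq (D (rep_lsq (x + y))) = abs_lsq (D (\<lambda>t. 1 * rep_lsq x t + 1 * rep_lsq y t))"
      by (rule abs_lsq_bounded_op_cong[OF D]) (simp_all add: L2_add abs_lsq_add)
    then show "abs_lsq (D (rep_lsq (x + y))) = abs_lsq (D (rep_lsq x)) + abs_lsq (D (rep_lsq y))"
      by (simp only: abs_lsq_bounded_op_combination[OF D] rep_lsq_L2) (simp add: lsq_cscale_conv)
    \<comment> \<open>The zero summand brings scalar multiplication into the two-term form in which
      \<open>bounded_op\<close> states linearity.\<close>
    have "abs_lsq (D (rep_lsq (r *\<^sub>R x))) = abs_lsq (D (\<lambda>t. of_real r * rep_lsq x t + 0 * rep_lsq x t))"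
      by (rule abs_lsq_bounded_op_cong[OF D]) (simp_all add: L2_mult abs_lsq_mult scaleR_lsq_def)
    then show "abs_lsq (D (rep_lsq (r *\<^sub>R x))) = r *\<^sub>R abs_lsq (D (rep_lsq x))"
      by (simp only: abs_lsq_bounded_op_combination[OF D] rep_lsq_L2) (simp add: lsq_cscale_conv)
    show "norm (abs_lsq (D (rep_lsq x))) \<le> norm x * C"
      using C[of "rep_lsq x"] norm_abs_lsq[of "rep_lsq x"] bounded_opD(1)[OF D]
      by (simp add: norm_abs_lsq mult.commute)
  qed
qed

lemma lsq_op_abs:
  assumes "bounded_op D" "f \<in> L2"
  shows "lsq_op D (abs_lsq f) = abs_lsq (D f)"
proof -
  have "lsq_op D (abs_lsq f) = abs_lsq (D (rep_lsq (abs_lsq f)))"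
    by (simp add: lsq_op_def bounded_linear_Blinfun_apply bounded_linear_lsq_op assms)
  also have "\<dots> = abs_lsq (D f)"
    by (rule abs_lsq_bounded_op_cong[OF assms(1) _ assms(2)]) (simp_all add: assms(2))
  finally show ?thesis .
qed

lemma lsq_op_commute_i:
  fixes D :: "('a::euclidean_space \<Rightarrow> complex) \<Rightarrow> 'a \<Rightarrow> complex"
  assumes D: "bounded_op D"
  shows "lsq_i o\<^sub>L lsq_op D = lsq_op D o\<^sub>L lsq_i"
proof (rule blinfun_eqI)
  fix x :: "'a lsq"
  have "lsq_i x = abs_lsq (\<lambda>t. \<i> * rep_lsq x t + 0 * rep_lsq x t)"
    by (simp add: lsq_i_apply abs_lsq_mult)
  then have "lsq_op D (lsq_i x) = abs_lsq (D (\<lambda>t. \<i> * rep_lsq x t + 0 * rep_lsq x t))"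
    by (simp only: lsq_op_abs[OF D] rep_lsq_L2 L2_add L2_mult)
  also have "\<dots> = lsq_i (abs_lsq (D (rep_lsq x)))"
    by (simp only: abs_lsq_bounded_op_combination[OF D] rep_lsq_L2) (simp add: lsq_cscale_conv)
  also have "abs_lsq (D (rep_lsq x)) = lsq_op D x"
    using lsq_op_abs[OF D, of "rep_lsq x"] by simp
  finally show "(lsq_i o\<^sub>L lsq_op D) x = (lsq_op D o\<^sub>L lsq_i) x"
    by simp
qed

lemma abs_fun_op: "f \<in> L2 \<Longrightarrow> abs_lsq (fun_op T f) = T (abs_lsq f)"
  by (simp add: fun_op_def)

lemma bounded_op_fun_op:
  assumes "lsq_i o\<^sub>L T = T o\<^sub>L lsq_i"
  shows "bounded_op (fun_op T)"
  unfolding bounded_op_def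
proof (intro conjI ballI allI)
  show "fun_op T f \<in> L2" for f
    by (simp add: fun_op_def)
  show "\<exists>C. \<forall>f\<in>L2. l2_norm (fun_op T f) \<le> C * l2_norm f"
    using norm_blinfun[of T]
    by (intro exI[of _ "norm T"] ballI) (simp add: norm_abs_lsq[symmetric] abs_fun_op fun_op_def)
  show "AE x in lborel. fun_op T (\<lambda>y. a * f y + b * g y) x = a * fun_op T f x + b * fun_op T g x"
    if "f \<in> L2" "g \<in> L2" for f g a b
    using that blinfun_cscale[OF assms]
    by (subst abs_lsq_eq_iff[symmetric])
      (auto simp: fun_op_def abs_lsq_add abs_lsq_mult L2_add L2_mult blinfun.bilinear_simps)
qed

lemma lsq_cinner_lsq_op:
  assumes "bounded_op D" "f \<in> L2" "g \<in> L2"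
  shows "l2_inner (D f) g = lsq_cinner (lsq_op D (abs_lsq f)) (abs_lsq g)"
  using assms bounded_opD(1)[OF assms(1)] by (simp add: lsq_op_abs lsq_cinner_abs)

text \<open>Polarization of the vanishing imaginary part gives symmetry.\<close>

lemma pos_blinfun_lsq_op:
  assumes A: "positive_op A"
  shows "pos_blinfun (lsq_op A)"
proof -
  have bA: "bounded_op A"
    using A by (simp add: positive_op_def)
  define T where "T = lsq_op A"
  have Ti: "T (lsq_i x) = lsq_i (T x)" for x
    using lsq_op_commute_i[OF bA] unfolding T_def by (metis blinfun_apply_blinfun_compose)
  have form: "lsq_cinner (T x) x \<in> \<real>\<^sub>\<ge>\<^sub>0" for x
    using A rep_lsq_L2[of x] lsq_cinner_lsq_op[OF bA rep_lsq_L2 rep_lsq_L2, of x x]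
    unfolding positive_op_def T_def abs_rep_lsq by metis
  then have nonneg: "0 \<le> T x \<bullet> x" and im: "T x \<bullet> lsq_i x = 0" for x
    using form[of x] by (auto simp: lsq_cinner_conv complex_nonneg_Reals_iff)
  have polar: "T x \<bullet> lsq_i y + T y \<bullet> lsq_i x = 0" for x y
    using im[of "x + y"] im[of x] im[of y] by (simp add: blinfun.bilinear_simps inner_add)
  \<comment> \<open>Replacing \<open>y\<close> by \<open>lsq_i y\<close> in \<open>polar\<close>
    turns the sum into the difference of the two sides, as \<open>lsq_i\<close> squares to -1 and
    preserves the real inner product.\<close>
  have "T x \<bullet> y = x \<bullet> T y" for x y
    using polar[of x "lsq_i y"] lsq_i_skew[of "T y" "lsq_i x"]
    by (simp add: Ti lsq_i_i inner_commute)
  then show ?thesis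
    using nonneg by (simp add: pos_blinfun_def T_def)
qed

text \<open>The choice in \<open>op_abs\<close> has a witness: the positive root of the adjoint of D
  times D, formed on classes and carried back by \<open>fun_op\<close>. The root commutes with
  \<open>lsq_i\<close> because that product does, so the result is complex linear.\<close>

lemma op_abs_props:
  assumes D: "bounded_op D"
  shows "positive_op (op_abs D)"
    and "f \<in> L2 \<Longrightarrow> g \<in> L2 \<Longrightarrow> l2_inner (op_abs D (op_abs D f)) g = l2_inner (D f) (D g)"
proof -
  define T where "T = lsq_op D"
  have Ti: "T (lsq_i x) = lsq_i (T x)" for x
    using lsq_op_commute_i[OF D] unfolding T_def by (metis blinfun_apply_blinfun_compose)
  obtain T' where T': "\<And>x y. blinfun_apply T' x \<bullet> y = x \<bullet> T y"
    using adjoint_exists[of T] by blast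
  have "pos_blinfun (T' o\<^sub>L T)"
    unfolding pos_blinfun_def
  proof (intro conjI allI)
    show "(T' o\<^sub>L T) x \<bullet> y = x \<bullet> (T' o\<^sub>L T) y" for x y
      using T'[of "T x" y] T'[of "T y" x] by (simp add: inner_commute)
    show "0 \<le> (T' o\<^sub>L T) x \<bullet> x" for x
      using T'[of "T x" x] by simp
  qed
  then obtain A where A: "pos_blinfun A" "A o\<^sub>L A = T' o\<^sub>L T"
      and com: "\<And>S. S o\<^sub>L (T' o\<^sub>L T) = (T' o\<^sub>L T) o\<^sub>L S \<Longrightarrow> S o\<^sub>L A = A o\<^sub>L S"
    using pos_sqrt_exists by blast
  \<comment> \<open>The adjoint inherits complex linearity because \<open>lsq_i\<close> is
    skew.\<close>
  have T'i: "T' (lsq_i x) = lsq_i (T' x)" for x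
  proof -
    have "T' (lsq_i x) \<bullet> y = lsq_i (T' x) \<bullet> y" for y
      by (simp add: T' lsq_i_skew Ti[symmetric])
    then show ?thesis
      by (metis vector_eq_rdot)
  qed
  have Ai: "lsq_i o\<^sub>L A = A o\<^sub>L lsq_i"
    by (rule com) (auto intro!: blinfun_eqI simp: Ti T'i)
  have bA: "bounded_op (fun_op A)"
    by (rule bounded_op_fun_op[OF Ai])
  have "positive_op (fun_op A)"
    unfolding positive_op_def
  proof (intro conjI ballI bA)
    fix f :: "'a \<Rightarrow> complex" assume f: "f \<in> L2"
    have "l2_inner (fun_op A f) f = lsq_cinner (A (abs_lsq f)) (abs_lsq f)"
      using f by (simp add: lsq_cinner_abs[symmetric] bounded_opD(1)[OF bA] abs_fun_op)
    moreover have "Im (lsq_cinner (A (abs_lsq f)) (abs_lsq f)) = 0"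
      using lsq_cinner_pos_commute[OF A(1) Ai, of "abs_lsq f" "abs_lsq f"]
        lsq_cinner_commute[of "A (abs_lsq f)" "abs_lsq f"] by (simp add: complex_eq_iff)
    ultimately show "l2_inner (fun_op A f) f \<in> \<real>\<^sub>\<ge>\<^sub>0"
      using pos_blinfunD(2)[OF A(1)] by (simp add: complex_nonneg_Reals_iff Re_lsq_cinner)
  qed
  moreover have "l2_inner (fun_op A (fun_op A f)) g = l2_inner (D f) (D g)" if f: "f \<in> L2" and g: "g \<in> L2" for f g
  proof -
    have AA: "A (A x) = T' (T x)" for x
      using A(2) by (metis blinfun_apply_blinfun_compose)
    have "l2_inner (fun_op A (fun_op A f)) g = lsq_cinner (A (A (abs_lsq f))) (abs_lsq g)"
      using f g by (simp add: lsq_cinner_abs[symmetric] bounded_opD(1)[OF bA] abs_fun_op)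
    also have "\<dots> = lsq_cinner (T (abs_lsq f)) (T (abs_lsq g))"
      by (simp add: AA lsq_cinner_conv T' Ti)
    also have "\<dots> = l2_inner (D f) (D g)"
      using f g by (simp add: T_def lsq_op_abs D bounded_opD(1)[OF D] lsq_cinner_abs)
    finally show ?thesis .
  qed
  ultimately have *: "\<exists>A. positive_op A \<and> (\<forall>f\<in>L2. \<forall>g\<in>L2. l2_inner (A (A f)) g = l2_inner (D f) (D g))"
    by blast
  from someI_ex[OF *]
  show "positive_op (op_abs D)"
    and "f \<in> L2 \<Longrightarrow> g \<in> L2 \<Longrightarrow> l2_inner (op_abs D (op_abs D f)) g = l2_inner (D f) (D g)"
    unfolding op_abs_def by auto
qed

lemma positive_op_bounded: "positive_op A \<Longrightarrow> bounded_op A"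
  by (simp add: positive_op_def)

text \<open>Symmetry turns the squared norm of |D| x into the form of |D|^2 at x, which is the
  squared norm of D x. This is the norm identity from which the factorization of D is built.\<close>

lemma norm_lsq_op_abs:
  assumes D: "bounded_op D"
  shows "norm (lsq_op (op_abs D) x) = norm (lsq_op D x)"
proof -
  note bA = positive_op_bounded[OF op_abs_props(1)[OF D]]
  define f where "f = rep_lsq x"
  have f: "f \<in> L2" "x = abs_lsq f"
    by (simp_all add: f_def)
  have "(norm (lsq_op (op_abs D) x))\<^sup>2 = lsq_op (op_abs D) (lsq_op (op_abs D) x) \<bullet> x"
    by (simp add: power2_norm_eq_inner pos_blinfunD[OF pos_blinfun_lsq_op[OF op_abs_props(1)[OF D]]])
  also have "\<dots> = Re (l2_inner (op_abs D (op_abs D f)) f)"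
    using f by (simp add: lsq_cinner_lsq_op bounded_opD(1)[OF bA] bA lsq_op_abs Re_lsq_cinner)
  also have "\<dots> = (norm (lsq_op D x))\<^sup>2"
    using f by (simp add: op_abs_props(2)[OF D] l2_inner_self lsq_op_abs D bounded_opD(1)[OF D] norm_abs_lsq)
  finally show ?thesis
    by simp
qed

text \<open>A positive operator is itself a positive root of its adjoint times itself, so uniqueness
  of roots applies. Equality holds on classes; as maps on functions the two may differ on null
  sets.\<close>

lemma lsq_op_abs_positive:
  assumes D: "positive_op D"
  shows "lsq_op (op_abs D) = lsq_op D"
proof (rule pos_sqrt_unique)
  have bD: "bounded_op D"
    by (rule positive_op_bounded[OF D])
  note bA = op_abs_props(1)[OF bD]
  show A: "pos_blinfun (lsq_op (op_abs D))" and T: "pos_blinfun (lsq_op D)"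
    using D bA by (auto intro: pos_blinfun_lsq_op)
  show "lsq_op (op_abs D) o\<^sub>L lsq_op (op_abs D) = lsq_op D o\<^sub>L lsq_op D"
  proof (rule blinfun_eqI)
    fix x
    have "lsq_op (op_abs D) (lsq_op (op_abs D) x) \<bullet> y = lsq_op D (lsq_op D x) \<bullet> y" for y
    proof -
      define f g where "f = rep_lsq x" and "g = rep_lsq y"
      have fg: "f \<in> L2" "x = abs_lsq f" "g \<in> L2" "y = abs_lsq g"
        by (simp_all add: f_def g_def)
      have "lsq_op (op_abs D) (lsq_op (op_abs D) x) \<bullet> y = Re (l2_inner (op_abs D (op_abs D f)) g)"
        using fg positive_op_bounded[OF bA]
        by (simp add: lsq_cinner_lsq_op bounded_opD(1) lsq_op_abs Re_lsq_cinner)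
      also have "\<dots> = lsq_op D x \<bullet> lsq_op D y"
        using fg bD by (simp add: op_abs_props(2) lsq_op_abs bounded_opD(1)[OF bD] Re_lsq_cinner[symmetric] lsq_cinner_abs)
      finally show ?thesis
        by (simp add: pos_blinfunD(1)[OF T])
    qed
    then show "(lsq_op (op_abs D) o\<^sub>L lsq_op (op_abs D)) x = (lsq_op D o\<^sub>L lsq_op D) x"
      by simp (metis vector_eq_rdot)
  qed
qed

section \<open>Traces and expansion over the basis\<close>

lemma l2_basis_orthonormal: "orthonormal_basis (l2_basis :: ('a::euclidean_space \<Rightarrow> complex) set)"
  unfolding l2_basis_def using orthonormal_basis_exists by (rule someI_ex)

lemma l2_basisD:
  assumes "e \<in> l2_basis"
  shows "e \<in> L2" and "e' \<in> l2_basis \<Longrightarrow> l2_inner e e' = (if e = e' then 1 else 0)"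
  using assms l2_basis_orthonormal unfolding orthonormal_basis_def by blast+

lemma l2_basis_total:
  assumes "\<And>e. e \<in> l2_basis \<Longrightarrow> lsq_cinner x (abs_lsq e) = 0"
  shows "x = 0"
proof -
  have "l2_inner (rep_lsq x) e = 0" if "e \<in> l2_basis" for e
    using assms[OF that] lsq_cinner_abs[of "rep_lsq x" e] l2_basisD(1)[OF that] by simp
  then have "AE t in lborel. rep_lsq x t = 0"
    using l2_basis_orthonormal rep_lsq_L2 unfolding orthonormal_basis_def by blast
  then have "abs_lsq (rep_lsq x) = 0"
    using abs_lsq_eq_0_iff[OF rep_lsq_L2] by blast
  then show ?thesis
    by simp
qed

text \<open>A summable real family has only countably many nonzero terms, so these can be listed as
  a sequence; \<open>None\<close> fills the indices to which no term is assigned. Passing to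
  sequences makes termwise integration over the basis available.\<close>

lemma nat_family_of_has_sum:
  fixes \<phi> :: "'b \<Rightarrow> real"
  assumes sum: "(\<phi> has_sum t) S"
  obtains g :: "nat \<Rightarrow> 'b option" where "(\<lambda>n. case g n of None \<Rightarrow> 0 | Some e \<Rightarrow> \<phi> e) sums t"
    "\<And>n e. g n = Some e \<Longrightarrow> e \<in> S" "\<And>m n e. g m = Some e \<Longrightarrow> g n = Some e \<Longrightarrow> m = n"
    "\<And>e. e \<in> S \<Longrightarrow> \<phi> e \<noteq> 0 \<Longrightarrow> \<exists>n. g n = Some e"
proof -
  define I where "I = {e\<in>S. \<phi> e \<noteq> 0}"
  have countable: "countable I"
    unfolding I_def using sum by (intro summable_countable_real) (auto simp: summable_on_def)
  define R where "R = to_nat_on I ` I"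
  define g where "g n = (if n \<in> R then Some (from_nat_into I n) else None)" for n
  have from_to: "from_nat_into I (to_nat_on I e) = e" if "e \<in> I" for e
    using countable that by simp
  have "(\<phi> has_sum t) I"
    using sum by (rule has_sum_cong_neutral[THEN iffD1, rotated -1]) (auto simp: I_def)
  then have "((\<lambda>n. \<phi> (from_nat_into I n)) has_sum t) R"
    unfolding R_def
    by (subst has_sum_reindex) (auto simp: countable inj_on_to_nat_on o_def from_to cong: has_sum_cong)
  then have "((\<lambda>n. case g n of None \<Rightarrow> 0 | Some e \<Rightarrow> \<phi> e) has_sum t) UNIV"
    by (rule has_sum_cong_neutral[THEN iffD1, rotated -1]) (auto simp: g_def)
  then have "(\<lambda>n. case g n of None \<Rightarrow> 0 | Some e \<Rightarrow> \<phi> e) sums t"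
    by (rule has_sum_imp_sums)
  moreover have "e \<in> S" if "g n = Some e" for n e
    using that from_to by (auto simp: g_def R_def I_def split: if_splits)
  moreover have "m = n" if "g m = Some e" "g n = Some e" for m n e
    using that from_to by (auto simp: g_def R_def split: if_splits)
  moreover have "\<exists>n. g n = Some e" if "e \<in> S" "\<phi> e \<noteq> 0" for e
    using that from_to[of e] by (intro exI[of _ "to_nat_on I e"]) (auto simp: g_def R_def I_def)
  ultimately show thesis
    by (rule that)
qed

text \<open>Moving one factor of |D| = C C across the inner product shows that the diagonal entry at
  e is the squared norm of C e. The trace of |D| is thus real, and it is the squared Hilbert-Schmidt
  norm of \<open>C\<close>.\<close>

lemma trace_class_sqrt:
  fixes D :: "('a::euclidean_space \<Rightarrow> complex) \<Rightarrow> 'a \<Rightarrow> complex"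
  assumes D: "trace_class D"
  obtains C :: "'a lsq \<Rightarrow>\<^sub>L 'a lsq" where "pos_blinfun C" "C o\<^sub>L C = lsq_op (op_abs D)" "lsq_i o\<^sub>L C = C o\<^sub>L lsq_i"
    "((\<lambda>e. (norm (C (abs_lsq e)))\<^sup>2) has_sum trace_norm D) l2_basis"
    "of_real (trace_norm D) = op_trace (op_abs D)"
proof -
  have bD: "bounded_op D" and sum: "(\<lambda>e. l2_inner (op_abs D e) e) summable_on l2_basis"
    using D by (auto simp: trace_class_def)
  note posA = op_abs_props(1)[OF bD]
  note bA = positive_op_bounded[OF posA]
  obtain C where C: "pos_blinfun C" "C o\<^sub>L C = lsq_op (op_abs D)"
      and com: "\<And>S. S o\<^sub>L lsq_op (op_abs D) = lsq_op (op_abs D) o\<^sub>L S \<Longrightarrow> S o\<^sub>L C = C o\<^sub>L S"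
    using pos_sqrt_exists[OF pos_blinfun_lsq_op[OF posA]] by blast
  have Ci: "lsq_i o\<^sub>L C = C o\<^sub>L lsq_i"
    by (intro com lsq_op_commute_i bA)
  have CC: "lsq_op (op_abs D) x = C (C x)" for x
    using C(2) by (metis blinfun_apply_blinfun_compose)
  have eq: "l2_inner (op_abs D e) e = of_real ((norm (C (abs_lsq e)))\<^sup>2)" if "e \<in> l2_basis" for e
  proof -
    have "l2_inner (op_abs D e) e = lsq_cinner (C (C (abs_lsq e))) (abs_lsq e)"
      using l2_basisD(1)[OF that] by (simp add: lsq_cinner_lsq_op bA CC)
    also have "\<dots> = lsq_cinner (C (abs_lsq e)) (C (abs_lsq e))"
      by (rule lsq_cinner_pos_commute[OF C(1) Ci])
    finally show ?thesis
      by (simp only: lsq_cinner_self)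
  qed
  have hs: "((\<lambda>e. of_real ((norm (C (abs_lsq e)))\<^sup>2)) has_sum op_trace (op_abs D)) l2_basis"
    using has_sum_infsum[OF sum] eq unfolding op_trace_def by (simp cong: has_sum_cong)
  then have sum_norm: "((\<lambda>e. (norm (C (abs_lsq e)))\<^sup>2) has_sum trace_norm D) l2_basis"
    using has_sum_Re[OF hs] by (simp add: trace_norm_def)
  have "of_real (trace_norm D) = op_trace (op_abs D)"
    using has_sum_of_real[OF sum_norm] hs by (rule has_sum_unique)
  then show thesis
    using that C Ci sum_norm by blast
qed

lemma op_trace_positive:
  assumes "trace_class D" and D: "positive_op D"
  shows "op_trace D = op_trace (op_abs D)"
proof -
  have bD: "bounded_op D"
    by (rule positive_op_bounded[OF D])
  have "l2_inner (op_abs D e) e = l2_inner (D e) e" if "e \<in> l2_basis" for e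
    using l2_basisD(1)[OF that] positive_op_bounded[OF op_abs_props(1)[OF bD]]
    by (simp add: lsq_cinner_lsq_op bD lsq_op_abs_positive[OF D])
  then show ?thesis
    unfolding op_trace_def by (simp cong: infsum_cong)
qed

text \<open>The coefficient of C f along a basis vector e is the inner product of f with C e.
  Expanding C f and applying the continuous \<open>B\<close> to each term gives the series for D f
  with b = B e and c = C e.\<close>

theorem trace_class_expansion:
  fixes D :: "('a::euclidean_space \<Rightarrow> complex) \<Rightarrow> 'a \<Rightarrow> complex"
  assumes D: "trace_class D"
  obtains b c :: "nat \<Rightarrow> 'a \<Rightarrow> complex" where
    "\<And>n. b n \<in> L2" "\<And>n. c n \<in> L2" "\<And>n. l2_norm (b n) \<le> l2_norm (c n)"
    "(\<lambda>n. (l2_norm (c n))\<^sup>2) sums trace_norm D"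
    "\<And>f. f \<in> L2 \<Longrightarrow> (\<lambda>N. l2_norm (\<lambda>x. D f x - (\<Sum>n<N. l2_inner f (c n) * b n x))) \<longlonglongrightarrow> 0"
    "positive_op D \<Longrightarrow> b = c"
proof -
  have bD: "bounded_op D"
    using D by (simp add: trace_class_def)
  obtain C :: "'a lsq \<Rightarrow>\<^sub>L 'a lsq" where C: "pos_blinfun C" "C o\<^sub>L C = lsq_op (op_abs D)"
      and Ci: "lsq_i o\<^sub>L C = C o\<^sub>L lsq_i"
      and C_sum: "((\<lambda>e. (norm (C (abs_lsq e)))\<^sup>2) has_sum trace_norm D) l2_basis"
    using trace_class_sqrt[OF D] by blast
  have CC: "lsq_op (op_abs D) x = C (C x)" for x
    using C(2) by (metis blinfun_apply_blinfun_compose)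
  have "\<exists>B::'a lsq \<Rightarrow>\<^sub>L 'a lsq. (\<forall>x. blinfun_apply B (C x) = lsq_op D x) \<and> (\<forall>x. norm (blinfun_apply B x) \<le> norm (C x)) \<and>
      lsq_i o\<^sub>L B = B o\<^sub>L lsq_i \<and> (positive_op D \<longrightarrow> B = C)"
  \<comment> \<open>For positive D the operator on classes equals |D| = C C, so \<open>C\<close>
    itself is an admissible factor.\<close>
  proof (cases "positive_op D")
    case True
    then show ?thesis
      using lsq_op_abs_positive[OF True] Ci by (intro exI[of _ C]) (simp add: CC[symmetric])
  next
    case False
    have "norm (lsq_op D x) = norm (C (C x))" for x
      using norm_lsq_op_abs[OF bD, of x] by (simp add: CC)
    then show ?thesis
      using sqrt_factorization[OF C(1), of "lsq_op D"] Ci lsq_op_commute_i[OF bD] lsq_i_skew False by blast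
  qed
  then obtain B :: "'a lsq \<Rightarrow>\<^sub>L 'a lsq" where BC: "\<And>x. B (C x) = lsq_op D x"
      and B_le: "\<And>x. norm (B x) \<le> norm (C x)" and Bi: "lsq_i o\<^sub>L B = B o\<^sub>L lsq_i" and B_pos: "positive_op D \<Longrightarrow> B = C"
    by blast
  obtain g :: "nat \<Rightarrow> ('a \<Rightarrow> complex) option" where
      g_sums: "(\<lambda>n. case g n of None \<Rightarrow> 0 | Some e \<Rightarrow> (norm (C (abs_lsq e)))\<^sup>2) sums trace_norm D"
      and g_basis: "\<And>n e. g n = Some e \<Longrightarrow> e \<in> l2_basis"
      and g_inj: "\<And>m n e. g m = Some e \<Longrightarrow> g n = Some e \<Longrightarrow> m = n"
      and g_surj: "\<And>e. e \<in> l2_basis \<Longrightarrow> (norm (C (abs_lsq e)))\<^sup>2 \<noteq> 0 \<Longrightarrow> \<exists>n. g n = Some e"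
    by (rule nat_family_of_has_sum[OF C_sum]) (rule that)
  \<comment> \<open>Padded indices give the zero vector, which is orthogonal to everything and
    contributes nothing to the sums.\<close>
  define ev where "ev n = (case g n of None \<Rightarrow> 0 | Some e \<Rightarrow> abs_lsq e)" for n
  have zero_cinner: "lsq_cinner 0 x = 0" "lsq_cinner x 0 = 0" for x :: "'a lsq"
    by (simp_all add: lsq_cinner_conv complex_eq_iff)
  have basis_cinner: "lsq_cinner (abs_lsq e) (abs_lsq e') = (if e = e' then 1 else 0)"
    if "e \<in> l2_basis" "e' \<in> l2_basis" for e e'
    using l2_basisD[OF that(1)] l2_basisD[OF that(2)] that by (simp add: lsq_cinner_abs)
  have ev_orth: "lsq_cinner (ev m) (ev n) = 0" if "m \<noteq> n" for m n
    using that by (auto simp: ev_def zero_cinner basis_cinner g_basis dest: g_inj split: option.split)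
  have ev_norm: "norm (ev n) \<le> 1" for n
  proof (cases "g n")
    case (Some e)
    then have "of_real ((norm (ev n))\<^sup>2) = (1::complex)"
      using basis_cinner[OF g_basis g_basis, of n e n e] unfolding lsq_cinner_self[symmetric] by (simp add: ev_def)
    then have "(norm (ev n))\<^sup>2 = 1"
      using of_real_eq_1_iff by blast
    then show ?thesis
      by (metis norm_ge_zero one_power2 order_refl power2_eq_imp_eq zero_le_one)
  qed (simp add: ev_def)
  have ev_sums: "(\<lambda>n. (norm (C (ev n)))\<^sup>2) sums trace_norm D"
    by (rule sums_cong[THEN iffD1, OF _ g_sums]) (auto simp: ev_def blinfun.bilinear_simps split: option.split)
  define b c where "b n = rep_lsq (B (ev n))" and "c n = rep_lsq (C (ev n))" for n
  have bL2: "b n \<in> L2" and cL2: "c n \<in> L2" for n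
    by (simp_all add: b_def c_def)
  have norm_bc: "l2_norm (b n) = norm (B (ev n))" "l2_norm (c n) = norm (C (ev n))" for n
    by (simp_all add: norm_abs_lsq[symmetric] bL2 cL2) (simp_all add: b_def c_def)
  have expand: "(\<lambda>N. l2_norm (\<lambda>x. D f x - (\<Sum>n<N. l2_inner f (c n) * b n x))) \<longlonglongrightarrow> 0" if f: "f \<in> L2" for f
  proof -
    define y where "y = abs_lsq f"
    define x where "x = C y"
    define v where "v n = lsq_cscale (lsq_cinner x (ev n)) (ev n)" for n
    have coeff: "lsq_cinner x (ev n) = lsq_cinner y (C (ev n))" for n
      unfolding x_def by (rule lsq_cinner_pos_commute[OF C(1) Ci])
    \<comment> \<open>Symmetry of \<open>C\<close> bounds the coefficients by the norm of f times
      \<open>norm (C (ev n))\<close>, and these norms are square summable by the trace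
      condition.\<close>
    have "summable v"
    proof (rule summable_orthogonal)
      show "v i \<bullet> v j = 0" if "i \<noteq> j" for i j
        unfolding v_def Re_lsq_cinner[symmetric] using ev_orth[OF that]
        by (simp add: lsq_cinner_cscale_left lsq_cinner_cscale_right)
      have v_le: "norm ((norm (v n))\<^sup>2) \<le> (norm y)\<^sup>2 * (norm (C (ev n)))\<^sup>2" for n
      proof -
        have "norm (v n) \<le> cmod (lsq_cinner x (ev n)) * 1"
          unfolding v_def norm_lsq_cscale by (intro mult_left_mono ev_norm) auto
        also have "\<dots> \<le> norm y * norm (C (ev n))"
          unfolding coeff using norm_lsq_cinner_le by simp
        finally have "(norm (v n))\<^sup>2 \<le> (norm y * norm (C (ev n)))\<^sup>2"
          by (intro power_mono) auto
        then show ?thesis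
          by (simp add: power_mult_distrib)
      qed
      have "summable (\<lambda>n. (norm y)\<^sup>2 * (norm (C (ev n)))\<^sup>2)"
        using ev_sums by (intro summable_mult) (rule sums_summable)
      then show "summable (\<lambda>n. (norm (v n))\<^sup>2)"
        by (rule summable_comparison_test') (rule v_le)
    qed
    then have v_sums: "v sums (\<Sum>n. v n)"
      by (rule summable_sums)
    have "x - (\<Sum>n. v n) = 0"
    proof (rule l2_basis_total)
      fix e :: "'a \<Rightarrow> complex" assume e: "e \<in> l2_basis"
      have s: "(\<lambda>n. lsq_cinner x (ev n) * lsq_cinner (ev n) (abs_lsq e)) sums lsq_cinner (\<Sum>n. v n) (abs_lsq e)"
        using bounded_linear.sums[OF bounded_linear_lsq_cinner_left v_sums, of "abs_lsq e"]
        by (simp add: v_def lsq_cinner_cscale_left)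
      have "(\<lambda>n. lsq_cinner x (ev n) * lsq_cinner (ev n) (abs_lsq e)) sums lsq_cinner x (abs_lsq e)"
      \<comment> \<open>A basis vector missing from the list has C e = 0, so by symmetry of
        \<open>C\<close> the vector x = C y has no component along it.\<close>
      proof (cases "\<exists>m. g m = Some e")
        case True
        then obtain m where m: "g m = Some e"
          by blast
        have ev_m: "ev m = abs_lsq e"
          by (simp add: ev_def m)
        have "lsq_cinner x (ev n) * lsq_cinner (ev n) (abs_lsq e) = (if n = m then lsq_cinner x (abs_lsq e) else 0)" for n
          using ev_orth[of n m] basis_cinner[OF e e] by (simp add: ev_m)
        then show ?thesis
          using sums_single[of m "\<lambda>n. lsq_cinner x (abs_lsq e)"] by simp
      next
        case False
        then have "C (abs_lsq e) = 0"
          using g_surj[OF e] by auto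
        then have "lsq_cinner x (abs_lsq e) = 0"
          using lsq_cinner_pos_commute[OF C(1) Ci, of y "abs_lsq e"] by (simp add: x_def zero_cinner)
        moreover have "lsq_cinner (ev n) (abs_lsq e) = 0" for n
          using False e by (auto simp: ev_def zero_cinner basis_cinner g_basis split: option.split)
        ultimately show ?thesis
          by simp
      qed
      then have "lsq_cinner x (abs_lsq e) = lsq_cinner (\<Sum>n. v n) (abs_lsq e)"
        using s sums_unique2 by blast
      then show "lsq_cinner (x - (\<Sum>n. v n)) (abs_lsq e) = 0"
        by (simp add: lsq_cinner_diff_left)
    qed
    then have "v sums x"
      using v_sums by simp
    then have "(\<lambda>n. B (v n)) sums B x"
      by (rule bounded_linear.sums[OF blinfun.bounded_linear_right])
    moreover have "B x = abs_lsq (D f)"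
      by (simp add: x_def y_def BC lsq_op_abs[OF bD f])
    moreover have "B (v n) = abs_lsq (\<lambda>x. l2_inner f (c n) * b n x)" for n
    proof -
      have "l2_inner f (c n) = lsq_cinner x (ev n)"
        unfolding coeff y_def using lsq_cinner_abs[OF f cL2[of n]] by (simp add: c_def)
      then show ?thesis
        by (simp add: abs_lsq_mult bL2 v_def blinfun_cscale[OF Bi]) (simp add: b_def)
    qed
    ultimately have "(\<lambda>N. \<Sum>n<N. abs_lsq (\<lambda>x. l2_inner f (c n) * b n x)) \<longlonglongrightarrow> abs_lsq (D f)"
      by (simp add: sums_def)
    then have "(\<lambda>N. norm (abs_lsq (D f) - (\<Sum>n<N. abs_lsq (\<lambda>x. l2_inner f (c n) * b n x)))) \<longlonglongrightarrow> norm (abs_lsq (D f) - abs_lsq (D f))"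
      by (intro tendsto_intros)
    moreover have "norm (abs_lsq (D f) - (\<Sum>n<N. abs_lsq (\<lambda>x. l2_inner f (c n) * b n x)))
        = l2_norm (\<lambda>x. D f x - (\<Sum>n<N. l2_inner f (c n) * b n x))" for N
    proof -
      have L: "D f \<in> L2" "(\<lambda>x. l2_inner f (c n) * b n x) \<in> L2" for n
        using bounded_opD(1)[OF bD f] by (auto intro: L2_mult bL2)
      then have "(\<lambda>x. \<Sum>n<N. l2_inner f (c n) * b n x) \<in> L2"
        by (intro L2_sum)
      with L show ?thesis
        by (simp add: norm_abs_lsq[symmetric] L2_diff abs_lsq_diff abs_lsq_sum)
    qed
    ultimately show ?thesis
      by simp
  qed
  show thesis
  proof (rule that[OF bL2 cL2 _ _ expand])
    show "l2_norm (b n) \<le> l2_norm (c n)" for n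
      unfolding norm_bc by (rule B_le)
    show "(\<lambda>n. (l2_norm (c n))\<^sup>2) sums trace_norm D"
      unfolding norm_bc by (rule ev_sums)
    show "b = c" if "positive_op D"
      using B_pos[OF that] by (simp add: b_def[abs_def] c_def[abs_def])
  qed
qed

section \<open>Continuity of translations\<close>

lemma nn_integral_lborel_affine:
  fixes f :: "'a::euclidean_space \<Rightarrow> ennreal"
  assumes [measurable]: "f \<in> borel_measurable borel" and c: "c \<noteq> 0"
  shows "(\<integral>\<^sup>+x. f x \<partial>lborel) = ennreal (\<bar>c\<bar> ^ DIM('a)) * (\<integral>\<^sup>+x. f (t + c *\<^sub>R x) \<partial>lborel)"
  by (subst lborel_affine[OF c, of t])
    (simp add: nn_integral_density nn_integral_distr nn_integral_cmult)

lemma integral_lborel_affine: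
  fixes f :: "'a::euclidean_space \<Rightarrow> 'b::{banach, second_countable_topology}"
  assumes [measurable]: "f \<in> borel_measurable borel" and c: "c \<noteq> 0"
  shows "(\<integral>x. f x \<partial>lborel) = \<bar>c\<bar> ^ DIM('a) *\<^sub>R (\<integral>x. f (t + c *\<^sub>R x) \<partial>lborel)"
  by (subst lborel_affine[OF c, of t]) (simp add: integral_density integral_distr)

lemma nn_integral_lborel_shift:
  fixes f :: "'a::euclidean_space \<Rightarrow> ennreal"
  assumes "f \<in> borel_measurable borel"
  shows "(\<integral>\<^sup>+x. f (x + a) \<partial>lborel) = (\<integral>\<^sup>+x. f x \<partial>lborel)"
  using nn_integral_lborel_affine[OF assms, of 1 a] by (simp add: add.commute)

lemma integral_lborel_shift:
  fixes f :: "'a::euclidean_space \<Rightarrow> 'b::{banach, second_countable_topology}"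
  assumes "f \<in> borel_measurable borel"
  shows "(\<integral>x. f (x + a) \<partial>lborel) = (\<integral>x. f x \<partial>lborel)"
  using integral_lborel_affine[OF assms, of 1 a] by (simp add: add.commute)

lemma nn_integral_lborel_uminus:
  fixes f :: "'a::euclidean_space \<Rightarrow> ennreal"
  assumes "f \<in> borel_measurable borel"
  shows "(\<integral>\<^sup>+x. f (- x) \<partial>lborel) = (\<integral>\<^sup>+x. f x \<partial>lborel)"
  using nn_integral_lborel_affine[OF assms, of "-1" 0] by simp

lemma nn_integral_lborel_pair:
  fixes f :: "'a::euclidean_space \<times> 'b::euclidean_space \<Rightarrow> ennreal"
  assumes f: "f \<in> borel_measurable borel"
  shows "(\<integral>\<^sup>+z. f z \<partial>lborel) = (\<integral>\<^sup>+x. \<integral>\<^sup>+y. f (x, y) \<partial>lborel \<partial>lborel)"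
    and "(\<integral>\<^sup>+z. f z \<partial>lborel) = (\<integral>\<^sup>+y. \<integral>\<^sup>+x. f (x, y) \<partial>lborel \<partial>lborel)"
proof -
  have f': "f \<in> borel_measurable (lborel \<Otimes>\<^sub>M lborel)"
    using f by (simp add: lborel_prod)
  show "(\<integral>\<^sup>+z. f z \<partial>lborel) = (\<integral>\<^sup>+x. \<integral>\<^sup>+y. f (x, y) \<partial>lborel \<partial>lborel)"
    using lborel.nn_integral_fst[OF f'] by (simp add: lborel_prod)
  then show "(\<integral>\<^sup>+z. f z \<partial>lborel) = (\<integral>\<^sup>+y. \<integral>\<^sup>+x. f (x, y) \<partial>lborel \<partial>lborel)"
    using lborel_pair.Fubini[OF f'] by simp
qed

lemma AE_lborel_pair:
  fixes P :: "'a::euclidean_space \<times> 'b::euclidean_space \<Rightarrow> bool"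
  assumes "AE z in lborel. P z"
  shows "AE x in lborel. AE y in lborel. P (x, y)"
  using lborel_pair.AE_pair[of P] assms unfolding lborel_prod by blast

lemma AE_lborel_pairI:
  fixes P :: "'a::euclidean_space \<times> 'b::euclidean_space \<Rightarrow> bool"
  assumes "{z. P z} \<in> sets borel" "AE x in lborel. AE y in lborel. P (x, y)"
  shows "AE z in lborel. P z"
  using lborel_pair.AE_pair_measure[of P] assms unfolding lborel_prod by simp

lemma l2_norm_add_le:
  assumes "f \<in> L2" "g \<in> L2"
  shows "l2_norm (\<lambda>x. f x + g x) \<le> l2_norm f + l2_norm g"
  using norm_triangle_ineq[of "abs_lsq f" "abs_lsq g"] assms
  by (simp add: abs_lsq_add[symmetric] norm_abs_lsq L2_add)

lemma l2_norm_diff_commute: "l2_norm (\<lambda>x. f x - g x) = l2_norm (\<lambda>x. g x - f x)"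
  by (simp add: l2_norm_def norm_minus_commute)

lemma L2_shift:
  assumes "f \<in> L2"
  shows "(\<lambda>x. f (x + a)) \<in> L2" and "l2_norm (\<lambda>x. f (x + a)) = l2_norm f"
proof -
  have [measurable]: "f \<in> borel_measurable borel"
    using assms by (rule L2_measurable)
  have "(\<integral>\<^sup>+x. ennreal ((cmod (f (x + a)))\<^sup>2) \<partial>lborel) = (\<integral>\<^sup>+x. ennreal ((cmod (f x))\<^sup>2) \<partial>lborel)"
    by (rule nn_integral_lborel_shift[where f="\<lambda>x. ennreal ((cmod (f x))\<^sup>2)"]) measurable
  with assms show 1: "(\<lambda>x. f (x + a)) \<in> L2"
    by (simp add: L2_iff_nn_integral)
  show "l2_norm (\<lambda>x. f (x + a)) = l2_norm f"
    unfolding l2_norm_def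
    by (subst integral_lborel_shift[where f="\<lambda>x. (cmod (f x))\<^sup>2"]) auto
qed

text \<open>Continuity of translation at shift 0, in sequential form so that dominated convergence
  applies directly.\<close>

definition shift_continuous :: "('a::euclidean_space \<Rightarrow> complex) \<Rightarrow> bool"
  where "shift_continuous f \<longleftrightarrow>
    (\<forall>a. a \<longlonglongrightarrow> 0 \<longrightarrow> (\<lambda>n. l2_norm (\<lambda>x. f (x + a n) - f x)) \<longlonglongrightarrow> 0)"

lemma shift_continuous_add:
  assumes f: "f \<in> L2" "shift_continuous f" and g: "g \<in> L2" "shift_continuous g"
  shows "shift_continuous (\<lambda>x. f x + g x)"
  unfolding shift_continuous_def
proof (intro allI impI)
  fix a :: "nat \<Rightarrow> 'a" assume a: "a \<longlonglongrightarrow> 0"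
  have lim: "(\<lambda>n. l2_norm (\<lambda>x. f (x + a n) - f x) + l2_norm (\<lambda>x. g (x + a n) - g x)) \<longlonglongrightarrow> 0"
    using f g a tendsto_add unfolding shift_continuous_def by fastforce
  have "l2_norm (\<lambda>x. (f (x + a n) + g (x + a n)) - (f x + g x))
      \<le> l2_norm (\<lambda>x. f (x + a n) - f x) + l2_norm (\<lambda>x. g (x + a n) - g x)" for n
    using l2_norm_add_le[of "\<lambda>x. f (x + a n) - f x" "\<lambda>x. g (x + a n) - g x"] f g
    by (simp add: L2_diff L2_shift algebra_simps)
  then show "(\<lambda>n. l2_norm (\<lambda>x. (f (x + a n) + g (x + a n)) - (f x + g x))) \<longlonglongrightarrow> 0"
    by (intro tendsto_sandwich[OF _ _ tendsto_const lim]) auto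
qed

lemma shift_continuous_mult:
  assumes "shift_continuous f"
  shows "shift_continuous (\<lambda>x. c * f x)"
  unfolding shift_continuous_def
proof (intro allI impI)
  fix a :: "nat \<Rightarrow> 'a" assume "a \<longlonglongrightarrow> 0"
  then have "(\<lambda>n. cmod c * l2_norm (\<lambda>x. f (x + a n) - f x)) \<longlonglongrightarrow> cmod c * 0"
    using assms unfolding shift_continuous_def by (intro tendsto_mult tendsto_const) auto
  then show "(\<lambda>n. l2_norm (\<lambda>x. c * f (x + a n) - c * f x)) \<longlonglongrightarrow> 0"
    by (simp add: l2_norm_mult[symmetric] right_diff_distrib)
qed

lemma shift_continuous_sum:
  "(\<And>i. i \<in> I \<Longrightarrow> f i \<in> L2 \<and> shift_continuous (f i)) \<Longrightarrow> shift_continuous (\<lambda>x. \<Sum>i\<in>I. f i x)"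
proof (induction I rule: infinite_finite_induct)
  case (insert i I)
  then show ?case
    by (simp add: L2_sum shift_continuous_add)
qed (auto simp: shift_continuous_def l2_norm_def)

text \<open>Translation is an isometry, so replacing \<open>f\<close> by \<open>g\<close> costs the
  approximation error twice, once before and once after the shift; each of the three errors is kept
  below r/4.\<close>

lemma shift_continuous_approx:
  assumes f: "f \<in> L2" and approx: "\<And>e. e > 0 \<Longrightarrow> \<exists>g\<in>L2. shift_continuous g \<and> l2_norm (\<lambda>x. f x - g x) < e"
  shows "shift_continuous f"
  unfolding shift_continuous_def
proof (intro allI impI LIMSEQ_I)
  fix a :: "nat \<Rightarrow> 'a" and r :: real
  assume a: "a \<longlonglongrightarrow> 0" and "r > 0"
  then obtain g where g: "g \<in> L2" "shift_continuous g" "l2_norm (\<lambda>x. f x - g x) < r / 4"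
    using approx[of "r / 4"] by auto
  have "(\<lambda>n. l2_norm (\<lambda>x. g (x + a n) - g x)) \<longlonglongrightarrow> 0"
    using g a by (simp add: shift_continuous_def)
  then obtain N where N: "\<And>n. n \<ge> N \<Longrightarrow> l2_norm (\<lambda>x. g (x + a n) - g x) < r / 4"
    using LIMSEQ_D[of _ 0 "r / 4"] \<open>r > 0\<close> by fastforce
  have "l2_norm (\<lambda>x. f (x + a n) - f x) < r" if "n \<ge> N" for n
  proof -
    let ?u = "\<lambda>x. f (x + a n) - g (x + a n)" and ?v = "\<lambda>x. g (x + a n) - g x" and ?w = "\<lambda>x. g x - f x"
    have L: "?u \<in> L2" "?v \<in> L2" "?w \<in> L2" "(\<lambda>x. f x - g x) \<in> L2"
      using f g by (auto intro: L2_diff L2_shift)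
    have "l2_norm (\<lambda>x. f (x + a n) - f x) = l2_norm (\<lambda>x. ?u x + (?v x + ?w x))"
      by simp
    also have "\<dots> \<le> l2_norm ?u + (l2_norm ?v + l2_norm ?w)"
      using l2_norm_add_le[OF L(1) L2_add[OF L(2,3)]] l2_norm_add_le[OF L(2,3)] by linarith
    also have "l2_norm ?u = l2_norm (\<lambda>x. f x - g x)"
      using L2_shift(2)[OF L(4), of "a n"] by simp
    also have "l2_norm ?w = l2_norm (\<lambda>x. f x - g x)"
      by (rule l2_norm_diff_commute)
    finally show ?thesis
      using g(3) N[OF that] \<open>r > 0\<close> by linarith
  qed
  then show "\<exists>no. \<forall>n\<ge>no. norm (l2_norm (\<lambda>x. f (x + a n) - f x) - 0) < r"
    by auto
qed

lemma L2_indicator: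
  assumes [measurable]: "A \<in> sets borel" and "emeasure lborel A < \<infinity>"
  shows "(\<lambda>x. of_real (indicat_real A x)) \<in> L2" and "l2_norm (\<lambda>x. of_real (indicat_real A x)) = sqrt (measure lborel A)"
proof -
  have *: "(indicat_real A x)\<^sup>2 = indicator A x" for x
    by (simp add: indicator_def)
  show "(\<lambda>x. of_real (indicat_real A x)) \<in> L2"
    using assms by (simp add: L2_def *)
  show "l2_norm (\<lambda>x. of_real (indicat_real A x)) = sqrt (measure lborel A)"
    by (simp add: l2_norm_def *)
qed

text \<open>The squared distance to the translate is twice the measure of \<open>U\<close> minus
  twice the measure of the overlap. Openness keeps \<open>x + a n\<close> in \<open>U\<close>
  eventually for each x in \<open>U\<close>, so the overlap converges to the measure of
  \<open>U\<close>.\<close>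

lemma shift_continuous_indicator_open:
  fixes U :: "'a::euclidean_space set"
  assumes U: "open U" and fin: "emeasure lborel U < \<infinity>"
  shows "shift_continuous (\<lambda>x. of_real (indicat_real U x))"
  unfolding shift_continuous_def
proof (intro allI impI)
  fix a :: "nat \<Rightarrow> 'a" assume a: "a \<longlonglongrightarrow> 0"
  have [measurable]: "U \<in> sets borel"
    using U by simp
  have int_U: "integrable lborel (indicat_real U)"
    using fin by simp
  have meas: "indicat_real U \<in> borel_measurable borel"
    by measurable
  have int_shift: "integrable lborel (\<lambda>x. indicat_real U (x + a n))" for n
  proof -
    have "(cmod (of_real (indicat_real U y)))\<^sup>2 = indicat_real U y" for y
      by (simp add: indicator_def)
    then show ?thesis
      using L2_integrable_square[OF L2_shift(1)[OF L2_indicator(1)[OF _ fin], of "a n"]] by simp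
  qed
  have int_prod: "integrable lborel (\<lambda>x. indicat_real U (x + a n) * indicat_real U x)" for n
    by (rule Bochner_Integration.integrable_bound[OF int_U]) (auto simp: indicator_def)
  have "(\<lambda>n. \<integral>x. indicat_real U (x + a n) * indicat_real U x \<partial>lborel) \<longlonglongrightarrow> (\<integral>x. indicat_real U x \<partial>lborel)"
  proof (rule integral_dominated_convergence[OF _ _ int_U])
    show "AE x in lborel. (\<lambda>n. indicat_real U (x + a n) * indicat_real U x) \<longlonglongrightarrow> indicat_real U x"
    proof (intro AE_I2)
      fix x
      show "(\<lambda>n. indicat_real U (x + a n) * indicat_real U x) \<longlonglongrightarrow> indicat_real U x"
      proof (cases "x \<in> U")
        case True
        have "(\<lambda>n. x + a n) \<longlonglongrightarrow> x + 0"
          by (intro tendsto_intros a)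
        then have "\<forall>\<^sub>F n in sequentially. x + a n \<in> U"
          using U True by (auto dest: topological_tendstoD)
        then have "\<forall>\<^sub>F n in sequentially. indicat_real U (x + a n) * indicat_real U x = indicat_real U x"
          by eventually_elim (simp add: True)
        then show ?thesis
          by (rule tendsto_eventually)
      qed simp
    qed
  qed (auto simp: indicator_def)
  then have lim: "(\<lambda>n. 2 * (\<integral>x. indicat_real U x \<partial>lborel) - 2 * (\<integral>x. indicat_real U (x + a n) * indicat_real U x \<partial>lborel))
      \<longlonglongrightarrow> 2 * (\<integral>x. indicat_real U x \<partial>lborel) - 2 * (\<integral>x. indicat_real U x \<partial>lborel)"
    by (intro tendsto_intros)
  have "(l2_norm (\<lambda>x. complex_of_real (indicat_real U (x + a n)) - of_real (indicat_real U x)))\<^sup>2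
      = 2 * (\<integral>x. indicat_real U x \<partial>lborel) - 2 * (\<integral>x. indicat_real U (x + a n) * indicat_real U x \<partial>lborel)" for n
  proof -
    have "(cmod (complex_of_real (indicat_real U (x + a n)) - of_real (indicat_real U x)))\<^sup>2
        = indicat_real U (x + a n) + indicat_real U x - 2 * (indicat_real U (x + a n) * indicat_real U x)" for x
      by (simp add: indicator_def)
    then have "(l2_norm (\<lambda>x. complex_of_real (indicat_real U (x + a n)) - of_real (indicat_real U x)))\<^sup>2
        = (\<integral>x. indicat_real U (x + a n) + indicat_real U x - 2 * (indicat_real U (x + a n) * indicat_real U x) \<partial>lborel)"
      by (simp add: l2_norm_square)
    also have "\<dots> = (\<integral>x. indicat_real U (x + a n) \<partial>lborel) + (\<integral>x. indicat_real U x \<partial>lborel)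
        - 2 * (\<integral>x. indicat_real U (x + a n) * indicat_real U x \<partial>lborel)"
      using int_shift[of n] int_U int_prod[of n] by (simp del: integral_indicator)
    also have "(\<integral>x. indicat_real U (x + a n) \<partial>lborel) = (\<integral>x. indicat_real U x \<partial>lborel)"
      using meas by (rule integral_lborel_shift)
    finally show ?thesis by simp
  qed
  with lim have "(\<lambda>n. (l2_norm (\<lambda>x. complex_of_real (indicat_real U (x + a n)) - of_real (indicat_real U x)))\<^sup>2) \<longlonglongrightarrow> 0"
    by simp
  then have "(\<lambda>n. sqrt ((l2_norm (\<lambda>x. complex_of_real (indicat_real U (x + a n)) - of_real (indicat_real U x)))\<^sup>2)) \<longlonglongrightarrow> sqrt 0"
    by (rule tendsto_real_sqrt)
  then show "(\<lambda>n. l2_norm (\<lambda>x. complex_of_real (indicat_real U (x + a n)) - of_real (indicat_real U x))) \<longlonglongrightarrow> 0"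
    by simp
qed

text \<open>Outer regularity: an open superset exceeding \<open>A\<close> by measure less than e^2
  has its indicator within e in norm.\<close>

lemma shift_continuous_indicator:
  fixes A :: "'a::euclidean_space set"
  assumes A: "A \<in> sets borel" and fin: "emeasure lborel A < \<infinity>"
  shows "shift_continuous (\<lambda>x. of_real (indicat_real A x))"
proof (rule shift_continuous_approx[OF L2_indicator(1)[OF A fin]])
  fix e :: real assume "e > 0"
  then obtain U where U: "open U" "A \<subseteq> U" "emeasure lborel (U - A) < e\<^sup>2"
    using outer_regular_lborel[OF A, of "e\<^sup>2"] by auto
  have "emeasure lborel U = emeasure lborel A + emeasure lborel (U - A)"
    using A U by (subst plus_emeasure) (auto simp: Un_absorb1)
  also have "\<dots> < \<infinity>"
    using fin order.strict_trans[OF U(3) ennreal_less_top] by simp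
  finally have finU: "emeasure lborel U < \<infinity>" .
  have UA: "U - A \<in> sets borel" "emeasure lborel (U - A) < \<infinity>"
    using A U(1) order.strict_trans[OF U(3) ennreal_less_top] by auto
  have "l2_norm (\<lambda>x. complex_of_real (indicat_real A x) - of_real (indicat_real U x))
      = l2_norm (\<lambda>x. complex_of_real (indicat_real (U - A) x))"
    unfolding l2_norm_def using U(2) by (intro arg_cong[where f=sqrt] Bochner_Integration.integral_cong) (auto simp: indicator_def)
  also have "\<dots> = sqrt (measure lborel (U - A))"
    by (rule L2_indicator[OF UA])
  also have "\<dots> < e"
  proof -
    have "ennreal (measure lborel (U - A)) < ennreal (e\<^sup>2)"
      using U(3) UA(2) by (simp add: emeasure_eq_ennreal_measure less_top[symmetric])
    then have "measure lborel (U - A) < e\<^sup>2"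
      by (simp add: ennreal_less_iff)
    then show ?thesis
      using \<open>e > 0\<close> by (simp add: real_less_lsqrt)
  qed
  finally show "\<exists>g\<in>L2. shift_continuous g \<and> l2_norm (\<lambda>x. of_real (indicat_real A x) - g x) < e"
    using U(1) finU L2_indicator(1)[OF _ finU] shift_continuous_indicator_open by (intro bexI[of _ "\<lambda>x. of_real (indicat_real U x)"]) auto
qed

text \<open>Square integrability forces finite measure of the level sets of nonzero values; the
  level set of 0 may be infinite but contributes the zero function.\<close>

lemma shift_continuous_simple:
  fixes s :: "'a::euclidean_space \<Rightarrow> complex"
  assumes s: "simple_function lborel s" and L2: "s \<in> L2"
  shows "shift_continuous s"
proof -
  have [measurable]: "s \<in> borel_measurable borel"
    using L2 by (rule L2_measurable)
  have fin: "finite (range s)"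
    using s by (simp add: simple_function_def)
  have summand: "(\<lambda>x. y * of_real (indicat_real (s -` {y}) x)) \<in> L2 \<and> shift_continuous (\<lambda>x. y * of_real (indicat_real (s -` {y}) x))" for y
  proof (cases "y = 0")
    case True
    then show ?thesis
      by (simp add: shift_continuous_def l2_norm_def)
  next
    case False
    have A: "s -` {y} \<in> sets borel"
      using measurable_sets_borel[of s "borel" "{y}"] by simp
    have "ennreal ((cmod y)\<^sup>2) * emeasure lborel (s -` {y}) = (\<integral>\<^sup>+x. ennreal ((cmod y)\<^sup>2) * indicator (s -` {y}) x \<partial>lborel)"
      using A by (subst nn_integral_cmult_indicator) auto
    also have "\<dots> \<le> (\<integral>\<^sup>+x. ennreal ((cmod (s x))\<^sup>2) \<partial>lborel)"
      by (intro nn_integral_mono) (auto simp: indicator_def)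
    also have "\<dots> < \<infinity>"
      using L2 by (simp add: L2_iff_nn_integral)
    finally have "emeasure lborel (s -` {y}) < \<infinity>"
      using False by (auto simp: ennreal_mult_less_top)
    then show ?thesis
      using A by (intro conjI L2_mult L2_indicator shift_continuous_mult shift_continuous_indicator)
  qed
  have "s = (\<lambda>x. \<Sum>y\<in>range s. y * of_real (indicat_real (s -` {y}) x))"
  proof
    fix x
    have "(\<Sum>y\<in>range s. y * of_real (indicat_real (s -` {y}) x)) = (\<Sum>y\<in>range s. if y = s x then y else 0)"
      by (intro sum.cong) (auto simp: indicator_def)
    also have "\<dots> = s x"
      using fin by simp
    finally show "s x = (\<Sum>y\<in>range s. y * of_real (indicat_real (s -` {y}) x))"
      by simp
  qed
  moreover have "shift_continuous (\<lambda>x. \<Sum>y\<in>range s. y * of_real (indicat_real (s -` {y}) x))"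
    using summand by (intro shift_continuous_sum)
  ultimately show ?thesis
    by simp
qed

theorem L2_shift_continuous:
  fixes f :: "'a::euclidean_space \<Rightarrow> complex"
  assumes f: "f \<in> L2" and a: "a \<longlonglongrightarrow> 0"
  shows "(\<lambda>n. l2_norm (\<lambda>x. f (x + a n) - f x)) \<longlonglongrightarrow> 0"
proof -
  have [measurable]: "f \<in> borel_measurable borel"
    using f by (rule L2_measurable)
  obtain s where s: "\<And>i. simple_function lborel (s i)" and lim: "\<And>x. (\<lambda>i. s i x) \<longlonglongrightarrow> f x"
      and le: "\<And>i x. cmod (s i x) \<le> 2 * cmod (f x)"
    using borel_measurable_implies_sequence_metric[of f lborel 0] by auto
  have [measurable]: "s i \<in> borel_measurable borel" for i
    using borel_measurable_simple_function[OF s[of i]] by simp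
  have f_int: "integrable lborel (\<lambda>x. (cmod (f x))\<^sup>2)"
    using f by (rule L2_integrable_square)
  have sq_le: "(cmod (s i x))\<^sup>2 \<le> 4 * (cmod (f x))\<^sup>2" for i x
    using power_mono[OF le[of i x], of 2] by (simp add: power_mult_distrib)
  have sL2: "s i \<in> L2" for i
  proof -
    have "integrable lborel (\<lambda>x. (cmod (s i x))\<^sup>2)"
      by (rule Bochner_Integration.integrable_bound[of _ "\<lambda>x. 4 * (cmod (f x))\<^sup>2"]) (use f_int sq_le in auto)
    then show ?thesis
      by (simp add: L2_def)
  qed
  have "(\<lambda>i. \<integral>x. (cmod (f x - s i x))\<^sup>2 \<partial>lborel) \<longlonglongrightarrow> (\<integral>x. 0 \<partial>(lborel :: 'a measure))"
  \<comment> \<open>The constant 10 is 2 + 2 * 4: twice the squared modulus of f plus twice that of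
    \<open>s i\<close>, which is at most 2 |f|.\<close>
  proof (rule integral_dominated_convergence[where w="\<lambda>x. 10 * (cmod (f x))\<^sup>2"])
    show "AE x in lborel. (\<lambda>i. (cmod (f x - s i x))\<^sup>2) \<longlonglongrightarrow> 0"
    proof (intro AE_I2)
      fix x
      have "(\<lambda>i. (cmod (f x - s i x))\<^sup>2) \<longlonglongrightarrow> (cmod (f x - f x))\<^sup>2"
        by (intro tendsto_intros lim)
      then show "(\<lambda>i. (cmod (f x - s i x))\<^sup>2) \<longlonglongrightarrow> 0"
        by simp
    qed
    show "AE x in lborel. norm ((cmod (f x - s i x))\<^sup>2) \<le> 10 * (cmod (f x))\<^sup>2" for i
      using cmod_add_square_le[of "f _" "- s i _"] sq_le[of i] by (intro AE_I2) (smt (verit) norm_minus_cancel real_norm_def uminus_add_conv_diff add.commute zero_le_power2)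
  qed (use f_int in auto)
  then have "(\<lambda>i. sqrt (\<integral>x. (cmod (f x - s i x))\<^sup>2 \<partial>lborel)) \<longlonglongrightarrow> sqrt 0"
    by (intro tendsto_real_sqrt) simp
  then have approx: "(\<lambda>i. l2_norm (\<lambda>x. f x - s i x)) \<longlonglongrightarrow> 0"
    by (simp add: l2_norm_def)
  have "shift_continuous f"
  proof (rule shift_continuous_approx[OF f])
    fix e :: real assume "e > 0"
    then obtain i where "l2_norm (\<lambda>x. f x - s i x) < e"
      using LIMSEQ_D[OF approx, of e] by auto
    then show "\<exists>g\<in>L2. shift_continuous g \<and> l2_norm (\<lambda>x. f x - g x) < e"
      using sL2 shift_continuous_simple[OF s sL2] by blast
  qed
  then show ?thesis
    using a by (simp add: shift_continuous_def)
qed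

section \<open>Fourier transform\<close>

definition fker :: "'a::euclidean_space \<Rightarrow> 'a \<Rightarrow> complex"
  where "fker y k = exp (- 2 * of_real pi * \<i> * of_real (y \<bullet> k))"

definition fourier :: "('a::euclidean_space \<Rightarrow> complex) \<Rightarrow> 'a \<Rightarrow> complex"
  where "fourier h k = (\<integral>y. fker y k * h y \<partial>lborel)"

text \<open>With 2 pi in the Fourier kernel, this Gaussian is its own transform and has integral
  1.\<close>

definition gauss :: "'a::euclidean_space \<Rightarrow> real"
  where "gauss k = exp (- pi * (norm k)\<^sup>2)"

lemma norm_fker [simp]: "cmod (fker y k) = 1"
  by (simp add: fker_def norm_exp_eq_Re)

lemma fker_commute: "fker y k = fker k y"
  by (simp add: fker_def inner_commute)

lemma fker_add: "fker (y + z) k = fker y k * fker z k"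
  by (simp add: fker_def inner_add_left exp_add[symmetric] algebra_simps)

lemma fker_scaleR: "fker (c *\<^sub>R y) k = fker y (c *\<^sub>R k)"
  by (simp add: fker_def)

lemma cnj_fker: "cnj (fker y k) = fker y (- k)"
  by (simp add: fker_def exp_cnj)

lemma measurable_fker [measurable (raw)]:
  assumes [measurable]: "f \<in> borel_measurable M" "g \<in> borel_measurable M"
  shows "(\<lambda>x. fker (f x) (g x)) \<in> borel_measurable M"
  unfolding fker_def by measurable

lemma gauss_pos [simp]: "0 < gauss k" "0 \<le> gauss k" "gauss k \<le> 1"
  by (simp_all add: gauss_def)

lemma measurable_gauss [measurable]: "gauss \<in> borel_measurable borel"
  unfolding gauss_def by measurable

text \<open>The characteristic function of the standard normal law after the substitution x = s t
  with s = sqrt (2 pi), which turns the normal density times s into exp (- pi t^2) and the phase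
  into the one with 2 pi.\<close>

lemma gauss_fourier_real:
  "(\<integral>t. exp (- 2 * of_real pi * \<i> * of_real (t * u)) * of_real (exp (- pi * t\<^sup>2)) \<partial>lborel) = complex_of_real (exp (- pi * u\<^sup>2))"
proof -
  define s where "s = sqrt (2 * pi)"
  have s: "s > 0" "s\<^sup>2 = 2 * pi"
    by (simp_all add: s_def)
  have "char std_normal_distribution (- s * u) = (\<integral>x. std_normal_density x *\<^sub>R iexp (- s * u * x) \<partial>lborel)"
    unfolding char_def by (subst integral_density) (auto simp: normal_density_nonneg)
  also have "\<dots> = \<bar>s\<bar> *\<^sub>R (\<integral>t. std_normal_density (0 + s * t) *\<^sub>R iexp (- s * u * (0 + s * t)) \<partial>lborel)"
    using s(1) by (intro lborel_integral_real_affine) simp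
  also have "\<dots> = (\<integral>t. s *\<^sub>R (std_normal_density (s * t) *\<^sub>R iexp (- s * u * (s * t))) \<partial>lborel)"
    using s(1) by (simp only: scaleR_conv_of_real integral_mult_right_zero abs_of_pos add_0)
  also have "\<dots> = (\<integral>t. exp (- 2 * of_real pi * \<i> * of_real (t * u)) * of_real (exp (- pi * t\<^sup>2)) \<partial>lborel)"
  proof (rule Bochner_Integration.integral_cong)
    fix t :: real
    have 1: "s * std_normal_density (s * t) = exp (- pi * t\<^sup>2)"
      using s by (simp add: std_normal_density_def power_mult_distrib s_def[symmetric])
    have 2: "- s * u * (s * t) = - 2 * pi * (t * u)"
      using s(2) by (simp add: power2_eq_square algebra_simps)
    have "s *\<^sub>R (std_normal_density (s * t) *\<^sub>R iexp (- s * u * (s * t)))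
        = of_real (exp (- pi * t\<^sup>2)) * iexp (- 2 * pi * (t * u))"
      unfolding 2 scaleR_scaleR 1 by (simp add: scaleR_conv_of_real)
    then show "s *\<^sub>R (std_normal_density (s * t) *\<^sub>R iexp (- s * u * (s * t)))
        = exp (- 2 * of_real pi * \<i> * of_real (t * u)) * of_real (exp (- pi * t\<^sup>2))"
      by (simp add: ac_simps)
  qed simp
  finally show ?thesis
    using s by (simp add: char_std_normal_distribution power_mult_distrib)
qed

lemma integral_lborel_prod_Basis:
  fixes h :: "'a::euclidean_space \<Rightarrow> real \<Rightarrow> complex"
  assumes h: "\<And>b. b \<in> Basis \<Longrightarrow> integrable lborel (h b)"
  shows "(\<integral>k. (\<Prod>b\<in>Basis. h b (k \<bullet> b)) \<partial>lborel) = (\<Prod>b\<in>Basis. \<integral>t. h b t \<partial>lborel)"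
proof -
  interpret product_sigma_finite "\<lambda>_::'a. lborel :: real measure" ..
  have [measurable]: "h b \<in> borel_measurable borel" if "b \<in> Basis" for b
    using borel_measurable_integrable[OF h[OF that]] by simp
  have "(\<integral>k. (\<Prod>b\<in>Basis. h b (k \<bullet> b)) \<partial>lborel)
      = (\<integral>k. (\<Prod>b\<in>Basis. h b (k \<bullet> b)) \<partial>distr (\<Pi>\<^sub>M b\<in>Basis. lborel) borel (\<lambda>f. \<Sum>b\<in>Basis. f b *\<^sub>R (b::'a)))"
    by (simp only: lborel_eq[where 'a='a, symmetric])
  also have "\<dots> = (\<integral>f. (\<Prod>b\<in>Basis. h b ((\<Sum>b\<in>Basis. f b *\<^sub>R b) \<bullet> b)) \<partial>(\<Pi>\<^sub>M b\<in>Basis. lborel))"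
    by (rule integral_distr) measurable
  also have "\<dots> = (\<integral>f. (\<Prod>b\<in>Basis. h b (f b)) \<partial>(\<Pi>\<^sub>M b\<in>Basis. lborel))"
    by (simp cong: prod.cong)
  also have "\<dots> = (\<Prod>b\<in>Basis. \<integral>t. h b t \<partial>lborel)"
    by (intro product_integral_prod h) auto
  finally show ?thesis .
qed

lemma gauss_fourier: "fourier (\<lambda>k. of_real (gauss k)) u = of_real (gauss u)"
proof -
  define h where "h b t = exp (- 2 * of_real pi * \<i> * of_real (t * (u \<bullet> b))) * complex_of_real (exp (- pi * t\<^sup>2))" for b t
  have h_int: "(\<integral>t. h b t \<partial>lborel) = of_real (exp (- pi * (u \<bullet> b)\<^sup>2))" for b
    unfolding h_def by (rule gauss_fourier_real)
  \<comment> \<open>A nonintegrable function has Bochner integral 0, so the nonzero value just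
    computed implies integrability.\<close>
  have "integrable lborel (h b)" for b
    using not_integrable_integral_eq[of lborel "h b"] h_int[of b] by (auto simp del: of_real_exp)
  then have "(\<integral>k. (\<Prod>b\<in>Basis. h b (k \<bullet> b)) \<partial>lborel) = (\<Prod>b\<in>Basis. \<integral>t. h b t \<partial>lborel)"
    by (intro integral_lborel_prod_Basis)
  moreover have norm_sq: "(norm k)\<^sup>2 = (\<Sum>b\<in>Basis. (k \<bullet> b)\<^sup>2)" for k :: 'a
    unfolding power2_norm_eq_inner by (subst euclidean_inner) (simp only: power2_eq_square)
  have "(\<Prod>b\<in>Basis. h b (k \<bullet> b)) = fker k u * of_real (gauss k)" for k
  proof -
    have "(\<Prod>b\<in>Basis. h b (k \<bullet> b)) = (\<Prod>b\<in>Basis. exp (- 2 * of_real pi * \<i> * of_real ((k \<bullet> b) * (u \<bullet> b)))) * (\<Prod>b\<in>Basis. of_real (exp (- pi * (k \<bullet> b)\<^sup>2)))"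
      unfolding h_def by (rule prod.distrib)
    also have "(\<Prod>b\<in>Basis. exp (- 2 * of_real pi * \<i> * of_real ((k \<bullet> b) * (u \<bullet> b)))) = fker k u"
      by (simp add: exp_sum[symmetric] fker_def euclidean_inner[of k u] sum_distrib_left)
    also have "(\<Prod>b\<in>Basis. of_real (exp (- pi * (k \<bullet> b)\<^sup>2))) = complex_of_real (gauss k)"
      unfolding of_real_prod[symmetric] by (simp add: exp_sum[symmetric] gauss_def norm_sq sum_distrib_left sum_negf)
    finally show ?thesis .
  qed
  moreover have "(\<Prod>b\<in>Basis. \<integral>t. h b t \<partial>lborel) = of_real (gauss u)"
    unfolding h_int of_real_prod[symmetric] by (simp add: exp_sum[symmetric] gauss_def norm_sq sum_distrib_left sum_negf)
  ultimately show ?thesis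
    by (simp add: fourier_def)
qed

lemma integrable_gauss: "integrable lborel (gauss :: 'a::euclidean_space \<Rightarrow> real)"
  and integral_gauss: "(\<integral>k. gauss (k::'a) \<partial>lborel) = 1"
proof -
  have "(\<integral>k. complex_of_real (gauss (k::'a)) \<partial>lborel) = 1"
    using gauss_fourier[of "0::'a"] by (simp add: fourier_def fker_def gauss_def)
  then show 1: "(\<integral>k. gauss (k::'a) \<partial>lborel) = 1"
    by (simp add: integral_complex_of_real)
  show "integrable lborel (gauss :: 'a \<Rightarrow> real)"
    using not_integrable_integral_eq[of lborel "gauss :: 'a \<Rightarrow> real"] 1 by auto
qed

lemma nn_integral_gauss: "(\<integral>\<^sup>+k. ennreal (gauss (k::'a::euclidean_space)) \<partial>lborel) = 1"
  using nn_integral_eq_integral[OF integrable_gauss] by (simp add: integral_gauss)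

lemma gauss_L2: "(\<lambda>k. complex_of_real (gauss k)) \<in> L2"
proof -
  have "integrable lborel (\<lambda>k::'a. (gauss k)\<^sup>2)"
    by (rule Bochner_Integration.integrable_bound[OF integrable_gauss])
      (auto simp: power2_eq_square mult_left_le_one_le)
  then show ?thesis
    by (simp add: L2_def)
qed

lemma gauss_scaled_fourier:
  fixes u :: "'a::euclidean_space"
  assumes m: "m > 0"
  shows "(\<integral>k. fker k u * of_real (gauss (k /\<^sub>R m)) \<partial>lborel) = of_real (m ^ DIM('a) * gauss (m *\<^sub>R u))"
proof -
  have "(\<integral>k. fker k u * of_real (gauss (k /\<^sub>R m)) \<partial>lborel)
      = \<bar>m\<bar> ^ DIM('a) *\<^sub>R (\<integral>k. fker (0 + m *\<^sub>R k) u * of_real (gauss ((0 + m *\<^sub>R k) /\<^sub>R m)) \<partial>lborel)"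
    using m by (intro integral_lborel_affine) auto
  also have "\<dots> = m ^ DIM('a) *\<^sub>R fourier (\<lambda>k. of_real (gauss k)) (m *\<^sub>R u)"
    using m by (simp add: fourier_def fker_scaleR)
  finally show ?thesis
    by (simp add: gauss_fourier scaleR_conv_of_real)
qed

lemma integrable_gauss_scaled:
  assumes "m > 0"
  shows "integrable lborel (\<lambda>k::'a::euclidean_space. gauss (k /\<^sub>R m))"
proof -
  have "(\<integral>k. complex_of_real (gauss ((k::'a) /\<^sub>R m)) \<partial>lborel) \<noteq> 0"
    using gauss_scaled_fourier[OF assms, of "0::'a"] assms by (simp add: fker_def gauss_def)
  then show ?thesis
    using not_integrable_integral_eq[of lborel "\<lambda>k::'a. gauss (k /\<^sub>R m)"] by auto
qed

lemma measurable_fourier [measurable (raw)]: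
  assumes [measurable]: "f \<in> borel_measurable (M \<Otimes>\<^sub>M lborel)" "g \<in> borel_measurable M"
  shows "(\<lambda>x. fourier (\<lambda>y. f (x, y)) (g x)) \<in> borel_measurable M"
  unfolding fourier_def by measurable

lemma measurable_fourier' [measurable]:
  assumes [measurable]: "h \<in> borel_measurable borel"
  shows "fourier h \<in> borel_measurable borel"
  unfolding fourier_def by measurable

lemma norm_fourier_le: "cmod (fourier h k) \<le> (\<integral>y. cmod (h y) \<partial>lborel)"
  unfolding fourier_def using integral_norm_bound[of lborel "\<lambda>y. fker y k * h y"] by (simp add: norm_mult)

section \<open>Gaussian mollification and the Plancherel inequality\<close>

text \<open>Convolution with a Gaussian of width 1/m, with the scale moved into the shift. The
  weight is then one fixed probability density, and mollification errors are averages of translation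
  errors.\<close>

definition mollify :: "real \<Rightarrow> ('a::euclidean_space \<Rightarrow> complex) \<Rightarrow> 'a \<Rightarrow> complex"
  where "mollify m h u = (\<integral>w. h (u + w /\<^sub>R m) * of_real (gauss w) \<partial>lborel)"

lemma measurable_mollify [measurable]:
  assumes [measurable]: "h \<in> borel_measurable borel"
  shows "mollify m h \<in> borel_measurable borel"
  unfolding mollify_def by measurable

text \<open>Fubini moves the outer transform onto the Gaussian cutoff, whose transform m^n gauss (m
  u) is an approximate identity centred at -K. The reflection is that of a twice applied Fourier
  transform.\<close>

lemma fourier_gauss_cutoff:
  fixes h :: "'a::euclidean_space \<Rightarrow> complex"
  assumes h: "integrable lborel h" and m: "m > 0"
  shows "fourier (\<lambda>k. of_real (gauss (k /\<^sub>R m)) * fourier h k) K = mollify m h (- K)"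
proof -
  have [measurable]: "h \<in> borel_measurable borel"
    using h by auto
  define F where "F k y = fker k K * (of_real (gauss (k /\<^sub>R m)) * (fker y k * h y))" for k y
  have "integrable (lborel \<Otimes>\<^sub>M lborel) (case_prod F)"
  proof (rule lborel_pair.Fubini_integrable)
    show "case_prod F \<in> borel_measurable (lborel \<Otimes>\<^sub>M lborel)"
      unfolding F_def by measurable
    have "(\<integral>y. norm (case_prod F (k, y)) \<partial>lborel) = gauss (k /\<^sub>R m) * (\<integral>y. cmod (h y) \<partial>lborel)" for k
      by (simp add: F_def norm_mult)
    then show "integrable lborel (\<lambda>k. \<integral>y. norm (case_prod F (k, y)) \<partial>lborel)"
      using integrable_gauss_scaled[OF m, where 'a='a] by simp
    have "integrable lborel (\<lambda>y. fker y k * h y)" for k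
      by (rule Bochner_Integration.integrable_bound[OF h]) (auto simp: norm_mult)
    then show "AE k in lborel. integrable lborel (\<lambda>y. case_prod F (k, y))"
      by (simp add: F_def)
  qed
  then have "(\<integral>k. \<integral>y. F k y \<partial>lborel \<partial>lborel) = (\<integral>y. \<integral>k. F k y \<partial>lborel \<partial>lborel)"
    by (rule lborel_pair.Fubini_integral[symmetric])
  moreover have "(\<integral>y. F k y \<partial>lborel) = fker k K * (of_real (gauss (k /\<^sub>R m)) * fourier h k)" for k
    by (simp add: F_def fourier_def)
  moreover have "(\<integral>k. F k y \<partial>lborel) = of_real (m ^ DIM('a) * gauss (m *\<^sub>R (y + K))) * h y" for y
  proof -
    have "F k y = (fker k (y + K) * of_real (gauss (k /\<^sub>R m))) * h y" for k
      by (simp add: F_def fker_add fker_commute[of k "y + K"] fker_commute[of k K] fker_commute[of y k])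
    then show ?thesis
      by (simp add: gauss_scaled_fourier[OF m])
  qed
  ultimately have "fourier (\<lambda>k. of_real (gauss (k /\<^sub>R m)) * fourier h k) K
      = (\<integral>y. of_real (m ^ DIM('a) * gauss (m *\<^sub>R (y + K))) * h y \<partial>lborel)"
    by (simp add: fourier_def)
  also have "\<dots> = \<bar>1 / m\<bar> ^ DIM('a) *\<^sub>R (\<integral>w. of_real (m ^ DIM('a) * gauss (m *\<^sub>R ((- K + (1 / m) *\<^sub>R w) + K))) * h (- K + (1 / m) *\<^sub>R w) \<partial>lborel)"
    using m by (intro integral_lborel_affine) auto
  also have "\<dots> = (\<integral>w. \<bar>1 / m\<bar> ^ DIM('a) *\<^sub>R (of_real (m ^ DIM('a) * gauss (m *\<^sub>R ((- K + (1 / m) *\<^sub>R w) + K))) * h (- K + (1 / m) *\<^sub>R w)) \<partial>lborel)"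
    by simp
  also have "\<dots> = mollify m h (- K)"
    unfolding mollify_def
  proof (rule Bochner_Integration.integral_cong)
    fix w :: 'a
    have "m *\<^sub>R ((- K + (1 / m) *\<^sub>R w) + K) = w"
      using m by (simp add: scaleR_add_right)
    moreover have "\<bar>1 / m\<bar> ^ DIM('a) * m ^ DIM('a) = 1"
      using m by (simp add: power_one_over)
    ultimately show "\<bar>1 / m\<bar> ^ DIM('a) *\<^sub>R (of_real (m ^ DIM('a) * gauss (m *\<^sub>R ((- K + (1 / m) *\<^sub>R w) + K))) * h (- K + (1 / m) *\<^sub>R w))
        = h (- K + w /\<^sub>R m) * of_real (gauss w)"
      by (simp add: scaleR_conv_of_real inverse_eq_divide mult.assoc[symmetric] flip: of_real_mult of_real_power)
  qed simp
  finally show ?thesis .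
qed

text \<open>Jensen's inequality for the Gaussian probability density, obtained from Cauchy-Schwarz
  by splitting off a factor sqrt gauss. If the average is not integrable, its Bochner integral is 0
  and the bound is trivial.\<close>

lemma gauss_average_square_le:
  fixes F :: "'a::euclidean_space \<Rightarrow> complex"
  assumes [measurable]: "F \<in> borel_measurable borel"
  shows "ennreal ((cmod (\<integral>w. F w * of_real (gauss w) \<partial>lborel))\<^sup>2) \<le> (\<integral>\<^sup>+w. ennreal ((cmod (F w))\<^sup>2) * ennreal (gauss w) \<partial>lborel)"
proof -
  define r where "r w = sqrt (gauss w)" for w :: 'a
  have r: "0 \<le> r w" "r w * r w = gauss w" "(r w)\<^sup>2 = gauss w" for w
    by (simp_all add: r_def)
  have [measurable]: "r \<in> borel_measurable borel"
    unfolding r_def by measurable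
  have "ennreal (cmod (\<integral>w. F w * of_real (gauss w) \<partial>lborel)) \<le> (\<integral>\<^sup>+w. ennreal (cmod (F w * of_real (gauss w))) \<partial>lborel)"
    by (cases "integrable lborel (\<lambda>w. F w * of_real (gauss w))")
      (simp_all add: integral_norm_bound_ennreal not_integrable_integral_eq)
  also have "\<dots> = (\<integral>\<^sup>+w. ennreal (cmod (F w) * r w) * ennreal (r w) \<partial>lborel)"
    by (intro nn_integral_cong) (simp add: norm_mult r mult.assoc ennreal_mult[symmetric])
  finally have "(ennreal (cmod (\<integral>w. F w * of_real (gauss w) \<partial>lborel)))\<^sup>2 \<le> (\<integral>\<^sup>+w. ennreal (cmod (F w) * r w) * ennreal (r w) \<partial>lborel)\<^sup>2"
    by (intro power_mono) auto
  also have "\<dots> \<le> (\<integral>\<^sup>+w. ennreal (cmod (F w) * r w) ^ 2 \<partial>lborel) * (\<integral>\<^sup>+w. ennreal (r w) ^ 2 \<partial>lborel)"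
    by (intro Cauchy_Schwarz_nn_integral) measurable
  also have "(\<integral>\<^sup>+w. ennreal (r w) ^ 2 \<partial>lborel) = 1"
    using nn_integral_gauss[where 'a='a] by (simp add: ennreal_power r)
  also have "(\<integral>\<^sup>+w. ennreal (cmod (F w) * r w) ^ 2 \<partial>lborel) = (\<integral>\<^sup>+w. ennreal ((cmod (F w))\<^sup>2) * ennreal (gauss w) \<partial>lborel)"
    by (simp add: ennreal_power r power_mult_distrib ennreal_mult)
  finally show ?thesis
    by (simp add: ennreal_power)
qed

text \<open>Jensen pointwise, then Tonelli and translation invariance: averaging translates does not
  increase the norm.\<close>

lemma nn_integral_mollify_le:
  fixes h :: "'a::euclidean_space \<Rightarrow> complex"
  assumes [measurable]: "h \<in> borel_measurable borel"
  shows "(\<integral>\<^sup>+u. ennreal ((cmod (mollify m h u))\<^sup>2) \<partial>lborel) \<le> (\<integral>\<^sup>+u. ennreal ((cmod (h u))\<^sup>2) \<partial>lborel)"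
proof -
  have "(\<integral>\<^sup>+u. ennreal ((cmod (mollify m h u))\<^sup>2) \<partial>lborel)
      \<le> (\<integral>\<^sup>+u. \<integral>\<^sup>+w. ennreal ((cmod (h (u + w /\<^sub>R m)))\<^sup>2) * ennreal (gauss w) \<partial>lborel \<partial>lborel)"
    unfolding mollify_def by (intro nn_integral_mono gauss_average_square_le) measurable
  also have "\<dots> = (\<integral>\<^sup>+w. \<integral>\<^sup>+u. ennreal ((cmod (h (u + w /\<^sub>R m)))\<^sup>2) * ennreal (gauss w) \<partial>lborel \<partial>lborel)"
    by (rule lborel_pair.Fubini') measurable
  also have "\<dots> = (\<integral>\<^sup>+w. (\<integral>\<^sup>+u. ennreal ((cmod (h u))\<^sup>2) \<partial>lborel) * ennreal (gauss (w::'a)) \<partial>lborel)"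
  proof (intro nn_integral_cong)
    fix w :: 'a
    have "(\<integral>\<^sup>+u. ennreal ((cmod (h (u + w /\<^sub>R m)))\<^sup>2) \<partial>lborel) = (\<integral>\<^sup>+u. ennreal ((cmod (h u))\<^sup>2) \<partial>lborel)"
      by (rule nn_integral_lborel_shift[where f="\<lambda>u. ennreal ((cmod (h u))\<^sup>2)"]) measurable
    then show "(\<integral>\<^sup>+u. ennreal ((cmod (h (u + w /\<^sub>R m)))\<^sup>2) * ennreal (gauss w) \<partial>lborel) = (\<integral>\<^sup>+u. ennreal ((cmod (h u))\<^sup>2) \<partial>lborel) * ennreal (gauss w)"
      by (subst nn_integral_multc) auto
  qed
  also have "\<dots> = (\<integral>\<^sup>+u. ennreal ((cmod (h u))\<^sup>2) \<partial>lborel)"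
    by (subst nn_integral_cmult) (auto simp: nn_integral_gauss)
  finally show ?thesis .
qed

lemma mollify_L2:
  assumes "h \<in> L2"
  shows "mollify m h \<in> L2" and "l2_norm (mollify m h) \<le> l2_norm h"
proof -
  have [measurable]: "h \<in> borel_measurable borel"
    using assms by (rule L2_measurable)
  have le: "(\<integral>\<^sup>+u. ennreal ((cmod (mollify m h u))\<^sup>2) \<partial>lborel) \<le> ennreal ((l2_norm h)\<^sup>2)"
    using nn_integral_mollify_le[of h m] nn_integral_L2_square[OF assms] by simp
  then show 1: "mollify m h \<in> L2"
    by (auto simp: L2_iff_nn_integral intro: le_less_trans)
  from le show "l2_norm (mollify m h) \<le> l2_norm h"
    by (simp add: nn_integral_L2_square[OF 1])
qed

text \<open>The integral of |fourier h|^2 against a Gaussian cutoff equals the inner product of h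
  with its mollification, hence is at most the squared norm of h. Fatou's lemma removes the cutoff
  as its width grows.\<close>

lemma fourier_L2_le:
  fixes h :: "'a::euclidean_space \<Rightarrow> complex"
  assumes h: "integrable lborel h" and L2: "h \<in> L2"
  shows "(\<integral>\<^sup>+k. ennreal ((cmod (fourier h k))\<^sup>2) \<partial>lborel) \<le> (\<integral>\<^sup>+y. ennreal ((cmod (h y))\<^sup>2) \<partial>lborel)"
proof -
  have [measurable]: "h \<in> borel_measurable borel"
    using h by auto
  let ?I = "\<integral>y. cmod (h y) \<partial>lborel"
  have cutoff: "(\<integral>\<^sup>+k. ennreal (gauss (k /\<^sub>R m) * (cmod (fourier h k))\<^sup>2) \<partial>lborel) \<le> ennreal ((l2_norm h)\<^sup>2)"
    if m: "m > 0" for m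
  proof -
    define F where "F k y = of_real (gauss (k /\<^sub>R m)) * cnj (fourier h k) * (fker y k * h y)" for k y
    have int1: "integrable lborel (\<lambda>k. gauss (k /\<^sub>R m) * cmod (fourier h k))"
      by (rule Bochner_Integration.integrable_bound[OF integrable_mult_left[OF integrable_gauss_scaled[OF m], of ?I]])
        (auto simp: abs_mult intro!: mult_left_mono norm_fourier_le order_trans[OF norm_fourier_le])
    have "integrable (lborel \<Otimes>\<^sub>M lborel) (case_prod F)"
    proof (rule lborel_pair.Fubini_integrable)
      show "case_prod F \<in> borel_measurable (lborel \<Otimes>\<^sub>M lborel)"
        unfolding F_def by measurable
      have "(\<integral>y. norm (case_prod F (k, y)) \<partial>lborel) = gauss (k /\<^sub>R m) * cmod (fourier h k) * ?I" for k
        by (simp add: F_def norm_mult)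
      then show "integrable lborel (\<lambda>k. \<integral>y. norm (case_prod F (k, y)) \<partial>lborel)"
        using int1 by simp
      have "integrable lborel (\<lambda>y. fker y k * h y)" for k
        by (rule Bochner_Integration.integrable_bound[OF h]) (auto simp: norm_mult)
      then show "AE k in lborel. integrable lborel (\<lambda>y. case_prod F (k, y))"
        by (simp add: F_def)
    qed
    then have "(\<integral>k. \<integral>y. F k y \<partial>lborel \<partial>lborel) = (\<integral>y. \<integral>k. F k y \<partial>lborel \<partial>lborel)"
      by (rule lborel_pair.Fubini_integral[symmetric])
    moreover have "(\<integral>y. F k y \<partial>lborel) = of_real (gauss (k /\<^sub>R m) * (cmod (fourier h k))\<^sup>2)" for k
    proof -
      have "(\<integral>y. F k y \<partial>lborel) = of_real (gauss (k /\<^sub>R m)) * (cnj (fourier h k) * fourier h k)"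
        by (simp add: F_def fourier_def mult.assoc)
      then show ?thesis
        by (simp add: complex_norm_square mult.commute del: of_real_power)
    qed
    moreover have "(\<integral>k. F k y \<partial>lborel) = h y * cnj (mollify m h y)" for y
    proof -
      have "F k y = h y * cnj (fker k (- y) * (of_real (gauss (k /\<^sub>R m)) * fourier h k))" for k
        by (simp add: F_def cnj_fker fker_commute[of y k])
      then have "(\<integral>k. F k y \<partial>lborel) = h y * (\<integral>k. cnj (fker k (- y) * (of_real (gauss (k /\<^sub>R m)) * fourier h k)) \<partial>lborel)"
        by (simp only: integral_mult_right_zero)
      also have "\<dots> = h y * cnj (fourier (\<lambda>k. of_real (gauss (k /\<^sub>R m)) * fourier h k) (- y))"
        unfolding Bochner_Integration.integral_cnj by (simp only: fourier_def)
      finally show ?thesis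
        by (simp add: fourier_gauss_cutoff[OF h m])
    qed
    ultimately have eq: "(\<integral>k. complex_of_real (gauss (k /\<^sub>R m) * (cmod (fourier h k))\<^sup>2) \<partial>lborel) = l2_inner h (mollify m h)"
      by (simp add: l2_inner_def)
    have int2: "integrable lborel (\<lambda>k. gauss (k /\<^sub>R m) * (cmod (fourier h k))\<^sup>2)"
      by (rule Bochner_Integration.integrable_bound[OF integrable_mult_left[OF int1, of ?I]])
        (auto simp: abs_mult power2_eq_square mult.assoc intro!: mult_left_mono order_trans[OF norm_fourier_le])
    have "(\<integral>k. gauss (k /\<^sub>R m) * (cmod (fourier h k))\<^sup>2 \<partial>lborel) = Re (l2_inner h (mollify m h))"
      unfolding eq[symmetric] integral_complex_of_real by simp
    also have "\<dots> \<le> cmod (l2_inner h (mollify m h))"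
      by (rule complex_Re_le_cmod)
    also have "\<dots> \<le> l2_norm h * l2_norm (mollify m h)"
      by (intro cmod_l2_inner_le L2 mollify_L2)
    also have "\<dots> \<le> (l2_norm h)\<^sup>2"
      unfolding power2_eq_square by (intro mult_left_mono mollify_L2 L2) auto
    finally show ?thesis
      by (subst nn_integral_eq_integral[OF int2]) (auto intro: ennreal_leI)
  qed
  have "(\<integral>\<^sup>+k. ennreal ((cmod (fourier h k))\<^sup>2) \<partial>lborel)
      = (\<integral>\<^sup>+k. liminf (\<lambda>n. ennreal (gauss (k /\<^sub>R real (Suc n)) * (cmod (fourier h k))\<^sup>2)) \<partial>lborel)"
  proof (intro nn_integral_cong)
    fix k :: 'a
    have lim0: "(\<lambda>n. k /\<^sub>R real (Suc n)) \<longlonglongrightarrow> 0 *\<^sub>R k"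
      by (rule tendsto_scaleR[OF LIMSEQ_inverse_real_of_nat tendsto_const])
    have "(\<lambda>n. gauss (k /\<^sub>R real (Suc n)) * (cmod (fourier h k))\<^sup>2) \<longlonglongrightarrow> exp (- pi * (norm (0 *\<^sub>R k))\<^sup>2) * (cmod (fourier h k))\<^sup>2"
      unfolding gauss_def by (intro tendsto_mult tendsto_exp tendsto_power tendsto_norm tendsto_const lim0)
    then have "(\<lambda>n. ennreal (gauss (k /\<^sub>R real (Suc n)) * (cmod (fourier h k))\<^sup>2)) \<longlonglongrightarrow> ennreal ((cmod (fourier h k))\<^sup>2)"
      by (intro tendsto_ennrealI) simp
    then show "ennreal ((cmod (fourier h k))\<^sup>2) = liminf (\<lambda>n. ennreal (gauss (k /\<^sub>R real (Suc n)) * (cmod (fourier h k))\<^sup>2))"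
      using lim_imp_Liminf[OF trivial_limit_sequentially] by metis
  qed
  also have "\<dots> \<le> liminf (\<lambda>n. \<integral>\<^sup>+k. ennreal (gauss (k /\<^sub>R real (Suc n)) * (cmod (fourier h k))\<^sup>2) \<partial>lborel)"
    by (intro nn_integral_liminf) measurable
  also have "\<dots> \<le> liminf (\<lambda>n::nat. ennreal ((l2_norm h)\<^sup>2))"
    by (intro Liminf_mono always_eventually allI cutoff) simp
  also have "\<dots> = ennreal ((l2_norm h)\<^sup>2)"
    by (simp add: Liminf_const)
  finally show ?thesis
    by (simp add: nn_integral_L2_square[OF L2])
qed

section \<open>Partial Fourier transform\<close>

lemma partial_fourier_integral_eq: "partial_fourier_integral f (x, K) = fourier (\<lambda>k. f (x, k)) K"
  by (simp add: partial_fourier_integral_def fourier_def fker_def)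

lemma measurable_partial_fourier_integral [measurable]:
  fixes f :: "'a::euclidean_space \<times> 'a \<Rightarrow> complex"
  assumes [measurable]: "f \<in> borel_measurable borel"
  shows "partial_fourier_integral f \<in> borel_measurable borel"
proof -
  have [measurable]: "f \<in> borel_measurable (borel \<Otimes>\<^sub>M borel)"
    by (simp add: borel_prod)
  have "(\<lambda>z. fourier (\<lambda>k. (\<lambda>(z, k). f (fst z, k)) (z, k)) (snd z)) \<in> borel_measurable (borel \<Otimes>\<^sub>M borel)"
    by (rule measurable_fourier) measurable
  then show ?thesis
    by (simp add: partial_fourier_integral_eq[symmetric] borel_prod)
qed

lemma L2_slice_AE:
  fixes f :: "'a::euclidean_space \<times> 'b::euclidean_space \<Rightarrow> complex"
  assumes f: "f \<in> L2"
  shows "AE x in lborel. (\<lambda>y. f (x, y)) \<in> L2"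
proof -
  have [measurable]: "f \<in> borel_measurable borel"
    using f by (rule L2_measurable)
  have "(\<integral>\<^sup>+x. \<integral>\<^sup>+y. ennreal ((cmod (f (x, y)))\<^sup>2) \<partial>lborel \<partial>lborel) = (\<integral>\<^sup>+z. ennreal ((cmod (f z))\<^sup>2) \<partial>lborel)"
    by (rule nn_integral_lborel_pair(1)[symmetric]) measurable
  also have "\<dots> < \<infinity>"
    using f by (simp add: L2_iff_nn_integral)
  finally have "AE x in lborel. (\<integral>\<^sup>+y. ennreal ((cmod (f (x, y)))\<^sup>2) \<partial>lborel) \<noteq> \<infinity>"
    by (intro nn_integral_PInf_AE) auto
  then show ?thesis
    by eventually_elim (simp add: L2_iff_nn_integral less_top)
qed

text \<open>The Plancherel inequality on almost every slice. Integrability is asked slicewise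
  because that is what the kernel estimates provide in the Wigner coordinates.\<close>

lemma partial_fourier_integral_L2_le:
  fixes f :: "'a::euclidean_space \<times> 'a \<Rightarrow> complex"
  assumes f: "f \<in> L2" and int: "AE x in lborel. integrable lborel (\<lambda>k. f (x, k))"
  shows "(\<integral>\<^sup>+z. ennreal ((cmod (partial_fourier_integral f z))\<^sup>2) \<partial>lborel) \<le> (\<integral>\<^sup>+z. ennreal ((cmod (f z))\<^sup>2) \<partial>lborel)"
proof -
  have [measurable]: "f \<in> borel_measurable borel"
    using f by (rule L2_measurable)
  have "(\<integral>\<^sup>+z. ennreal ((cmod (partial_fourier_integral f z))\<^sup>2) \<partial>lborel)
      = (\<integral>\<^sup>+x. \<integral>\<^sup>+K. ennreal ((cmod (partial_fourier_integral f (x, K)))\<^sup>2) \<partial>lborel \<partial>lborel)"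
    by (rule nn_integral_lborel_pair(1)) measurable
  also have "\<dots> \<le> (\<integral>\<^sup>+x. \<integral>\<^sup>+k. ennreal ((cmod (f (x, k)))\<^sup>2) \<partial>lborel \<partial>lborel)"
  proof (intro nn_integral_mono_AE, use int L2_slice_AE[OF f] in eventually_elim)
    case (elim x)
    then show ?case
      unfolding partial_fourier_integral_eq by (rule fourier_L2_le)
  qed
  also have "\<dots> = (\<integral>\<^sup>+z. ennreal ((cmod (f z))\<^sup>2) \<partial>lborel)"
    by (rule nn_integral_lborel_pair(1)[symmetric]) measurable
  finally show ?thesis .
qed

lemma partial_fourier_integral_L2:
  fixes f :: "'a::euclidean_space \<times> 'a \<Rightarrow> complex"
  assumes f: "f \<in> L2" and int: "AE x in lborel. integrable lborel (\<lambda>k. f (x, k))"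
  shows "partial_fourier_integral f \<in> L2" and "l2_norm (partial_fourier_integral f) \<le> l2_norm f"
proof -
  have [measurable]: "f \<in> borel_measurable borel"
    using f by (rule L2_measurable)
  have le: "(\<integral>\<^sup>+z. ennreal ((cmod (partial_fourier_integral f z))\<^sup>2) \<partial>lborel) \<le> ennreal ((l2_norm f)\<^sup>2)"
    using partial_fourier_integral_L2_le[OF f int] nn_integral_L2_square[OF f] by simp
  then show 1: "partial_fourier_integral f \<in> L2"
    by (auto simp: L2_iff_nn_integral intro: le_less_trans)
  from le show "l2_norm (partial_fourier_integral f) \<le> l2_norm f"
    by (simp add: nn_integral_L2_square[OF 1])
qed

lemma integrable_slice_AE:
  fixes f :: "'a::euclidean_space \<times> 'b::euclidean_space \<Rightarrow> complex"
  assumes "integrable lborel f"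
  shows "AE x in lborel. integrable lborel (\<lambda>y. f (x, y))"
  using lborel_pair.AE_integrable_fst'[of f] assms unfolding lborel_prod by blast

lemma l2_tendsto_iff:
  assumes "\<And>m. \<phi> m \<in> L2" "f \<in> L2"
  shows "l2_tendsto \<phi> f \<longleftrightarrow> (\<lambda>m. l2_norm (\<lambda>z. \<phi> m z - f z)) \<longlonglongrightarrow> 0"
proof -
  have "l2_tendsto \<phi> f \<longleftrightarrow> (\<lambda>m. ennreal ((l2_norm (\<lambda>z. \<phi> m z - f z))\<^sup>2)) \<longlonglongrightarrow> ennreal 0"
    using assms by (simp add: l2_tendsto_def nn_integral_L2_square L2_diff)
  also have "\<dots> \<longleftrightarrow> (\<lambda>m. (l2_norm (\<lambda>z. \<phi> m z - f z))\<^sup>2) \<longlonglongrightarrow> 0"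
    by (intro tendsto_ennreal_iff) auto
  also have "\<dots> \<longleftrightarrow> (\<lambda>m. l2_norm (\<lambda>z. \<phi> m z - f z)) \<longlonglongrightarrow> 0"
  proof
    assume "(\<lambda>m. (l2_norm (\<lambda>z. \<phi> m z - f z))\<^sup>2) \<longlonglongrightarrow> 0"
    then have "(\<lambda>m. sqrt ((l2_norm (\<lambda>z. \<phi> m z - f z))\<^sup>2)) \<longlonglongrightarrow> sqrt 0"
      by (rule tendsto_real_sqrt)
    then show "(\<lambda>m. l2_norm (\<lambda>z. \<phi> m z - f z)) \<longlonglongrightarrow> 0"
      by simp
  next
    assume "(\<lambda>m. l2_norm (\<lambda>z. \<phi> m z - f z)) \<longlonglongrightarrow> 0"
    from tendsto_power[OF this, of 2] show "(\<lambda>m. (l2_norm (\<lambda>z. \<phi> m z - f z))\<^sup>2) \<longlonglongrightarrow> 0"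
      by simp
  qed
  finally show ?thesis .
qed

text \<open>The predicate under the choice in \<open>partial_fourier\<close>, given a name so that
  existence and uniqueness can be stated for it.\<close>

definition is_partial_fourier ::
    "('a::euclidean_space \<times> 'a \<Rightarrow> complex) \<Rightarrow> ('a \<times> 'a \<Rightarrow> complex) \<Rightarrow> bool"
  where "is_partial_fourier f G \<longleftrightarrow> G \<in> L2 \<and>
    (\<exists>\<phi>. (\<forall>m. \<phi> m \<in> L2 \<and> integrable lborel (\<phi> m)) \<and>
         l2_tendsto \<phi> f \<and> l2_tendsto (\<lambda>m. partial_fourier_integral (\<phi> m)) G)"

text \<open>The integral transform is a contraction for the norm on integrable \<open>L2\<close>
  functions, so two approximating sequences with the same limit have transforms with the same
  limit.\<close>

lemma is_partial_fourier_unique: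
  assumes f: "f \<in> L2" and G: "is_partial_fourier f G" and G': "is_partial_fourier f G'"
  shows "AE z in lborel. G z = G' z"
proof -
  obtain \<phi> where L: "G \<in> L2" "\<And>m. \<phi> m \<in> L2" "\<And>m. integrable lborel (\<phi> m)"
      and lim0: "l2_tendsto \<phi> f" "l2_tendsto (\<lambda>m. partial_fourier_integral (\<phi> m)) G"
    using G unfolding is_partial_fourier_def by blast
  obtain \<phi>' where L': "G' \<in> L2" "\<And>m. \<phi>' m \<in> L2" "\<And>m. integrable lborel (\<phi>' m)"
      and lim0': "l2_tendsto \<phi>' f" "l2_tendsto (\<lambda>m. partial_fourier_integral (\<phi>' m)) G'"
    using G' unfolding is_partial_fourier_def by blast
  let ?P = "\<lambda>m. partial_fourier_integral (\<phi> m)" and ?P' = "\<lambda>m. partial_fourier_integral (\<phi>' m)"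
  have P: "?P m \<in> L2" and P': "?P' m \<in> L2" for m
    by (intro partial_fourier_integral_L2(1) integrable_slice_AE L L')+
  have lim: "(\<lambda>m. l2_norm (\<lambda>z. \<phi> m z - f z)) \<longlonglongrightarrow> 0" "(\<lambda>m. l2_norm (\<lambda>z. ?P m z - G z)) \<longlonglongrightarrow> 0"
    using lim0 L f P by (simp_all add: l2_tendsto_iff)
  have lim': "(\<lambda>m. l2_norm (\<lambda>z. \<phi>' m z - f z)) \<longlonglongrightarrow> 0" "(\<lambda>m. l2_norm (\<lambda>z. ?P' m z - G' z)) \<longlonglongrightarrow> 0"
    using lim0' L' f P' by (simp_all add: l2_tendsto_iff)
  have PP': "l2_norm (\<lambda>z. ?P m z - ?P' m z) \<le> l2_norm (\<lambda>z. \<phi> m z - \<phi>' m z)" for m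
  proof -
    have D: "(\<lambda>z. \<phi> m z - \<phi>' m z) \<in> L2" "integrable lborel (\<lambda>z. \<phi> m z - \<phi>' m z)"
      using L L' by (auto intro: L2_diff)
    have [measurable]: "\<phi> m \<in> borel_measurable borel" "\<phi>' m \<in> borel_measurable borel"
      using L(2) L'(2) by (auto dest: L2_measurable)
    have "AE z in lborel. ?P m z - ?P' m z = partial_fourier_integral (\<lambda>z. \<phi> m z - \<phi>' m z) z"
    proof (rule AE_lborel_pairI)
      show "AE x in lborel. AE K in lborel. ?P m (x, K) - ?P' m (x, K) = partial_fourier_integral (\<lambda>z. \<phi> m z - \<phi>' m z) (x, K)"
        using integrable_slice_AE[OF L(3)[of m]] integrable_slice_AE[OF L'(3)[of m]]
      proof eventually_elim
        case (elim x)
        have "integrable lborel (\<lambda>k. fker k K * g k)" if "integrable lborel g" for g :: "'a \<Rightarrow> complex" and K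
          by (rule Bochner_Integration.integrable_bound[OF that]) (use that in \<open>auto simp: norm_mult\<close>)
        with elim show ?case
          by (simp add: partial_fourier_integral_eq fourier_def right_diff_distrib)
      qed
    qed measurable
    then have "l2_norm (\<lambda>z. ?P m z - ?P' m z) = l2_norm (partial_fourier_integral (\<lambda>z. \<phi> m z - \<phi>' m z))"
      unfolding l2_norm_def by (intro arg_cong[where f=sqrt] integral_cong_AE) auto
    also have "\<dots> \<le> l2_norm (\<lambda>z. \<phi> m z - \<phi>' m z)"
      using D by (intro partial_fourier_integral_L2 integrable_slice_AE)
    finally show ?thesis .
  qed
  have triangle: "l2_norm (\<lambda>z. u z - w z) \<le> l2_norm (\<lambda>z. v z - u z) + l2_norm (\<lambda>z. v z - w z)"
    if "u \<in> L2" "v \<in> L2" "w \<in> L2" for u v w :: "'a \<times> 'a \<Rightarrow> complex"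
    using l2_norm_add_le[of "\<lambda>z. u z - v z" "\<lambda>z. v z - w z"] that
    by (simp add: L2_diff l2_norm_diff_commute[of u v])
  let ?e = "\<lambda>m. l2_norm (\<lambda>z. ?P m z - G z) + ((l2_norm (\<lambda>z. \<phi> m z - f z) + l2_norm (\<lambda>z. \<phi>' m z - f z)) + l2_norm (\<lambda>z. ?P' m z - G' z))"
  have "l2_norm (\<lambda>z. G z - G' z) \<le> ?e m" for m
  proof -
    have "l2_norm (\<lambda>z. G z - G' z) \<le> l2_norm (\<lambda>z. ?P m z - G z) + l2_norm (\<lambda>z. ?P m z - G' z)"
      using L(1) P L'(1) by (rule triangle)
    also have "l2_norm (\<lambda>z. ?P m z - G' z) \<le> l2_norm (\<lambda>z. ?P' m z - ?P m z) + l2_norm (\<lambda>z. ?P' m z - G' z)"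
      using P P' L'(1) by (rule triangle)
    also have "l2_norm (\<lambda>z. ?P' m z - ?P m z) \<le> l2_norm (\<lambda>z. \<phi> m z - \<phi>' m z)"
      using PP'[of m] by (subst l2_norm_diff_commute)
    also have "\<dots> \<le> l2_norm (\<lambda>z. f z - \<phi> m z) + l2_norm (\<lambda>z. f z - \<phi>' m z)"
      using L(2) f L'(2) by (rule triangle)
    finally show ?thesis
      by (simp add: l2_norm_diff_commute[of f])
  qed
  moreover have "?e \<longlonglongrightarrow> 0 + ((0 + 0) + 0)"
    by (intro tendsto_add lim lim')
  ultimately have "l2_norm (\<lambda>z. G z - G' z) \<le> 0"
    by (intro LIMSEQ_le_const[of ?e]) auto
  then have "l2_norm (\<lambda>z. G z - G' z) = 0"
    using l2_norm_nonneg[of "\<lambda>z. G z - G' z"] by linarith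
  then show ?thesis
    using l2_norm_eq_0_iff[OF L2_diff[OF L(1) L'(1)]] by auto
qed

lemma measurable_mollify_slice:
  fixes H :: "'a::euclidean_space \<times> 'b::euclidean_space \<Rightarrow> complex"
  assumes H: "H \<in> borel_measurable borel"
  shows "(\<lambda>z. mollify m (\<lambda>y. H (fst z, y)) (snd z)) \<in> borel_measurable borel"
proof -
  have [measurable]: "H \<in> borel_measurable (borel \<Otimes>\<^sub>M borel)"
    using H by (simp add: borel_prod)
  have "(\<lambda>z. mollify m (\<lambda>y. H (fst z, y)) (snd z)) \<in> borel_measurable (borel \<Otimes>\<^sub>M borel)"
    unfolding mollify_def by measurable
  then show ?thesis
    by (simp add: borel_prod)
qed

text \<open>By Jensen and Tonelli the squared error is at most the Gaussian average of squared
  translation errors in the second variable. Each of these tends to 0 and is bounded by (2 |H|)^2,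
  so dominated convergence applies.\<close>

lemma mollify_slice_tendsto:
  fixes H :: "'a::euclidean_space \<times> 'b::euclidean_space \<Rightarrow> complex"
  assumes H: "H \<in> L2"
  shows "(\<lambda>n. \<integral>\<^sup>+z. ennreal ((cmod (mollify (real (Suc n)) (\<lambda>y. H (fst z, y)) (snd z) - H z))\<^sup>2) \<partial>lborel) \<longlonglongrightarrow> 0"
proof -
  have [measurable]: "H \<in> borel_measurable borel"
    using H by (rule L2_measurable)
  define s where "s n w = (0::'a, w /\<^sub>R real (Suc n))" for n and w :: 'b
  define \<omega> where "\<omega> n w = (l2_norm (\<lambda>z. H (z + s n w) - H z))\<^sup>2" for n w
  have s_meas [measurable]: "s n \<in> borel_measurable borel" for n
    unfolding s_def by measurable
  have \<omega>_nn: "ennreal (\<omega> n w) = (\<integral>\<^sup>+z. ennreal ((cmod (H (z + s n w) - H z))\<^sup>2) \<partial>lborel)" for n w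
    unfolding \<omega>_def using H by (intro nn_integral_L2_square[symmetric] L2_diff L2_shift)
  have \<omega>_meas [measurable]: "(\<lambda>w. ennreal (\<omega> n w)) \<in> borel_measurable borel" for n
    unfolding \<omega>_nn by measurable
  have \<omega>_le: "\<omega> n w \<le> (2 * l2_norm H)\<^sup>2" for n w
  proof -
    have "l2_norm (\<lambda>z. H (z + s n w) - H z) \<le> l2_norm (\<lambda>z. H (z + s n w)) + l2_norm (\<lambda>z. - H z)"
      using l2_norm_add_le[of "\<lambda>z. H (z + s n w)" "\<lambda>z. - H z"] H by (simp add: L2_shift L2_uminus)
    also have "\<dots> = 2 * l2_norm H"
      using L2_shift(2)[OF H, of "s n w"] by (simp add: l2_norm_def)
    finally show ?thesis
      unfolding \<omega>_def by (intro power_mono) auto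
  qed
  have \<omega>_lim: "(\<lambda>n. \<omega> n w) \<longlonglongrightarrow> 0" for w
  proof -
    have "(\<lambda>n. s n w) \<longlonglongrightarrow> (0, 0 *\<^sub>R w)"
      unfolding s_def by (intro tendsto_Pair tendsto_const tendsto_scaleR LIMSEQ_inverse_real_of_nat)
    then have "(\<lambda>n. s n w) \<longlonglongrightarrow> 0"
      by (simp add: zero_prod_def)
    then have "(\<lambda>n. l2_norm (\<lambda>z. H (z + s n w) - H z)) \<longlonglongrightarrow> 0"
      by (rule L2_shift_continuous[OF H])
    from tendsto_power[OF this, of 2] show ?thesis
      by (simp add: \<omega>_def)
  qed
  have le: "(\<integral>\<^sup>+z. ennreal ((cmod (mollify (real (Suc n)) (\<lambda>y. H (fst z, y)) (snd z) - H z))\<^sup>2) \<partial>lborel)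
      \<le> (\<integral>\<^sup>+w. ennreal (\<omega> n w) * ennreal (gauss w) \<partial>lborel)" for n
  proof -
    let ?m = "real (Suc n)"
    \<comment> \<open>Square integrability of the slice makes it integrable against the Gaussian, so
      that subtracting the constant \<open>H (x, y)\<close> under the integral is legitimate, for
      every y at once.\<close>
    have "AE x in lborel. \<forall>y. ennreal ((cmod (mollify ?m (\<lambda>y. H (x, y)) y - H (x, y)))\<^sup>2)
        \<le> (\<integral>\<^sup>+w. ennreal ((cmod (H ((x, y) + s n w) - H (x, y)))\<^sup>2) * ennreal (gauss w) \<partial>lborel)"
      using L2_slice_AE[OF H]
    proof eventually_elim
      case (elim x)
      show ?case
      proof
        fix y
        have "(\<lambda>w. H (x, y + w /\<^sub>R ?m)) \<in> L2"
        proof -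
          have "(\<lambda>w. H (x, w + y)) \<in> L2"
            using elim by (rule L2_shift(1))
          then have fin: "(\<integral>\<^sup>+w. ennreal ((cmod (H (x, w + y)))\<^sup>2) \<partial>lborel) < \<infinity>"
            by (simp add: L2_iff_nn_integral)
          have "(\<integral>\<^sup>+w. ennreal ((cmod (H (x, w + y)))\<^sup>2) \<partial>lborel)
              = ennreal (\<bar>1 / ?m\<bar> ^ DIM('b)) * (\<integral>\<^sup>+w. ennreal ((cmod (H (x, (0 + (1 / ?m) *\<^sub>R w) + y)))\<^sup>2) \<partial>lborel)"
          proof (rule nn_integral_lborel_affine)
            show "(\<lambda>w. ennreal ((cmod (H (x, w + y)))\<^sup>2)) \<in> borel_measurable borel"
              by measurable
          qed simp
          then have "(\<integral>\<^sup>+w. ennreal ((cmod (H (x, y + w /\<^sub>R ?m)))\<^sup>2) \<partial>lborel) < \<infinity>"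
            using fin by (auto simp: ennreal_mult_less_top inverse_eq_divide add.commute)
          then show ?thesis
            by (simp add: L2_iff_nn_integral)
        qed
        then have "integrable lborel (\<lambda>w. H (x, y + w /\<^sub>R ?m) * of_real (gauss w))"
          by (rule L2_integrable_mult[OF _ gauss_L2])
        moreover have "integrable lborel (\<lambda>w. H (x, y) * of_real (gauss (w::'b)))"
          using integrable_gauss by (intro integrable_mult_right integrable_of_real)
        moreover have "(\<integral>w. H (x, y) * of_real (gauss (w::'b)) \<partial>lborel) = H (x, y)"
          by (simp add: integral_complex_of_real integral_gauss)
        ultimately have "mollify ?m (\<lambda>y. H (x, y)) y - H (x, y) = (\<integral>w. (H ((x, y) + s n w) - H (x, y)) * of_real (gauss w) \<partial>lborel)"
          by (simp add: mollify_def s_def left_diff_distrib)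
        then show "ennreal ((cmod (mollify ?m (\<lambda>y. H (x, y)) y - H (x, y)))\<^sup>2)
            \<le> (\<integral>\<^sup>+w. ennreal ((cmod (H ((x, y) + s n w) - H (x, y)))\<^sup>2) * ennreal (gauss w) \<partial>lborel)"
          by (simp only:) (rule gauss_average_square_le, measurable)
      qed
    qed
    have moll_meas [measurable]: "(\<lambda>z. mollify ?m (\<lambda>y. H (fst z, y)) (snd z)) \<in> borel_measurable borel"
      by (rule measurable_mollify_slice) measurable
    have "(\<integral>\<^sup>+z. ennreal ((cmod (mollify ?m (\<lambda>y. H (fst z, y)) (snd z) - H z))\<^sup>2) \<partial>lborel)
        = (\<integral>\<^sup>+x. \<integral>\<^sup>+y. ennreal ((cmod (mollify ?m (\<lambda>y. H (x, y)) y - H (x, y)))\<^sup>2) \<partial>lborel \<partial>lborel)"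
      by (subst nn_integral_lborel_pair(1)) (simp_all del: of_nat_Suc)
    also have "\<dots> \<le> (\<integral>\<^sup>+x. \<integral>\<^sup>+y. \<integral>\<^sup>+w. ennreal ((cmod (H ((x, y) + s n w) - H (x, y)))\<^sup>2) * ennreal (gauss w) \<partial>lborel \<partial>lborel \<partial>lborel)"
      using \<open>AE x in lborel. \<forall>y. _ x y \<le> _ x y\<close> by (intro nn_integral_mono_AE) (auto elim!: eventually_mono intro!: nn_integral_mono)
    also have "\<dots> = (\<integral>\<^sup>+z. \<integral>\<^sup>+w. ennreal ((cmod (H (z + s n w) - H z))\<^sup>2) * ennreal (gauss w) \<partial>lborel \<partial>lborel)"
      by (rule nn_integral_lborel_pair(1)[symmetric]) measurable
    also have "\<dots> = (\<integral>\<^sup>+w. \<integral>\<^sup>+z. ennreal ((cmod (H (z + s n w) - H z))\<^sup>2) * ennreal (gauss w) \<partial>lborel \<partial>lborel)"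
      by (rule lborel_pair.Fubini') measurable
    also have "\<dots> = (\<integral>\<^sup>+w. ennreal (\<omega> n w) * ennreal (gauss w) \<partial>lborel)"
      unfolding \<omega>_nn by (intro nn_integral_cong nn_integral_multc) measurable
    finally show ?thesis .
  qed
  have "(\<lambda>n. \<integral>\<^sup>+w. ennreal (\<omega> n w) * ennreal (gauss w) \<partial>lborel) \<longlonglongrightarrow> (\<integral>\<^sup>+w. 0 \<partial>(lborel :: 'b measure))"
  proof (rule nn_integral_dominated_convergence[where w="\<lambda>w. ennreal ((2 * l2_norm H)\<^sup>2) * ennreal (gauss w)"])
    show "AE w in lborel. ennreal (\<omega> n w) * ennreal (gauss w) \<le> ennreal ((2 * l2_norm H)\<^sup>2) * ennreal (gauss w)" for n
      by (intro AE_I2 mult_right_mono ennreal_leI \<omega>_le) auto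
    show "(\<integral>\<^sup>+w. ennreal ((2 * l2_norm H)\<^sup>2) * ennreal (gauss (w::'b)) \<partial>lborel) < \<infinity>"
      by (subst nn_integral_cmult) (auto simp: nn_integral_gauss)
    show "AE w in lborel. (\<lambda>n. ennreal (\<omega> n w) * ennreal (gauss w)) \<longlonglongrightarrow> 0"
    proof (intro AE_I2)
      fix w :: 'b
      have "(\<lambda>n. ennreal (\<omega> n w * gauss w)) \<longlonglongrightarrow> ennreal (0 * gauss w)"
        by (intro tendsto_ennrealI tendsto_mult \<omega>_lim tendsto_const)
      then show "(\<lambda>n. ennreal (\<omega> n w) * ennreal (gauss w)) \<longlonglongrightarrow> 0"
        by (simp add: ennreal_mult \<omega>_def)
    qed
  qed measurable
  then have lim: "(\<lambda>n. \<integral>\<^sup>+w. ennreal (\<omega> n w) * ennreal (gauss w) \<partial>lborel) \<longlonglongrightarrow> 0"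
    by simp
  show ?thesis
    by (rule tendsto_sandwich[OF _ _ tendsto_const lim]) (simp_all add: le del: of_nat_Suc)
qed


text \<open>The transform W of \<open>H\<close> is approximated by cutoffs of W, whose integral
  transforms are computed by \<open>fourier_gauss_cutoff\<close> as mollified slices of
  \<open>H\<close> at -K. Mollifications converge to \<open>H\<close> in norm, which identifies the
  limit.\<close>

theorem is_partial_fourier_inversion:
  fixes H :: "'a::euclidean_space \<times> 'a \<Rightarrow> complex"
  assumes H: "H \<in> L2" and int: "AE x in lborel. integrable lborel (\<lambda>y. H (x, y))"
  shows "is_partial_fourier (partial_fourier_integral H) (\<lambda>(x, K). H (x, - K))"
proof -
  have [measurable]: "H \<in> borel_measurable borel"
    using H by (rule L2_measurable)
  have "(\<lambda>z::'a \<times> 'a. (fst z, - snd z)) \<in> borel_measurable borel"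
    by (intro borel_measurable_continuous_onI continuous_intros)
  then have [measurable]: "(\<lambda>z. H (fst z, - snd z)) \<in> borel_measurable borel"
    by (rule measurable_compose) measurable
  define W where "W = partial_fourier_integral H"
  have W: "W \<in> L2"
    unfolding W_def by (rule partial_fourier_integral_L2[OF H int])
  have [measurable]: "W \<in> borel_measurable borel"
    using W by (rule L2_measurable)
  \<comment> \<open>The cutoff must be square integrable in both variables for its product with W to
    be integrable: a ball suffices in x, where no transform is taken, and the Gaussian acts in k.
    \<open>Suc n\<close> keeps the Gaussian width positive.\<close>
  define ind :: "nat \<Rightarrow> 'a \<Rightarrow> real" where "ind n x = indicator (cball 0 (real (Suc n))) x" for n x
  define c where "c n z = ind n (fst z) * gauss (snd z /\<^sub>R real (Suc n))" for n and z :: "'a \<times> 'a"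
  have [measurable]: "cball (0::'a) r \<in> sets borel" for r
    by simp
  have [measurable]: "ind n \<in> borel_measurable borel" for n
    unfolding ind_def by measurable
  have ind_fst: "(\<lambda>z::'a \<times> 'a. ind n (fst z)) \<in> borel_measurable (borel \<Otimes>\<^sub>M borel)" for n
    by measurable
  have gauss_snd: "(\<lambda>z::'a \<times> 'a. gauss (snd z /\<^sub>R real (Suc n))) \<in> borel_measurable (borel \<Otimes>\<^sub>M borel)" for n
    by measurable
  have "c n \<in> borel_measurable (borel \<Otimes>\<^sub>M borel)" for n
    unfolding c_def by measurable
  with ind_fst gauss_snd have [measurable]: "(\<lambda>z::'a \<times> 'a. ind n (fst z)) \<in> borel_measurable borel"
      "(\<lambda>z::'a \<times> 'a. gauss (snd z /\<^sub>R real (Suc n))) \<in> borel_measurable borel" "c n \<in> borel_measurable borel" for n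
    unfolding borel_prod .
  have ind01: "0 \<le> ind n x" "ind n x \<le> 1" for n x
    by (simp_all add: ind_def indicator_def)
  have c01: "0 \<le> c n z" "c n z \<le> 1" for n z
    unfolding c_def using ind01 by (auto intro: mult_le_one)
  have ind_lim: "(\<lambda>n. ind n x) \<longlonglongrightarrow> 1" for x
  proof -
    obtain N where N: "norm x \<le> real N"
      using real_arch_simple by blast
    have "ind n x = 1" if "n \<ge> N" for n
      using N that by (simp add: ind_def)
    then show ?thesis
      by (intro tendsto_eventually eventually_sequentiallyI)
  qed
  have c_lim: "(\<lambda>n. c n z) \<longlonglongrightarrow> 1" for z
  proof -
    have "(\<lambda>n. snd z /\<^sub>R real (Suc n)) \<longlonglongrightarrow> 0 *\<^sub>R snd z"
      by (rule tendsto_scaleR[OF LIMSEQ_inverse_real_of_nat tendsto_const])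
    then have "(\<lambda>n. gauss (snd z /\<^sub>R real (Suc n))) \<longlonglongrightarrow> exp (- pi * (norm (0 *\<^sub>R snd z))\<^sup>2)"
      unfolding gauss_def by (intro tendsto_mult tendsto_exp tendsto_power tendsto_norm tendsto_const)
    from tendsto_mult[OF ind_lim this, of "fst z"] show ?thesis
      by (simp add: c_def)
  qed
  define \<phi> where "\<phi> n z = of_real (c n z) * W z" for n z
  have c_L2: "(\<lambda>z. complex_of_real (c n z)) \<in> L2" for n
  proof -
    let ?m = "real (Suc n)"
    have "(\<integral>\<^sup>+z. ennreal ((cmod (of_real (c n z)))\<^sup>2) \<partial>lborel) \<le> (\<integral>\<^sup>+z. ennreal (ind n (fst z)) * ennreal (gauss ((snd z :: 'a) /\<^sub>R ?m)) \<partial>lborel)"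
    proof (intro nn_integral_mono)
      fix z :: "'a \<times> 'a"
      have "(c n z)\<^sup>2 \<le> c n z"
        using c01[of n z] by (simp add: power2_eq_square mult_left_le_one_le)
      then show "ennreal ((cmod (of_real (c n z)))\<^sup>2) \<le> ennreal (ind n (fst z)) * ennreal (gauss (snd z /\<^sub>R ?m))"
        unfolding norm_of_real power2_abs ennreal_mult[OF ind01(1) gauss_pos(2), symmetric] c_def[symmetric]
        by (rule ennreal_leI)
    qed
    also have "\<dots> = (\<integral>\<^sup>+x. \<integral>\<^sup>+k. ennreal (ind n x) * ennreal (gauss ((k::'a) /\<^sub>R ?m)) \<partial>lborel \<partial>lborel)"
      by (subst nn_integral_lborel_pair(1)) (simp_all del: of_nat_Suc)
    also have "\<dots> = (\<integral>\<^sup>+x. ennreal (ind n x) \<partial>lborel) * (\<integral>\<^sup>+k. ennreal (gauss ((k::'a) /\<^sub>R ?m)) \<partial>lborel)"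
      by (simp add: nn_integral_cmult nn_integral_multc)
    also have "\<dots> < \<infinity>"
    proof -
      have "(\<integral>\<^sup>+x. ennreal (ind n x) \<partial>lborel) = emeasure lborel (cball (0::'a) ?m)"
        by (simp add: ind_def ennreal_indicator)
      also have "\<dots> < \<infinity>"
        by (rule emeasure_bounded_finite) simp
      finally have "(\<integral>\<^sup>+x. ennreal (ind n x) \<partial>lborel) < \<infinity>" .
      moreover have "(\<integral>\<^sup>+k. ennreal (gauss ((k::'a) /\<^sub>R ?m)) \<partial>lborel) < \<infinity>"
        using integrable_gauss_scaled[of ?m, where 'a='a] by (simp add: integrable_iff_bounded)
      ultimately show ?thesis
        by (simp add: ennreal_mult_less_top)
    qed
    finally show ?thesis
      by (simp add: L2_iff_nn_integral)
  qed
  have \<phi>_int: "integrable lborel (\<phi> n)" for n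
    unfolding \<phi>_def by (rule L2_integrable_mult[OF c_L2 W])
  have \<phi>_L2: "\<phi> n \<in> L2" for n
  proof -
    have "integrable lborel (\<lambda>z. (cmod (\<phi> n z))\<^sup>2)"
    proof (rule Bochner_Integration.integrable_bound[OF L2_integrable_square[OF W]])
      show "AE z in lborel. norm ((cmod (\<phi> n z))\<^sup>2) \<le> norm ((cmod (W z))\<^sup>2)"
        using c01 by (intro AE_I2) (auto simp: \<phi>_def norm_mult power_mult_distrib mult_left_le_one_le power_le_one)
    qed (simp add: \<phi>_def)
    then show ?thesis
      using \<phi>_int by (simp add: L2_def)
  qed
  have "l2_tendsto \<phi> W"
    unfolding l2_tendsto_def
  proof -
    have "(\<lambda>n. \<integral>\<^sup>+z. ennreal ((cmod (\<phi> n z - W z))\<^sup>2) \<partial>lborel) \<longlonglongrightarrow> (\<integral>\<^sup>+z. 0 \<partial>(lborel :: ('a \<times> 'a) measure))"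
    proof (rule nn_integral_dominated_convergence[where w="\<lambda>z. ennreal ((cmod (W z))\<^sup>2)"])
      show "AE z in lborel. ennreal ((cmod (\<phi> n z - W z))\<^sup>2) \<le> ennreal ((cmod (W z))\<^sup>2)" for n
      proof (intro AE_I2 ennreal_leI)
        fix z
        have "\<phi> n z - W z = of_real (c n z - 1) * W z"
          by (simp add: \<phi>_def algebra_simps)
        then have "(cmod (\<phi> n z - W z))\<^sup>2 = (c n z - 1)\<^sup>2 * (cmod (W z))\<^sup>2"
          by (simp only: norm_mult norm_of_real power_mult_distrib power2_abs)
        also have "\<dots> \<le> 1 * (cmod (W z))\<^sup>2"
          using c01[of n z] by (intro mult_right_mono) (auto simp: power2_le_iff_abs_le abs_square_le_1)
        finally show "(cmod (\<phi> n z - W z))\<^sup>2 \<le> (cmod (W z))\<^sup>2"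
          by simp
      qed
      show "(\<integral>\<^sup>+z. ennreal ((cmod (W z))\<^sup>2) \<partial>lborel) < \<infinity>"
        using W by (simp add: L2_iff_nn_integral)
      show "AE z in lborel. (\<lambda>n. ennreal ((cmod (\<phi> n z - W z))\<^sup>2)) \<longlonglongrightarrow> 0"
      proof (intro AE_I2)
        fix z
        have "(\<lambda>n. ennreal ((cmod (of_real (c n z) * W z - W z))\<^sup>2)) \<longlonglongrightarrow> ennreal ((cmod (of_real 1 * W z - W z))\<^sup>2)"
          by (intro tendsto_intros c_lim)
        then show "(\<lambda>n. ennreal ((cmod (\<phi> n z - W z))\<^sup>2)) \<longlonglongrightarrow> 0"
          by (simp add: \<phi>_def)
      qed
    qed (simp_all add: \<phi>_def)
    then show "(\<lambda>n. \<integral>\<^sup>+z. ennreal ((cmod (\<phi> n z - W z))\<^sup>2) \<partial>lborel) \<longlonglongrightarrow> 0"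
      by simp
  qed
  moreover have "l2_tendsto (\<lambda>n. partial_fourier_integral (\<phi> n)) (\<lambda>(x, K). H (x, - K))"
    unfolding l2_tendsto_def
  proof -
    define M where "M n z = mollify (real (Suc n)) (\<lambda>y. H (fst z, y)) (snd z)" for n z
    have [measurable]: "M n \<in> borel_measurable borel" for n
      unfolding M_def by (rule measurable_mollify_slice) measurable
    have [measurable]: "\<phi> n \<in> borel_measurable borel" for n
      using \<phi>_L2 by (rule L2_measurable)
    have le: "(\<integral>\<^sup>+z. ennreal ((cmod (partial_fourier_integral (\<phi> n) z - (case z of (x, K) \<Rightarrow> H (x, - K))))\<^sup>2) \<partial>lborel)
        \<le> 2 * (\<integral>\<^sup>+z. ennreal ((cmod (M n z - H z))\<^sup>2) \<partial>lborel)
          + 2 * (\<integral>\<^sup>+z. ennreal ((1 - ind n (fst z)) * (cmod (H z))\<^sup>2) \<partial>lborel)" for n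
    proof -
      let ?m = "real (Suc n)"
      have pf: "AE x in lborel. \<forall>K. partial_fourier_integral (\<phi> n) (x, K) = of_real (ind n x) * M n (x, - K)"
        using int
      proof eventually_elim
        case (elim x)
        show ?case
        proof
          fix K
          have "partial_fourier_integral (\<phi> n) (x, K)
              = (\<integral>k. of_real (ind n x) * (fker k K * (of_real (gauss (k /\<^sub>R ?m)) * fourier (\<lambda>y. H (x, y)) k)) \<partial>lborel)"
            unfolding partial_fourier_integral_eq fourier_def[of _ K]
            by (intro Bochner_Integration.integral_cong) (simp_all add: \<phi>_def c_def W_def partial_fourier_integral_eq)
          also have "\<dots> = of_real (ind n x) * fourier (\<lambda>k. of_real (gauss (k /\<^sub>R ?m)) * fourier (\<lambda>y. H (x, y)) k) K"
            unfolding fourier_def[of _ K] by (rule integral_mult_right_zero)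
          also have "\<dots> = of_real (ind n x) * M n (x, - K)"
            using elim by (subst fourier_gauss_cutoff) (simp_all add: M_def)
          finally show "partial_fourier_integral (\<phi> n) (x, K) = of_real (ind n x) * M n (x, - K)" .
        qed
      qed
      have "(\<integral>\<^sup>+z. ennreal ((cmod (partial_fourier_integral (\<phi> n) z - (case z of (x, K) \<Rightarrow> H (x, - K))))\<^sup>2) \<partial>lborel)
          = (\<integral>\<^sup>+x. \<integral>\<^sup>+K. ennreal ((cmod (partial_fourier_integral (\<phi> n) (x, K) - H (x, - K)))\<^sup>2) \<partial>lborel \<partial>lborel)"
        by (subst nn_integral_lborel_pair(1)) (simp_all add: split_beta')
      also have "\<dots> = (\<integral>\<^sup>+x. \<integral>\<^sup>+K. ennreal ((cmod (of_real (ind n x) * M n (x, - K) - H (x, - K)))\<^sup>2) \<partial>lborel \<partial>lborel)"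
        using pf by (intro nn_integral_cong_AE) (auto elim!: eventually_mono)
      also have "\<dots> = (\<integral>\<^sup>+x. \<integral>\<^sup>+K. ennreal ((cmod (of_real (ind n x) * M n (x, K) - H (x, K)))\<^sup>2) \<partial>lborel \<partial>lborel)"
      proof (rule nn_integral_cong)
        fix x
        show "(\<integral>\<^sup>+K. ennreal ((cmod (of_real (ind n x) * M n (x, - K) - H (x, - K)))\<^sup>2) \<partial>lborel)
            = (\<integral>\<^sup>+K. ennreal ((cmod (of_real (ind n x) * M n (x, K) - H (x, K)))\<^sup>2) \<partial>lborel)"
          by (rule nn_integral_lborel_uminus[where f="\<lambda>K. ennreal ((cmod (of_real (ind n x) * M n (x, K) - H (x, K)))\<^sup>2)"])
            simp
      qed
      also have "\<dots> = (\<integral>\<^sup>+z. ennreal ((cmod (of_real (ind n (fst z)) * M n z - H z))\<^sup>2) \<partial>lborel)"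
        by (subst nn_integral_lborel_pair(1)) simp_all
      also have "\<dots> \<le> (\<integral>\<^sup>+z. 2 * ennreal ((cmod (M n z - H z))\<^sup>2) + 2 * ennreal ((1 - ind n (fst z)) * (cmod (H z))\<^sup>2) \<partial>lborel)"
      proof (intro nn_integral_mono)
        fix z :: "'a \<times> 'a"
        let ?i = "ind n (fst z)"
        have i: "?i = 0 \<or> ?i = 1"
          by (auto simp: ind_def indicator_def)
        \<comment> \<open>The indicator is 0 or 1, so either only the mollification error or only
          the tail of \<open>H\<close> is present.\<close>
        have "(cmod (of_real ?i * M n z - H z))\<^sup>2 \<le> 2 * (cmod (M n z - H z))\<^sup>2 + 2 * ((1 - ?i) * (cmod (H z))\<^sup>2)"
          using i by auto
        then have "ennreal ((cmod (of_real ?i * M n z - H z))\<^sup>2) \<le> ennreal (2 * (cmod (M n z - H z))\<^sup>2 + 2 * ((1 - ?i) * (cmod (H z))\<^sup>2))"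
          by (rule ennreal_leI)
        also have "\<dots> = 2 * ennreal ((cmod (M n z - H z))\<^sup>2) + 2 * ennreal ((1 - ?i) * (cmod (H z))\<^sup>2)"
          using i by (auto simp: ennreal_mult)
        finally show "ennreal ((cmod (of_real ?i * M n z - H z))\<^sup>2) \<le> 2 * ennreal ((cmod (M n z - H z))\<^sup>2) + 2 * ennreal ((1 - ?i) * (cmod (H z))\<^sup>2)" .
      qed
      also have "\<dots> = 2 * (\<integral>\<^sup>+z. ennreal ((cmod (M n z - H z))\<^sup>2) \<partial>lborel)
          + 2 * (\<integral>\<^sup>+z. ennreal ((1 - ind n (fst z)) * (cmod (H z))\<^sup>2) \<partial>lborel)"
        by (subst nn_integral_add) (simp_all add: nn_integral_cmult)
      finally show ?thesis .
    qed
    have "(\<lambda>n. \<integral>\<^sup>+z. ennreal ((1 - ind n (fst z)) * (cmod (H z))\<^sup>2) \<partial>lborel) \<longlonglongrightarrow> (\<integral>\<^sup>+z. 0 \<partial>(lborel :: ('a \<times> 'a) measure))"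
    proof (rule nn_integral_dominated_convergence[where w="\<lambda>z. ennreal ((cmod (H z))\<^sup>2)"])
      show "AE z in lborel. ennreal ((1 - ind n (fst z)) * (cmod (H z))\<^sup>2) \<le> ennreal ((cmod (H z))\<^sup>2)" for n
        using ind01 by (intro AE_I2 ennreal_leI) (simp add: mult_left_le_one_le)
      show "(\<integral>\<^sup>+z. ennreal ((cmod (H z))\<^sup>2) \<partial>lborel) < \<infinity>"
        using H by (simp add: L2_iff_nn_integral)
      show "AE z in lborel. (\<lambda>n. ennreal ((1 - ind n (fst z)) * (cmod (H z))\<^sup>2)) \<longlonglongrightarrow> 0"
      proof (intro AE_I2)
        fix z
        have "(\<lambda>n. ennreal ((1 - ind n (fst z)) * (cmod (H z))\<^sup>2)) \<longlonglongrightarrow> ennreal ((1 - 1) * (cmod (H z))\<^sup>2)"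
          by (intro tendsto_intros ind_lim)
        then show "(\<lambda>n. ennreal ((1 - ind n (fst z)) * (cmod (H z))\<^sup>2)) \<longlonglongrightarrow> 0"
          by simp
      qed
    qed measurable
    then have "(\<lambda>n. \<integral>\<^sup>+z. ennreal ((1 - ind n (fst z)) * (cmod (H z))\<^sup>2) \<partial>lborel) \<longlonglongrightarrow> 0"
      by simp
    from tendsto_add[OF ennreal_tendsto_cmult[OF _ mollify_slice_tendsto[OF H, folded M_def], of 2] ennreal_tendsto_cmult[OF _ this, of 2]]
    have lim: "(\<lambda>n. 2 * (\<integral>\<^sup>+z. ennreal ((cmod (M n z - H z))\<^sup>2) \<partial>lborel)
          + 2 * (\<integral>\<^sup>+z. ennreal ((1 - ind n (fst z)) * (cmod (H z))\<^sup>2) \<partial>lborel)) \<longlonglongrightarrow> 0"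
      by simp
    show "(\<lambda>n. \<integral>\<^sup>+z. ennreal ((cmod (partial_fourier_integral (\<phi> n) z - (case z of (x, K) \<Rightarrow> H (x, - K))))\<^sup>2) \<partial>lborel) \<longlonglongrightarrow> 0"
      by (rule tendsto_sandwich[OF _ _ tendsto_const lim]) (use le in simp_all)
  qed
  moreover have "(\<lambda>(x, K). H (x, - K)) \<in> L2"
  proof -
    have "(\<integral>\<^sup>+z. ennreal ((cmod (case z of (x, K) \<Rightarrow> H (x, - K)))\<^sup>2) \<partial>lborel) = (\<integral>\<^sup>+x. \<integral>\<^sup>+K. ennreal ((cmod (H (x, - K)))\<^sup>2) \<partial>lborel \<partial>lborel)"
      by (subst nn_integral_lborel_pair(1)) (simp_all add: split_beta')
    also have "\<dots> = (\<integral>\<^sup>+x. \<integral>\<^sup>+K. ennreal ((cmod (H (x, K)))\<^sup>2) \<partial>lborel \<partial>lborel)"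
    proof (rule nn_integral_cong)
      fix x
      show "(\<integral>\<^sup>+K. ennreal ((cmod (H (x, - K)))\<^sup>2) \<partial>lborel) = (\<integral>\<^sup>+K. ennreal ((cmod (H (x, K)))\<^sup>2) \<partial>lborel)"
        by (rule nn_integral_lborel_uminus[where f="\<lambda>K. ennreal ((cmod (H (x, K)))\<^sup>2)"]) simp
    qed
    also have "\<dots> = (\<integral>\<^sup>+z. ennreal ((cmod (H z))\<^sup>2) \<partial>lborel)"
      by (rule nn_integral_lborel_pair(1)[symmetric]) measurable
    finally show ?thesis
      using H by (simp add: L2_iff_nn_integral split_beta')
  qed
  ultimately show ?thesis
    unfolding is_partial_fourier_def W_def[symmetric] using \<phi>_L2 \<phi>_int by blast
qed

text \<open>The reflected \<open>H\<close> shows that the choice has a witness, and uniqueness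
  forces the chosen transform to agree with it almost everywhere.\<close>

corollary partial_fourier_inversion:
  fixes H :: "'a::euclidean_space \<times> 'a \<Rightarrow> complex"
  assumes H: "H \<in> L2" and int: "AE x in lborel. integrable lborel (\<lambda>y. H (x, y))"
  shows "partial_fourier (partial_fourier_integral H) \<in> L2"
    and "AE z in lborel. partial_fourier (partial_fourier_integral H) z = H (fst z, - snd z)"
proof -
  note inv = is_partial_fourier_inversion[OF H int]
  have pf: "is_partial_fourier (partial_fourier_integral H) (partial_fourier (partial_fourier_integral H))"
    using someI[of "is_partial_fourier (partial_fourier_integral H)", OF inv]
    unfolding partial_fourier_def is_partial_fourier_def .
  then show "partial_fourier (partial_fourier_integral H) \<in> L2"
    by (simp add: is_partial_fourier_def)
  show "AE z in lborel. partial_fourier (partial_fourier_integral H) z = H (fst z, - snd z)"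
    using is_partial_fourier_unique[OF partial_fourier_integral_L2(1)[OF H int] pf inv]
    by (simp add: split_beta')
qed

section \<open>Integral kernels\<close>

lemma AE_eq_0_of_set_integrals_real:
  fixes f :: "'b \<Rightarrow> real"
  assumes f: "integrable M f" and zero: "\<And>A. A \<in> sets M \<Longrightarrow> (\<integral>x. indicat_real A x * f x \<partial>M) = 0"
  shows "AE x in M. f x = 0"
proof -
  have [measurable]: "f \<in> borel_measurable M"
    using f by auto
  have nonpos: "AE x in M. g x \<le> 0"
    if g: "integrable M g" and z: "\<And>A. A \<in> sets M \<Longrightarrow> (\<integral>x. indicat_real A x * g x \<partial>M) = 0" for g :: "'b \<Rightarrow> real"
  proof -
    have [measurable]: "g \<in> borel_measurable M"
      using g by auto
    define A where "A = {x \<in> space M. g x > 0}"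
    have A: "A \<in> sets M"
      unfolding A_def by measurable
    have "integrable M (\<lambda>x. indicat_real A x * g x)"
      using integrable_mult_indicator[OF A g] by simp
    then have "AE x in M. indicat_real A x * g x = 0"
      using integral_nonneg_eq_0_iff_AE[of M "\<lambda>x. indicat_real A x * g x"] z[OF A]
      by (auto simp: A_def indicator_def)
    then show ?thesis
      using AE_space by eventually_elim (auto simp: A_def indicator_def split: if_splits)
  qed
  have "AE x in M. f x \<le> 0"
    by (rule nonpos[OF f zero])
  moreover have "AE x in M. - f x \<le> 0"
    using f zero by (intro nonpos) auto
  ultimately show ?thesis
    by eventually_elim simp
qed

lemma AE_eq_0_of_set_integrals:
  fixes f :: "'b \<Rightarrow> complex"
  assumes f: "integrable M f" and zero: "\<And>A. A \<in> sets M \<Longrightarrow> (\<integral>x. indicat_real A x *\<^sub>R f x \<partial>M) = 0"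
  shows "AE x in M. f x = 0"
proof -
  have ind: "integrable M (\<lambda>x. indicat_real A x *\<^sub>R f x)" if "A \<in> sets M" for A
    by (rule integrable_mult_indicator[OF that f])
  have "(\<integral>x. indicat_real A x * Re (f x) \<partial>M) = 0" "(\<integral>x. indicat_real A x * Im (f x) \<partial>M) = 0" if "A \<in> sets M" for A
    using integral_Re[OF ind[OF that]] integral_Im[OF ind[OF that]] zero[OF that] by simp_all
  then have "AE x in M. Re (f x) = 0" "AE x in M. Im (f x) = 0"
    using f by (auto intro!: AE_eq_0_of_set_integrals_real)
  then show ?thesis
    by eventually_elim (simp add: complex_eq_iff)
qed

text \<open>Finite intersections of a countable basis, with the empty intersection giving
  \<open>UNIV\<close>. Countability is the point: exceptional null sets attached to the members can
  be united.\<close>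

lemma borel_countable_Int_stable_generator:
  "\<exists>G::'a::second_countable_topology set set. countable G \<and> Int_stable G \<and> UNIV \<in> G \<and> sets borel = sigma_sets UNIV G"
proof -
  obtain B :: "'a set set" where B: "countable B" "topological_basis B"
    using ex_countable_basis by blast
  define G where "G = Inter ` {F. finite F \<and> F \<subseteq> B}"
  have B_sets: "sets borel = sigma_sets UNIV B"
    by (simp add: borel_eq_countable_basis[OF B])
  have "countable G"
    unfolding G_def using B(1) by (intro countable_image countable_Collect_finite_subset)
  moreover have "Int_stable G"
  proof (rule Int_stableI)
    fix X Y assume "X \<in> G" "Y \<in> G"
    then obtain F F' where "finite F" "F \<subseteq> B" "X = \<Inter>F" "finite F'" "F' \<subseteq> B" "Y = \<Inter>F'"
      by (auto simp: G_def)
    then show "X \<inter> Y \<in> G"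
      unfolding G_def by (intro image_eqI[of _ _ "F \<union> F'"]) auto
  qed
  moreover have "UNIV \<in> G"
    unfolding G_def by (intro image_eqI[of _ _ "{}"]) auto
  moreover have "sets borel = sigma_sets UNIV G"
  proof
    have "B \<subseteq> G"
      unfolding G_def by (auto intro!: image_eqI[of _ Inter "{_}"])
    then show "sets borel \<subseteq> sigma_sets UNIV G"
      unfolding B_sets by (rule sigma_sets_mono')
    have "G \<subseteq> sets borel"
    proof
      fix X assume "X \<in> G"
      then obtain F where "finite F" "F \<subseteq> B" "X = \<Inter>F"
        by (auto simp: G_def)
      moreover have "open U" if "U \<in> B" for U
        using B(2) that by (rule topological_basis_open)
      ultimately have "open X"
        by (auto intro!: open_Inter)
      then show "X \<in> sets borel"
        by simp
    qed
    then show "sigma_sets UNIV G \<subseteq> sets borel"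
      using sets.sigma_sets_subset[of G borel] by simp
  qed
  ultimately show ?thesis
    by blast
qed

text \<open>The sets with vanishing integral form a Dynkin system; \<open>UNIV\<close> in the
  generator supplies complements, and countable additivity of the integral supplies disjoint
  unions.\<close>

lemma AE_eq_0_of_generator_integrals:
  fixes f :: "'a::euclidean_space \<Rightarrow> complex"
  assumes f: "integrable lborel f" and G: "Int_stable G" "UNIV \<in> G" "sets borel = sigma_sets UNIV G"
    and zero: "\<And>A. A \<in> G \<Longrightarrow> (\<integral>x. indicat_real A x *\<^sub>R f x \<partial>lborel) = 0"
  shows "AE x in lborel. f x = 0"
proof (rule AE_eq_0_of_set_integrals[OF f])
  fix A :: "'a set" assume "A \<in> sets lborel"
  have "G \<subseteq> Pow UNIV"
    by simp
  moreover have "A \<in> sigma_sets UNIV G"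
    using \<open>A \<in> sets lborel\<close> G(3) by simp
  ultimately show "(\<integral>x. indicat_real A x *\<^sub>R f x \<partial>lborel) = 0"
  proof (induction rule: sigma_sets_induct_disjoint[OF G(1), consumes 2, case_names basic empty compl union])
    case (compl A)
    have "A \<in> sets lborel"
      using compl G(3) by simp
    then have "integrable lborel (\<lambda>x. indicat_real A x *\<^sub>R f x)"
      by (rule integrable_mult_indicator[OF _ f])
    moreover have "(\<integral>x. f x \<partial>lborel) = 0"
      using zero[OF G(2)] by simp
    moreover have "indicat_real (UNIV - A) x *\<^sub>R f x = f x - indicat_real A x *\<^sub>R f x" for x
      by (simp add: indicator_def)
    ultimately show ?case
      using f compl by simp
  next
    case (union A)
    have A: "A i \<in> sets lborel" for i
      using union(2) G(3) by auto
    have "set_integrable lborel (\<Union>i. A i) f"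
      unfolding set_integrable_def using A by (intro integrable_mult_indicator f) auto
    then have "(LINT x:(\<Union>i. A i)|lborel. f x) = (\<Sum>i. (LINT x:(A i)|lborel. f x))"
      using A union(1) by (intro lebesgue_integral_countable_add) (auto simp: disjoint_family_on_def)
    then show ?case
      using union(3) by (simp add: set_lebesgue_integral_def)
  qed (use zero in auto)
qed

text \<open>The exceptional set in \<open>has_integral_kernel\<close> depends on the test function,
  so only countably many are used: indicators of generator sets cut down to balls, which puts them
  in \<open>L2\<close>. For almost every x all tests agree, and the slices coincide on each
  ball.\<close>

theorem integral_kernel_unique:
  fixes D :: "('a::euclidean_space \<Rightarrow> complex) \<Rightarrow> 'a \<Rightarrow> complex"
  assumes k: "has_integral_kernel D k" and k': "has_integral_kernel D k'"
  shows "AE z in lborel. k z = k' z"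
proof -
  have [measurable]: "k \<in> borel_measurable borel" "k' \<in> borel_measurable borel"
    using k k' by (auto simp: has_integral_kernel_def)
  obtain G :: "'a set set" where G: "countable G" "Int_stable G" "UNIV \<in> G" "sets borel = sigma_sets UNIV G"
    using borel_countable_Int_stable_generator by blast
  define B where "B N = ball (0::'a) (real N)" for N
  define u where "u U N y = complex_of_real (indicat_real (U \<inter> B N) y)" for U N y
  have u_L2: "u U N \<in> L2" if "U \<in> G" for U N
  proof -
    have "U \<in> sets borel"
      using that G(4) by blast
    moreover have "emeasure lborel (U \<inter> B N) \<le> emeasure lborel (B N)"
      by (intro emeasure_mono) (auto simp: B_def)
    moreover have "emeasure lborel (B N) < \<infinity>"
      unfolding B_def by (rule emeasure_bounded_finite) simp
    ultimately show ?thesis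
      unfolding u_def[abs_def] by (intro L2_indicator) (auto simp: B_def)
  qed
  have "AE x in lborel. \<forall>U\<in>G. \<forall>N. integrable lborel (\<lambda>y. k (x, y) * u U N y) \<and> integrable lborel (\<lambda>y. k' (x, y) * u U N y)
      \<and> (\<integral>y. k (x, y) * u U N y \<partial>lborel) = (\<integral>y. k' (x, y) * u U N y \<partial>lborel)"
    unfolding AE_ball_countable[OF G(1)] AE_all_countable
  proof (intro ballI allI)
    fix U N assume "U \<in> G"
    have "AE x in lborel. integrable lborel (\<lambda>y. k (x, y) * u U N y) \<and> D (u U N) x = (\<integral>y. k (x, y) * u U N y \<partial>lborel)"
      "AE x in lborel. integrable lborel (\<lambda>y. k' (x, y) * u U N y) \<and> D (u U N) x = (\<integral>y. k' (x, y) * u U N y \<partial>lborel)"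
      using k k' u_L2[OF \<open>U \<in> G\<close>] by (auto simp: has_integral_kernel_def)
    then show "AE x in lborel. integrable lborel (\<lambda>y. k (x, y) * u U N y) \<and> integrable lborel (\<lambda>y. k' (x, y) * u U N y)
      \<and> (\<integral>y. k (x, y) * u U N y \<partial>lborel) = (\<integral>y. k' (x, y) * u U N y \<partial>lborel)"
      by eventually_elim simp
  qed
  then have "AE x in lborel. AE y in lborel. k (x, y) = k' (x, y)"
  proof eventually_elim
    case (elim x)
    have "AE y in lborel. (k (x, y) - k' (x, y)) * u UNIV N y = 0" for N
    proof (rule AE_eq_0_of_generator_integrals[OF _ G(2-4)])
      show "integrable lborel (\<lambda>y. (k (x, y) - k' (x, y)) * u UNIV N y)"
        using elim G(3) by (simp add: left_diff_distrib)
      show "(\<integral>y. indicat_real U y *\<^sub>R ((k (x, y) - k' (x, y)) * u UNIV N y) \<partial>lborel) = 0" if "U \<in> G" for U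
      proof -
        have "indicat_real U y *\<^sub>R ((k (x, y) - k' (x, y)) * u UNIV N y) = k (x, y) * u U N y - k' (x, y) * u U N y" for y
          by (simp add: u_def indicator_def algebra_simps)
        then show ?thesis
          using elim that by simp
      qed
    qed
    then have "AE y in lborel. \<forall>N. (k (x, y) - k' (x, y)) * u UNIV N y = 0"
      unfolding AE_all_countable by blast
    then show ?case
    proof eventually_elim
      case (elim y)
      obtain N where "norm y < real N"
        using reals_Archimedean2 by blast
      then have "u UNIV N y = 1"
        by (simp add: u_def B_def)
      then show ?case
        using elim[rule_format, of N] by simp
    qed
  qed
  then show ?thesis
    by (rule AE_lborel_pairI[rotated]) measurable
qed

section \<open>The kernel of a trace class operator as a series\<close>

lemma nn_integral_L2_mult_le:
  assumes f: "f \<in> L2" and g: "g \<in> L2"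
  shows "(\<integral>\<^sup>+x. ennreal (cmod (f x) * cmod (g x)) \<partial>lborel) \<le> ennreal (l2_norm f * l2_norm g)"
proof -
  have [measurable]: "f \<in> borel_measurable borel" "g \<in> borel_measurable borel"
    using f g by (auto dest: L2_measurable)
  let ?f = "\<lambda>x. complex_of_real (cmod (f x))" and ?g = "\<lambda>x. complex_of_real (cmod (g x))"
  have L: "?f \<in> L2" "?g \<in> L2" and n: "l2_norm ?f = l2_norm f" "l2_norm ?g = l2_norm g"
    using f g by (simp_all add: L2_def l2_norm_def)
  have "integrable lborel (\<lambda>x. cmod (f x * g x))"
    using L2_integrable_mult[OF f g] by (rule integrable_norm)
  then have "(\<integral>\<^sup>+x. ennreal (cmod (f x) * cmod (g x)) \<partial>lborel) = ennreal (\<integral>x. cmod (f x) * cmod (g x) \<partial>lborel)"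
    by (intro nn_integral_eq_integral) (simp_all add: norm_mult)
  also have "(\<integral>x. cmod (f x) * cmod (g x) \<partial>lborel) = Re (l2_inner ?f ?g)"
    unfolding l2_inner_def by (simp add: integral_complex_of_real flip: of_real_mult)
  also have "\<dots> \<le> cmod (l2_inner ?f ?g)"
    by (rule complex_Re_le_cmod)
  also have "\<dots> \<le> l2_norm f * l2_norm g"
    using cmod_l2_inner_le[OF L] by (simp add: n)
  finally show ?thesis
    by (simp add: ennreal_leI)
qed

lemma Cauchy_Schwarz_suminf:
  fixes f g :: "nat \<Rightarrow> ennreal"
  shows "(\<Sum>n. f n * g n)\<^sup>2 \<le> (\<Sum>n. (f n)\<^sup>2) * (\<Sum>n. (g n)\<^sup>2)"
  using Cauchy_Schwarz_nn_integral[of f "count_space UNIV" g] by (simp add: nn_integral_count_space_nat)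

text \<open>Fatou's lemma applied to the squared distances: their lower limit is 0 almost
  everywhere, and the pointwise limit identifies it with the squared distance of \<open>f\<close>
  and \<open>p\<close>.\<close>

lemma L2_tendsto_AE_limit:
  fixes f :: "'a::euclidean_space \<Rightarrow> complex"
  assumes f: "f \<in> L2" and u: "\<And>n. u n \<in> L2" and lim: "(\<lambda>n. l2_norm (\<lambda>x. f x - u n x)) \<longlonglongrightarrow> 0"
    and p: "AE x in lborel. (\<lambda>n. u n x) \<longlonglongrightarrow> p x"
  shows "AE x in lborel. f x = p x"
proof -
  have [measurable]: "f \<in> borel_measurable borel" "u n \<in> borel_measurable borel" for n
    using f u by (auto dest: L2_measurable)
  have "(\<integral>\<^sup>+x. liminf (\<lambda>n. ennreal ((cmod (f x - u n x))\<^sup>2)) \<partial>lborel) \<le> liminf (\<lambda>n. \<integral>\<^sup>+x. ennreal ((cmod (f x - u n x))\<^sup>2) \<partial>lborel)"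
    by (intro nn_integral_liminf) measurable
  also have "\<dots> = liminf (\<lambda>n. ennreal ((l2_norm (\<lambda>x. f x - u n x))\<^sup>2))"
    using f u by (simp add: nn_integral_L2_square L2_diff)
  also have "\<dots> = 0"
  proof -
    have "(\<lambda>n. ennreal ((l2_norm (\<lambda>x. f x - u n x))\<^sup>2)) \<longlonglongrightarrow> ennreal (0\<^sup>2)"
      by (intro tendsto_ennrealI tendsto_power lim)
    then show ?thesis
      using lim_imp_Liminf[OF trivial_limit_sequentially] by fastforce
  qed
  finally have "AE x in lborel. liminf (\<lambda>n. ennreal ((cmod (f x - u n x))\<^sup>2)) = 0"
    by (subst (asm) le_zero_eq, subst (asm) nn_integral_0_iff_AE) auto
  with p show ?thesis
  proof eventually_elim
    case (elim x)
    have "(\<lambda>n. ennreal ((cmod (f x - u n x))\<^sup>2)) \<longlonglongrightarrow> ennreal ((cmod (f x - p x))\<^sup>2)"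
      by (intro tendsto_ennrealI tendsto_intros elim)
    then have "ennreal ((cmod (f x - p x))\<^sup>2) = 0"
      using lim_imp_Liminf[OF trivial_limit_sequentially] elim(2) by metis
    then show ?case
      by simp
  qed
qed

text \<open>The data of the operator expansion detached from the operator; \<open>t\<close> will be
  the trace norm.\<close>

locale kernel_expansion =
  fixes b c :: "nat \<Rightarrow> 'a::euclidean_space \<Rightarrow> complex" and t :: real
  assumes b_L2: "b n \<in> L2" and c_L2: "c n \<in> L2" and b_le_c: "l2_norm (b n) \<le> l2_norm (c n)"
    and c_sums: "(\<lambda>n. (l2_norm (c n))\<^sup>2) sums t"
begin

definition majorant :: "'a \<times> 'a \<Rightarrow> ennreal"
  where "majorant z = (\<Sum>n. ennreal (cmod (b n (fst z)) * cmod (c n (snd z))))"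

text \<open>Setting the kernel to zero where the expansion diverges absolutely keeps it below \<open>majorant\<close> everywhere.\<close>

definition kernel :: "'a \<times> 'a \<Rightarrow> complex"
  where "kernel z = (if majorant z < \<infinity> then \<Sum>n. b n (fst z) * cnj (c n (snd z)) else 0)"

lemma b_measurable [measurable]: "b n \<in> borel_measurable borel"
  using b_L2 by (rule L2_measurable)

lemma c_measurable [measurable]: "c n \<in> borel_measurable borel"
  using c_L2 by (rule L2_measurable)

lemma majorant_measurable [measurable]: "majorant \<in> borel_measurable borel"
proof -
  have "majorant \<in> borel_measurable (borel \<Otimes>\<^sub>M borel)"
    unfolding majorant_def by measurable
  then show ?thesis
    by (simp add: borel_prod)
qed

lemma kernel_measurable [measurable]: "kernel \<in> borel_measurable borel"
proof -
  have [measurable]: "majorant \<in> borel_measurable (borel \<Otimes>\<^sub>M borel)"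
    by (simp add: borel_prod)
  have "kernel \<in> borel_measurable (borel \<Otimes>\<^sub>M borel)"
    unfolding kernel_def by measurable
  then show ?thesis
    by (simp add: borel_prod)
qed

lemma t_nonneg: "0 \<le> t"
  using c_sums suminf_nonneg[of "\<lambda>n. (l2_norm (c n))\<^sup>2"] by (auto simp: sums_iff)

lemma suminf_norm_c: "(\<Sum>n. ennreal ((l2_norm (c n))\<^sup>2)) = ennreal t"
  using c_sums by (intro suminf_ennreal_eq) auto

lemma suminf_norm_b_le: "(\<Sum>n. ennreal ((l2_norm (b n))\<^sup>2)) \<le> ennreal t"
  unfolding suminf_norm_c[symmetric]
  by (intro suminf_le summableI ennreal_leI power_mono b_le_c) auto

lemma suminf_norm_bc_le: "(\<Sum>n. ennreal (l2_norm (b n) * l2_norm (c n))) \<le> ennreal t"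
  unfolding suminf_norm_c[symmetric]
  by (intro suminf_le summableI ennreal_leI) (auto simp: power2_eq_square intro!: mult_right_mono b_le_c)

lemma majorant_finite_summable:
  assumes "majorant (x, y) < \<infinity>"
  shows "summable (\<lambda>n. norm (b n x * cnj (c n y)))"
  using assms unfolding majorant_def by (intro summable_suminf_not_top) (auto simp: norm_mult)

lemma norm_kernel_le: "ennreal (cmod (kernel z)) \<le> majorant z"
proof (cases "majorant z < \<infinity>")
  case True
  obtain x y where z: "z = (x, y)"
    by (cases z)
  have s: "summable (\<lambda>n. norm (b n x * cnj (c n y)))"
    using True unfolding z by (rule majorant_finite_summable)
  have "ennreal (cmod (kernel z)) = ennreal (cmod (\<Sum>n. b n x * cnj (c n y)))"
    using True by (simp add: kernel_def z)
  also have "\<dots> \<le> ennreal (\<Sum>n. cmod (b n x * cnj (c n y)))"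
    by (intro ennreal_leI summable_norm s)
  also have "\<dots> = majorant z"
    unfolding majorant_def z using s by (subst suminf_ennreal2[symmetric]) (auto simp: norm_mult)
  finally show ?thesis .
qed (simp add: kernel_def)

text \<open>Cauchy-Schwarz for each term, with translation preserving the norm. The bound holds for
  every shift \<open>w\<close>, not only almost every one.\<close>

lemma nn_integral_majorant_shift:
  "(\<integral>\<^sup>+x. majorant (x + w, x) \<partial>lborel) \<le> ennreal t"
proof -
  have "(\<integral>\<^sup>+x. majorant (x + w, x) \<partial>lborel) = (\<Sum>n. \<integral>\<^sup>+x. ennreal (cmod (b n (x + w)) * cmod (c n x)) \<partial>lborel)"
    unfolding majorant_def by (simp add: nn_integral_suminf)
  also have "\<dots> \<le> (\<Sum>n. ennreal (l2_norm (b n) * l2_norm (c n)))"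
  proof (intro suminf_le summableI)
    fix n
    show "(\<integral>\<^sup>+x. ennreal (cmod (b n (x + w)) * cmod (c n x)) \<partial>lborel) \<le> ennreal (l2_norm (b n) * l2_norm (c n))"
      using nn_integral_L2_mult_le[OF L2_shift(1)[OF b_L2] c_L2] by (simp add: L2_shift(2)[OF b_L2])
  qed
  also have "\<dots> \<le> ennreal t"
    by (rule suminf_norm_bc_le)
  finally show ?thesis .
qed

text \<open>Cauchy-Schwarz with a translate of \<open>b n\<close> and a reflected translate of
  \<open>c n\<close>. This is the direction in which the Wigner integral runs, and the bound is
  available at every \<open>x\<close>.\<close>

lemma nn_integral_majorant_antidiagonal:
  "(\<integral>\<^sup>+y. majorant (x + y, x - y) \<partial>lborel) \<le> ennreal t"
proof -
  have "(\<integral>\<^sup>+y. majorant (x + y, x - y) \<partial>lborel) = (\<Sum>n. \<integral>\<^sup>+y. ennreal (cmod (b n (x + y)) * cmod (c n (x - y))) \<partial>lborel)"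
    unfolding majorant_def by (simp add: nn_integral_suminf)
  also have "\<dots> \<le> (\<Sum>n. ennreal (l2_norm (b n) * l2_norm (c n)))"
  proof (intro suminf_le summableI)
    fix n
    have "(\<integral>\<^sup>+y. ennreal ((cmod (c n y))\<^sup>2) \<partial>lborel) = (\<integral>\<^sup>+y. ennreal ((cmod (c n (x - y)))\<^sup>2) \<partial>lborel)"
      by (subst nn_integral_lborel_affine[where c="-1" and t=x]) auto
    then have r: "(\<lambda>y. c n (x - y)) \<in> L2"
      using c_L2[of n] by (simp add: L2_iff_nn_integral)
    with \<open>(\<integral>\<^sup>+y. ennreal ((cmod (c n y))\<^sup>2) \<partial>lborel) = _\<close> have "l2_norm (\<lambda>y. c n (x - y)) = l2_norm (c n)"
      by (simp add: nn_integral_L2_square c_L2)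
    then show "(\<integral>\<^sup>+y. ennreal (cmod (b n (x + y)) * cmod (c n (x - y))) \<partial>lborel) \<le> ennreal (l2_norm (b n) * l2_norm (c n))"
      using nn_integral_L2_mult_le[OF L2_shift(1)[OF b_L2] r, of n x] by (simp add: L2_shift(2)[OF b_L2] add.commute)
  qed
  also have "\<dots> \<le> ennreal t"
    by (rule suminf_norm_bc_le)
  finally show ?thesis .
qed

text \<open>Cauchy-Schwarz in the summation index separates the two variables, leaving a product of
  two sums of squared norms, each at most \<open>t\<close>.\<close>

lemma kernel_L2: "kernel \<in> L2"
proof -
  have "(\<integral>\<^sup>+z. ennreal ((cmod (kernel z))\<^sup>2) \<partial>lborel) \<le> (\<integral>\<^sup>+z. (\<Sum>n. ennreal ((cmod (b n (fst z)))\<^sup>2)) * (\<Sum>n. ennreal ((cmod (c n (snd z)))\<^sup>2)) \<partial>lborel)"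
  proof (intro nn_integral_mono)
    fix z
    have "ennreal ((cmod (kernel z))\<^sup>2) = (ennreal (cmod (kernel z)))\<^sup>2"
      by (simp add: ennreal_power)
    also have "\<dots> \<le> (majorant z)\<^sup>2"
      by (intro power_mono norm_kernel_le) simp
    also have "\<dots> \<le> (\<Sum>n. (ennreal (cmod (b n (fst z))))\<^sup>2) * (\<Sum>n. (ennreal (cmod (c n (snd z))))\<^sup>2)"
      unfolding majorant_def using Cauchy_Schwarz_suminf[of "\<lambda>n. ennreal (cmod (b n (fst z)))" "\<lambda>n. ennreal (cmod (c n (snd z)))"]
      by (simp add: ennreal_mult)
    finally show "ennreal ((cmod (kernel z))\<^sup>2) \<le> (\<Sum>n. ennreal ((cmod (b n (fst z)))\<^sup>2)) * (\<Sum>n. ennreal ((cmod (c n (snd z)))\<^sup>2))"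
      by (simp add: ennreal_power)
  qed
  also have "\<dots> = (\<integral>\<^sup>+x. \<integral>\<^sup>+y. (\<Sum>n. ennreal ((cmod (b n x))\<^sup>2)) * (\<Sum>n. ennreal ((cmod (c n y))\<^sup>2)) \<partial>lborel \<partial>lborel)"
  proof -
    have "(\<lambda>z. (\<Sum>n. ennreal ((cmod (b n (fst z)))\<^sup>2)) * (\<Sum>n. ennreal ((cmod (c n (snd z)))\<^sup>2))) \<in> borel_measurable (borel \<Otimes>\<^sub>M borel)"
      by measurable
    then show ?thesis
      by (subst nn_integral_lborel_pair(1)) (simp_all add: borel_prod)
  qed
  also have "\<dots> = (\<integral>\<^sup>+x. (\<Sum>n. ennreal ((cmod (b n x))\<^sup>2)) \<partial>lborel) * (\<integral>\<^sup>+y. (\<Sum>n. ennreal ((cmod (c n y))\<^sup>2)) \<partial>lborel)"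
    by (simp add: nn_integral_cmult nn_integral_multc)
  also have "\<dots> \<le> ennreal t * ennreal t"
    using suminf_norm_b_le suminf_norm_c
    by (intro mult_mono) (simp_all add: nn_integral_suminf nn_integral_L2_square b_L2 c_L2)
  also have "\<dots> < \<infinity>"
    by (simp add: ennreal_mult_less_top)
  finally show ?thesis
    by (simp add: L2_iff_nn_integral)
qed

text \<open>At almost every x the squares of \<open>b n x\<close> are summable; with the squared
  norms of \<open>c n\<close> this justifies exchanging sum and integral against f. The series then
  converges pointwise to the kernel integral and in norm to g, so the two limits agree.\<close>

lemma kernel_represents:
  assumes f: "f \<in> L2" and g: "g \<in> L2"
    and lim: "(\<lambda>N. l2_norm (\<lambda>x. g x - (\<Sum>n<N. l2_inner f (c n) * b n x))) \<longlonglongrightarrow> 0"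
  shows "AE x in lborel. integrable lborel (\<lambda>y. kernel (x, y) * f y) \<and> g x = (\<integral>y. kernel (x, y) * f y \<partial>lborel)"
proof -
  have [measurable]: "f \<in> borel_measurable borel"
    using f by (rule L2_measurable)
  have "(\<integral>\<^sup>+x. (\<Sum>n. ennreal ((cmod (b n x))\<^sup>2)) \<partial>lborel) \<le> ennreal t"
    using suminf_norm_b_le by (simp add: nn_integral_suminf nn_integral_L2_square b_L2)
  then have "AE x in lborel. (\<Sum>n. ennreal ((cmod (b n x))\<^sup>2)) \<noteq> \<infinity>"
    by (intro nn_integral_PInf_AE) (auto simp: top_unique)
  then have pointwise: "AE x in lborel. integrable lborel (\<lambda>y. kernel (x, y) * f y) \<and>
      (\<lambda>n. l2_inner f (c n) * b n x) sums (\<integral>y. kernel (x, y) * f y \<partial>lborel)"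
  proof eventually_elim
    case (elim x)
    then have b_sq: "summable (\<lambda>n. (cmod (b n x))\<^sup>2)"
      by (intro summable_suminf_not_top) auto
    define \<tau> where "\<tau> n y = b n x * cnj (c n y) * f y" for n y
    have \<tau>_int: "integrable lborel (\<tau> n)" for n
      unfolding \<tau>_def using L2_integrable_mult[OF L2_cnj[OF c_L2] f, of n] by (simp add: mult.assoc)
    have \<tau>_norm: "(\<integral>\<^sup>+y. ennreal (cmod (\<tau> n y)) \<partial>lborel) \<le> ennreal (cmod (b n x) * (l2_norm (c n) * l2_norm f))" for n
    proof -
      have "(\<integral>\<^sup>+y. ennreal (cmod (\<tau> n y)) \<partial>lborel) = ennreal (cmod (b n x)) * (\<integral>\<^sup>+y. ennreal (cmod (c n y) * cmod (f y)) \<partial>lborel)"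
        by (subst nn_integral_cmult[symmetric]) (simp_all add: \<tau>_def norm_mult mult.assoc ennreal_mult)
      also have "\<dots> \<le> ennreal (cmod (b n x)) * ennreal (l2_norm (c n) * l2_norm f)"
        by (intro mult_left_mono nn_integral_L2_mult_le c_L2 f) simp
      finally show ?thesis
        by (simp add: ennreal_mult)
    qed
    have b_c_summable: "summable (\<lambda>n. cmod (b n x) * (l2_norm (c n) * l2_norm f))"
    proof (rule summable_comparison_test')
      show "summable (\<lambda>n. ((cmod (b n x))\<^sup>2 + (l2_norm (c n))\<^sup>2) * l2_norm f)"
        by (intro summable_mult2 summable_add b_sq sums_summable[OF c_sums])
      fix n :: nat
      have "cmod (b n x) * l2_norm (c n) \<le> (cmod (b n x))\<^sup>2 + (l2_norm (c n))\<^sup>2"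
        using zero_le_power2[of "cmod (b n x) - l2_norm (c n)"] zero_le_power2[of "cmod (b n x)"] zero_le_power2[of "l2_norm (c n)"]
        unfolding power2_diff by linarith
      then have "(cmod (b n x) * l2_norm (c n)) * l2_norm f \<le> ((cmod (b n x))\<^sup>2 + (l2_norm (c n))\<^sup>2) * l2_norm f"
        by (rule mult_right_mono) simp
      then show "norm (cmod (b n x) * (l2_norm (c n) * l2_norm f)) \<le> ((cmod (b n x))\<^sup>2 + (l2_norm (c n))\<^sup>2) * l2_norm f"
        by (simp add: mult.assoc)
    qed
    have "(\<integral>\<^sup>+y. (\<Sum>n. ennreal (cmod (\<tau> n y))) \<partial>lborel) = (\<Sum>n. \<integral>\<^sup>+y. ennreal (cmod (\<tau> n y)) \<partial>lborel)"
      using \<tau>_int by (intro nn_integral_suminf) auto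
    also have "\<dots> \<le> (\<Sum>n. ennreal (cmod (b n x) * (l2_norm (c n) * l2_norm f)))"
      by (intro suminf_le summableI \<tau>_norm)
    also have "\<dots> < \<infinity>"
      unfolding infinity_ennreal_def
      by (intro less_top[THEN iffD1] ennreal_suminf_neq_top[OF b_c_summable]) simp
    finally have fin: "AE y in lborel. (\<Sum>n. ennreal (cmod (\<tau> n y))) \<noteq> \<infinity>"
      using \<tau>_int by (intro nn_integral_PInf_AE) auto
    then have AE_sum: "AE y in lborel. summable (\<lambda>n. norm (\<tau> n y))"
      by eventually_elim (auto intro: summable_suminf_not_top)
    have norm_sum: "summable (\<lambda>n. \<integral>y. norm (\<tau> n y) \<partial>lborel)"
    proof (rule summable_comparison_test'[OF b_c_summable])
      fix n :: nat
      have "ennreal (\<integral>y. norm (\<tau> n y) \<partial>lborel) \<le> ennreal (cmod (b n x) * (l2_norm (c n) * l2_norm f))"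
        using \<tau>_norm[of n] \<tau>_int[of n] by (subst nn_integral_eq_integral[symmetric]) auto
      then show "norm (\<integral>y. norm (\<tau> n y) \<partial>lborel) \<le> cmod (b n x) * (l2_norm (c n) * l2_norm f)"
        by simp
    qed
    \<comment> \<open>Where the majorant is infinite, finiteness of its product with |f y| forces f
      y = 0, so the default value 0 of the kernel agrees with the sum there.\<close>
    have "AE y in lborel. (\<Sum>n. \<tau> n y) = kernel (x, y) * f y"
      using fin
    proof eventually_elim
      case (elim y)
      have S: "(\<Sum>n. ennreal (cmod (\<tau> n y))) = majorant (x, y) * ennreal (cmod (f y))"
        unfolding majorant_def by (simp add: \<tau>_def norm_mult ennreal_mult ennreal_suminf_multc)
      show ?case
      proof (cases "majorant (x, y) < \<infinity>")
        case True
        then have "summable (\<lambda>n. b n x * cnj (c n y))"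
          by (rule summable_norm_cancel[OF majorant_finite_summable])
        then have "(\<Sum>n. b n x * cnj (c n y)) * f y = (\<Sum>n. b n x * cnj (c n y) * f y)"
          by (rule suminf_mult2)
        then show ?thesis
          using True by (simp only: kernel_def \<tau>_def if_True fst_conv snd_conv)
      next
        case False
        have "majorant (x, y) * ennreal (cmod (f y)) \<noteq> \<infinity>"
          using elim unfolding S .
        then have "f y = 0"
          using False by (auto simp: less_top[symmetric] ennreal_top_mult split: if_splits)
        then show ?thesis
          by (simp add: \<tau>_def)
      qed
    qed
    moreover have [measurable]: "(\<lambda>y. kernel (x, y) * f y) \<in> borel_measurable borel"
      by measurable
    have [measurable]: "\<tau> n \<in> borel_measurable borel" for n
      unfolding \<tau>_def by measurable
    have "(\<lambda>y. \<Sum>n. \<tau> n y) \<in> borel_measurable borel"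
      by measurable
    ultimately have "integrable lborel (\<lambda>y. kernel (x, y) * f y)"
        and int_eq: "(\<integral>y. (\<Sum>n. \<tau> n y) \<partial>lborel) = (\<integral>y. kernel (x, y) * f y \<partial>lborel)"
      using integrable_suminf[OF \<tau>_int AE_sum norm_sum]
      by (auto intro: integral_cong_AE elim: integrable_cong_AE_imp)
    moreover have "(\<integral>y. \<tau> n y \<partial>lborel) = l2_inner f (c n) * b n x" for n
    proof -
      have "\<tau> n y = b n x * (f y * cnj (c n y))" for y
        by (simp add: \<tau>_def)
      then show ?thesis
        by (simp add: l2_inner_def mult.commute)
    qed
    ultimately show ?case
      using sums_integral[OF \<tau>_int AE_sum norm_sum] by simp
  qed
  have "AE x in lborel. g x = (\<integral>y. kernel (x, y) * f y \<partial>lborel)"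
  proof (rule L2_tendsto_AE_limit[OF g _ lim])
    show "(\<lambda>x. \<Sum>n<N. l2_inner f (c n) * b n x) \<in> L2" for N
      by (intro L2_sum L2_mult b_L2)
    show "AE x in lborel. (\<lambda>N. \<Sum>n<N. l2_inner f (c n) * b n x) \<longlonglongrightarrow> (\<integral>y. kernel (x, y) * f y \<partial>lborel)"
      using pointwise by eventually_elim (simp add: sums_def)
  qed
  then show ?thesis
    using pointwise by eventually_elim simp
qed

end

section \<open>Wigner functions\<close>

context kernel_expansion
begin

lemma nn_integral_kernel_shift_le: "(\<integral>\<^sup>+x. ennreal (cmod (kernel (x + w, x))) \<partial>lborel) \<le> ennreal t"
  using nn_integral_mono[of lborel "\<lambda>x. ennreal (cmod (kernel (x + w, x)))" "\<lambda>x. majorant (x + w, x)"]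
    norm_kernel_le nn_integral_majorant_shift[of w] order_trans by blast

lemma integrable_kernel_shift: "integrable lborel (\<lambda>x. kernel (x + w, x))"
  using nn_integral_kernel_shift_le[of w] by (auto simp: integrable_iff_bounded intro: le_less_trans)

text \<open>Termwise integration, justified since each term has integral norm at most the squared
  norm of \<open>c n\<close>. The right side is the trace of the operator composed with a
  translation.\<close>

lemma kernel_trace_sums:
  "(\<lambda>n. l2_inner (\<lambda>x. b n (x + w)) (c n)) sums (\<integral>x. kernel (x + w, x) \<partial>lborel)"
proof -
  define \<tau> where "\<tau> n x = b n (x + w) * cnj (c n x)" for n x
  have \<tau>_int: "integrable lborel (\<tau> n)" for n
    unfolding \<tau>_def by (intro L2_integrable_inner L2_shift b_L2 c_L2)
  have "(\<integral>\<^sup>+x. majorant (x + w, x) \<partial>lborel) \<noteq> \<infinity>"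
    using nn_integral_majorant_shift[of w] by (auto simp: top_unique)
  then have fin: "AE x in lborel. majorant (x + w, x) \<noteq> \<infinity>"
    by (intro nn_integral_PInf_AE) auto
  then have AE_sum: "AE x in lborel. summable (\<lambda>n. norm (\<tau> n x))"
    unfolding \<tau>_def by eventually_elim (rule majorant_finite_summable, simp add: less_top)
  have norm_sum: "summable (\<lambda>n. \<integral>x. norm (\<tau> n x) \<partial>lborel)"
  proof (rule summable_comparison_test'[OF sums_summable[OF c_sums]])
    fix n :: nat
    have "ennreal (\<integral>x. norm (\<tau> n x) \<partial>lborel) = (\<integral>\<^sup>+x. ennreal (cmod (b n (x + w)) * cmod (c n x)) \<partial>lborel)"
      by (subst nn_integral_eq_integral[OF integrable_norm[OF \<tau>_int], symmetric]) (simp_all add: \<tau>_def norm_mult)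
    also have "\<dots> \<le> ennreal (l2_norm (b n) * l2_norm (c n))"
      using nn_integral_L2_mult_le[OF L2_shift(1)[OF b_L2] c_L2] by (simp add: L2_shift(2)[OF b_L2])
    also have "\<dots> \<le> ennreal ((l2_norm (c n))\<^sup>2)"
      unfolding power2_eq_square by (intro ennreal_leI mult_right_mono b_le_c) simp
    finally show "norm (\<integral>x. norm (\<tau> n x) \<partial>lborel) \<le> (l2_norm (c n))\<^sup>2"
      by simp
  qed
  have "(\<lambda>n. \<integral>x. \<tau> n x \<partial>lborel) sums (\<integral>x. (\<Sum>n. \<tau> n x) \<partial>lborel)"
    by (rule sums_integral[OF \<tau>_int AE_sum norm_sum])
  also have "(\<integral>x. (\<Sum>n. \<tau> n x) \<partial>lborel) = (\<integral>x. kernel (x + w, x) \<partial>lborel)"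
  proof (rule integral_cong_AE)
    show "AE x in lborel. (\<Sum>n. \<tau> n x) = kernel (x + w, x)"
      using fin by eventually_elim (simp add: kernel_def \<tau>_def less_top)
    have [measurable]: "\<tau> n \<in> borel_measurable borel" for n
      unfolding \<tau>_def by measurable
    show "(\<lambda>x. \<Sum>n. \<tau> n x) \<in> borel_measurable lborel"
      by measurable
  qed measurable
  finally show ?thesis
    by (simp add: \<tau>_def l2_inner_def)
qed

text \<open>When \<open>b = c\<close>, each term tends to the squared norm of \<open>c n\<close> by
  continuity of translations and is bounded by it for every shift; Tannery's theorem exchanges the
  limit with the sum.\<close>

lemma kernel_trace_tendsto:
  assumes "b = c" and w: "w \<longlonglongrightarrow> 0"
  shows "(\<lambda>j. \<integral>x. kernel (x + w j, x) \<partial>lborel) \<longlonglongrightarrow> of_real t"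
proof -
  let ?a = "\<lambda>n j. l2_inner (\<lambda>x. c n (x + w j)) (c n)"
  have lim: "(\<lambda>j. ?a n j) \<longlonglongrightarrow> of_real ((l2_norm (c n))\<^sup>2)" for n
  proof -
    have eq: "?a n j - of_real ((l2_norm (c n))\<^sup>2) = l2_inner (\<lambda>x. c n (x + w j) - c n x) (c n)" for j
      unfolding l2_inner_self[symmetric] unfolding l2_inner_def
      by (simp add: left_diff_distrib L2_integrable_inner L2_shift c_L2)
    have le: "norm (?a n j - of_real ((l2_norm (c n))\<^sup>2)) \<le> l2_norm (\<lambda>x. c n (x + w j) - c n x) * l2_norm (c n)" for j
      unfolding eq by (intro cmod_l2_inner_le L2_diff L2_shift c_L2)
    have "(\<lambda>j. l2_norm (\<lambda>x. c n (x + w j) - c n x) * l2_norm (c n)) \<longlonglongrightarrow> 0 * l2_norm (c n)"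
      by (intro tendsto_mult tendsto_const L2_shift_continuous c_L2 w)
    then have "(\<lambda>j. l2_norm (\<lambda>x. c n (x + w j) - c n x) * l2_norm (c n)) \<longlonglongrightarrow> 0"
      by simp
    with always_eventually[OF allI[OF le]] have "(\<lambda>j. ?a n j - of_real ((l2_norm (c n))\<^sup>2)) \<longlonglongrightarrow> 0"
      by (rule Lim_null_comparison)
    then show ?thesis
      by (rule LIM_zero_cancel)
  qed
  have "norm (?a n j) \<le> (l2_norm (c n))\<^sup>2" for n j
    using cmod_l2_inner_le[OF L2_shift(1)[OF c_L2] c_L2, of n "w j" n]
    by (simp add: L2_shift(2)[OF c_L2] power2_eq_square)
  then have bound: "\<forall>\<^sub>F (n, j) in at_top \<times>\<^sub>F sequentially. norm (?a n j) \<le> (l2_norm (c n))\<^sup>2"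
    by (intro always_eventually) auto
  have "(\<lambda>j. \<Sum>n. ?a n j) \<longlonglongrightarrow> (\<Sum>n. of_real ((l2_norm (c n))\<^sup>2))"
    using tannerys_theorem[OF lim bound sums_summable[OF c_sums] sequentially_bot] by blast
  moreover have "(\<Sum>n. of_real ((l2_norm (c n))\<^sup>2)) = complex_of_real t"
    using sums_of_real[OF c_sums] by (rule sums_unique[symmetric])
  moreover have "(\<Sum>n. ?a n j) = (\<integral>x. kernel (x + w j, x) \<partial>lborel)" for j
    using kernel_trace_sums[of "w j"] \<open>b = c\<close> by (auto intro: sums_unique[symmetric])
  ultimately show ?thesis
    by simp
qed

end

section \<open>Midpoint and difference coordinates\<close>

lemma AE_in_ball:
  fixes P :: "'a::euclidean_space \<Rightarrow> bool"
  assumes "AE x in lborel. P x" "r > 0"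
  shows "\<exists>x\<in>ball a r. P x"
proof (rule ccontr)
  assume "\<not> ?thesis"
  with assms(1) have "AE x in lborel. x \<notin> ball a r"
    by (auto elim: eventually_mono)
  then have "ball a r \<in> null_sets lborel"
    by (subst AE_iff_null_sets) auto
  then have "negligible (ball a r)"
    by (simp add: negligible_iff_null_sets null_sets_completionI)
  then show False
    using open_not_negligible[of "ball a r"] \<open>r > 0\<close> by auto
qed

text \<open>A shift of the midpoint by half the scaled difference reduces the rotation to a
  translation and a scaling in one variable, which contributes the factor of epsilon to the
  dimension. It transfers both square integrability and null sets.\<close>

lemma nn_integral_rotate:
  fixes F :: "'a::euclidean_space \<times> 'a \<Rightarrow> ennreal"
  assumes F: "F \<in> borel_measurable borel" and "\<epsilon> > 0"
  shows "(\<integral>\<^sup>+z. F z \<partial>lborel)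
    = ennreal (\<epsilon> ^ DIM('a)) * (\<integral>\<^sup>+z. F (fst z + \<epsilon> *\<^sub>R (snd z /\<^sub>R 2), fst z - \<epsilon> *\<^sub>R (snd z /\<^sub>R 2)) \<partial>lborel)"
proof -
  have [measurable]: "F \<in> borel_measurable borel"
    by (rule F)
  have "(\<lambda>z::'a \<times> 'a. (fst z + \<epsilon> *\<^sub>R (snd z /\<^sub>R 2), fst z - \<epsilon> *\<^sub>R (snd z /\<^sub>R 2))) \<in> borel_measurable borel"
    by (intro borel_measurable_continuous_onI continuous_intros)
  then have meas: "(\<lambda>z. F (fst z + \<epsilon> *\<^sub>R (snd z /\<^sub>R 2), fst z - \<epsilon> *\<^sub>R (snd z /\<^sub>R 2))) \<in> borel_measurable borel"
    by (rule measurable_compose) (rule F)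
  have "(\<integral>\<^sup>+z. F (fst z + \<epsilon> *\<^sub>R (snd z /\<^sub>R 2), fst z - \<epsilon> *\<^sub>R (snd z /\<^sub>R 2)) \<partial>lborel)
      = (\<integral>\<^sup>+y. \<integral>\<^sup>+x. F (x + \<epsilon> *\<^sub>R (y /\<^sub>R 2), x - \<epsilon> *\<^sub>R (y /\<^sub>R 2)) \<partial>lborel \<partial>lborel)"
    by (subst nn_integral_lborel_pair(2)[OF meas]) simp
  also have "\<dots> = (\<integral>\<^sup>+y. \<integral>\<^sup>+x. F (x + \<epsilon> *\<^sub>R y, x) \<partial>lborel \<partial>lborel)"
  proof (rule nn_integral_cong)
    fix y :: 'a
    have "\<epsilon> *\<^sub>R y = \<epsilon> *\<^sub>R (y /\<^sub>R 2) + \<epsilon> *\<^sub>R (y /\<^sub>R 2)"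
      by (simp flip: scaleR_add_left)
    then show "(\<integral>\<^sup>+x. F (x + \<epsilon> *\<^sub>R (y /\<^sub>R 2), x - \<epsilon> *\<^sub>R (y /\<^sub>R 2)) \<partial>lborel) = (\<integral>\<^sup>+x. F (x + \<epsilon> *\<^sub>R y, x) \<partial>lborel)"
      using nn_integral_lborel_shift[of "\<lambda>x. F (x + \<epsilon> *\<^sub>R y, x)" "- (\<epsilon> *\<^sub>R (y /\<^sub>R 2))"]
      by (simp add: add.assoc)
  qed
  also have "\<dots> = (\<integral>\<^sup>+x. \<integral>\<^sup>+y. F (x + \<epsilon> *\<^sub>R y, x) \<partial>lborel \<partial>lborel)"
    by (rule lborel_pair.Fubini') measurable
  finally have eq: "(\<integral>\<^sup>+z. F (fst z + \<epsilon> *\<^sub>R (snd z /\<^sub>R 2), fst z - \<epsilon> *\<^sub>R (snd z /\<^sub>R 2)) \<partial>lborel)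
      = (\<integral>\<^sup>+x. \<integral>\<^sup>+y. F (x + \<epsilon> *\<^sub>R y, x) \<partial>lborel \<partial>lborel)" .
  have "(\<integral>\<^sup>+z. F z \<partial>lborel) = (\<integral>\<^sup>+x. \<integral>\<^sup>+y. F (y, x) \<partial>lborel \<partial>lborel)"
    by (rule nn_integral_lborel_pair(2)[OF F])
  also have "\<dots> = (\<integral>\<^sup>+x. ennreal (\<epsilon> ^ DIM('a)) * (\<integral>\<^sup>+y. F (x + \<epsilon> *\<^sub>R y, x) \<partial>lborel) \<partial>lborel)"
  proof (rule nn_integral_cong)
    fix x :: 'a
    show "(\<integral>\<^sup>+y. F (y, x) \<partial>lborel) = ennreal (\<epsilon> ^ DIM('a)) * (\<integral>\<^sup>+y. F (x + \<epsilon> *\<^sub>R y, x) \<partial>lborel)"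
      using nn_integral_lborel_affine[of "\<lambda>y. F (y, x)" \<epsilon> x] \<open>\<epsilon> > 0\<close> by simp
  qed
  also have "\<dots> = ennreal (\<epsilon> ^ DIM('a)) * (\<integral>\<^sup>+x. \<integral>\<^sup>+y. F (x + \<epsilon> *\<^sub>R y, x) \<partial>lborel \<partial>lborel)"
    by (rule nn_integral_cmult) measurable
  finally show ?thesis
    unfolding eq .
qed

definition rotate :: "real \<Rightarrow> ('a::euclidean_space \<times> 'a \<Rightarrow> complex) \<Rightarrow> 'a \<times> 'a \<Rightarrow> complex"
  where "rotate \<epsilon> F z = F (fst z + \<epsilon> *\<^sub>R (snd z /\<^sub>R 2), fst z - \<epsilon> *\<^sub>R (snd z /\<^sub>R 2))"

lemma rotate_measurable [measurable]:
  fixes F :: "'a::euclidean_space \<times> 'a \<Rightarrow> complex"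
  assumes "F \<in> borel_measurable borel"
  shows "rotate \<epsilon> F \<in> borel_measurable borel"
proof -
  have "(\<lambda>z::'a \<times> 'a. (fst z + \<epsilon> *\<^sub>R (snd z /\<^sub>R 2), fst z - \<epsilon> *\<^sub>R (snd z /\<^sub>R 2))) \<in> borel_measurable borel"
    by (intro borel_measurable_continuous_onI continuous_intros)
  then show ?thesis
    unfolding rotate_def[abs_def] by (rule measurable_compose) (rule assms)
qed

lemma rotate_L2:
  assumes F: "F \<in> L2" and "\<epsilon> > 0"
  shows "rotate \<epsilon> F \<in> L2"
proof -
  have [measurable]: "F \<in> borel_measurable borel"
    using F by (rule L2_measurable)
  have "(\<integral>\<^sup>+z. ennreal ((cmod (F z))\<^sup>2) \<partial>lborel) = ennreal (\<epsilon> ^ DIM('a)) * (\<integral>\<^sup>+z. ennreal ((cmod (rotate \<epsilon> F z))\<^sup>2) \<partial>lborel)"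
    unfolding rotate_def by (rule nn_integral_rotate) (measurable, rule assms(2))
  then show ?thesis
    using F \<open>\<epsilon> > 0\<close> by (auto simp: L2_iff_nn_integral ennreal_mult_less_top)
qed

lemma rotate_cong_AE:
  fixes F G :: "'a::euclidean_space \<times> 'a \<Rightarrow> complex"
  assumes [measurable]: "F \<in> borel_measurable borel" "G \<in> borel_measurable borel"
    and eq: "AE z in lborel. F z = G z" and "\<epsilon> > 0"
  shows "AE z in lborel. rotate \<epsilon> F z = rotate \<epsilon> G z"
proof -
  have "0 = (\<integral>\<^sup>+z. ennreal (cmod (F z - G z)) \<partial>lborel)"
    using eq by (subst nn_integral_0_iff_AE[THEN iffD2]) auto
  also have "\<dots> = ennreal (\<epsilon> ^ DIM('a)) * (\<integral>\<^sup>+z. ennreal (cmod (rotate \<epsilon> F z - rotate \<epsilon> G z)) \<partial>lborel)"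
    unfolding rotate_def by (rule nn_integral_rotate) (measurable, rule assms(4))
  finally have "(\<integral>\<^sup>+z. ennreal (cmod (rotate \<epsilon> F z - rotate \<epsilon> G z)) \<partial>lborel) = 0"
    using \<open>\<epsilon> > 0\<close> by auto
  then show ?thesis
    by (subst (asm) nn_integral_0_iff_AE) auto
qed

text \<open>The transforms are equal outright, not only almost everywhere: the choice predicate sees
  \<open>f\<close> only through squared distances, so the same function is chosen.\<close>

lemma partial_fourier_cong_AE:
  assumes "AE z in lborel. f z = f' z"
  shows "partial_fourier f = partial_fourier f'"
proof -
  have "l2_tendsto \<phi> f \<longleftrightarrow> l2_tendsto \<phi> f'" for \<phi>
  proof -
    have "(\<integral>\<^sup>+z. ennreal ((cmod (\<phi> m z - f z))\<^sup>2) \<partial>lborel) = (\<integral>\<^sup>+z. ennreal ((cmod (\<phi> m z - f' z))\<^sup>2) \<partial>lborel)" for m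
      using assms by (intro nn_integral_cong_AE) auto
    then show ?thesis
      by (simp add: l2_tendsto_def)
  qed
  then show ?thesis
    unfolding partial_fourier_def by simp
qed

lemma wigner_eq: "wigner \<epsilon> D = partial_fourier_integral (rotate \<epsilon> (op_kernel D))"
  by (simp add: wigner_def partial_fourier_integral_def rotate_def)

text \<open>The dual norm integrates over x at fixed K, so an almost everywhere statement on the
  product is sliced in the second variable; Tonelli for the indicator of the exceptional set does
  this.\<close>

lemma AE_lborel_pair_swap:
  fixes P :: "'a::euclidean_space \<times> 'b::euclidean_space \<Rightarrow> bool"
  assumes P: "{z. P z} \<in> sets borel" and AE: "AE z in lborel. P z"
  shows "AE y in lborel. AE x in lborel. P (x, y)"
proof -
  have N: "{z. \<not> P z} \<in> sets borel"
    using sets.compl_sets[OF P] by (simp add: Collect_neg_eq Compl_eq_Diff_UNIV)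
  let ?i = "indicator {z. \<not> P z} :: 'a \<times> 'b \<Rightarrow> ennreal"
  have [measurable]: "?i \<in> borel_measurable borel"
    using N by simp
  have "0 = (\<integral>\<^sup>+z. ?i z \<partial>lborel)"
    using AE by (subst nn_integral_0_iff_AE[THEN iffD2]) (auto simp: indicator_def)
  also have "\<dots> = (\<integral>\<^sup>+y. \<integral>\<^sup>+x. ?i (x, y) \<partial>lborel \<partial>lborel)"
    by (rule nn_integral_lborel_pair(2)) measurable
  finally have "AE y in lborel. (\<integral>\<^sup>+x. ?i (x, y) \<partial>lborel) = 0"
    by (subst nn_integral_0_iff_AE[symmetric]) auto
  then show ?thesis
  proof eventually_elim
    case (elim y)
    then have "AE x in lborel. ?i (x, y) = 0"
      by (subst (asm) nn_integral_0_iff_AE) auto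
    then show ?case
      by eventually_elim (auto simp: indicator_def split: if_splits)
  qed
qed

text \<open>The trace identities are equations between complex numbers, so they also assert that
  both traces are real.\<close>

theorem lemma5p3:
  fixes \<epsilon> :: real
    and D :: "(real ^ 'n \<Rightarrow> complex) \<Rightarrow> real ^ 'n \<Rightarrow> complex"
  assumes "\<epsilon> > 0" and "trace_class D"
  shows "dual_A_norm (wigner \<epsilon> D) \<le> ennreal (trace_norm D)
         \<and> complex_of_real (trace_norm D) = op_trace (op_abs D)
         \<and> (positive_op D \<longrightarrow>
              dual_A_norm (wigner \<epsilon> D) = ennreal (trace_norm D)
              \<and> complex_of_real (trace_norm D) = op_trace D)"
proof -
  have bD: "bounded_op D"
    using assms(2) by (simp add: trace_class_def)
  obtain b c where bc: "\<And>n. b n \<in> L2" "\<And>n. c n \<in> L2" "\<And>n. l2_norm (b n) \<le> l2_norm (c n)"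
      "(\<lambda>n. (l2_norm (c n))\<^sup>2) sums trace_norm D"
    and expand: "\<And>f. f \<in> L2 \<Longrightarrow> (\<lambda>N. l2_norm (\<lambda>x. D f x - (\<Sum>n<N. l2_inner f (c n) * b n x))) \<longlonglongrightarrow> 0"
    and pos: "positive_op D \<Longrightarrow> b = c"
    using trace_class_expansion[OF assms(2)] by blast
  interpret kernel_expansion b c "trace_norm D"
    using bc by unfold_locales
  have k: "has_integral_kernel D kernel"
    unfolding has_integral_kernel_def
    using kernel_represents[OF _ bounded_opD(1)[OF bD] expand] by simp
  then have ok: "has_integral_kernel D (op_kernel D)"
    unfolding op_kernel_def by (rule someI[of "has_integral_kernel D"])
  have [measurable]: "op_kernel D \<in> borel_measurable borel"
    using ok by (simp add: has_integral_kernel_def)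
  define H where "H = rotate \<epsilon> kernel"
  have H: "H \<in> L2"
    unfolding H_def using kernel_L2 assms(1) by (rule rotate_L2)
  have [measurable]: "H \<in> borel_measurable borel"
    using H by (rule L2_measurable)
  \<comment> \<open>Scaling the difference variable by epsilon/2 turns the slice into the
    antidiagonal integral, so the Fourier integral of \<open>H\<close> converges absolutely at every
    x.\<close>
  have H_int: "integrable lborel (\<lambda>y. H (x, y))" for x
  proof -
    have "(\<integral>\<^sup>+y. ennreal (cmod (kernel (x + y, x - y))) \<partial>lborel) \<le> ennreal (trace_norm D)"
      by (rule order_trans[OF nn_integral_mono nn_integral_majorant_antidiagonal]) (rule norm_kernel_le)
    moreover have "(\<integral>\<^sup>+y. ennreal (cmod (kernel (x + y, x - y))) \<partial>lborel)
        = ennreal (\<bar>\<epsilon> / 2\<bar> ^ DIM(real ^ 'n)) * (\<integral>\<^sup>+y. ennreal (cmod (kernel (x + (0 + (\<epsilon> / 2) *\<^sub>R y), x - (0 + (\<epsilon> / 2) *\<^sub>R y)))) \<partial>lborel)"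
      by (rule nn_integral_lborel_affine) (measurable, use assms(1) in simp)
    ultimately have "ennreal (\<bar>\<epsilon> / 2\<bar> ^ DIM(real ^ 'n)) * (\<integral>\<^sup>+y. ennreal (cmod (H (x, y))) \<partial>lborel) < \<infinity>"
      by (auto simp: H_def rotate_def intro: le_less_trans)
    then have "(\<integral>\<^sup>+y. ennreal (cmod (H (x, y))) \<partial>lborel) < \<infinity>"
      using assms(1) by (auto simp: ennreal_mult_less_top)
    then show ?thesis
      by (simp add: integrable_iff_bounded)
  qed
  \<comment> \<open>The kernel chosen by \<open>op_kernel\<close> agrees with the explicit one up to
    a null set, and the change of coordinates keeps that set null.\<close>
  have H_AE: "AE z in lborel. rotate \<epsilon> (op_kernel D) z = H z"
    unfolding H_def using integral_kernel_unique[OF ok k] assms(1) by (intro rotate_cong_AE) auto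
  have "AE z in lborel. wigner \<epsilon> D z = partial_fourier_integral H z"
  proof (rule AE_lborel_pairI)
    show "AE x in lborel. AE y in lborel. wigner \<epsilon> D (x, y) = partial_fourier_integral H (x, y)"
      using AE_lborel_pair[OF H_AE]
    proof eventually_elim
      case (elim x)
      have "fourier (\<lambda>y. rotate \<epsilon> (op_kernel D) (x, y)) k = fourier (\<lambda>y. H (x, y)) k" for k
        unfolding fourier_def using elim by (intro integral_cong_AE) auto
      then show ?case
        by (simp add: wigner_eq partial_fourier_integral_eq)
    qed
    show "{z. wigner \<epsilon> D z = partial_fourier_integral H z} \<in> sets borel"
      unfolding wigner_eq by measurable
  qed
  then have pf_eq: "partial_fourier (wigner \<epsilon> D) = partial_fourier (partial_fourier_integral H)"
    by (rule partial_fourier_cong_AE)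
  define P where "P = partial_fourier (wigner \<epsilon> D)"
  have [measurable]: "P \<in> borel_measurable borel"
    unfolding P_def pf_eq using H H_int by (intro L2_measurable partial_fourier_inversion) auto
  have P_AE: "AE z in lborel. P z = H (fst z, - snd z)"
    unfolding P_def pf_eq using H H_int by (intro partial_fourier_inversion) auto
  define N where "N K = (\<integral>\<^sup>+x. ennreal (cmod (P (x, K))) \<partial>lborel)" for K
  have N_meas: "N \<in> borel_measurable lborel"
    unfolding N_def[abs_def] by measurable
  have norm_eq: "dual_A_norm (wigner \<epsilon> D) = esssup lborel N"
    by (simp add: dual_A_norm_def N_def[abs_def] P_def)
  have "(\<lambda>z::(real^'n) \<times> (real^'n). (fst z, - snd z)) \<in> borel_measurable borel"
    by (intro borel_measurable_continuous_onI continuous_intros)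
  then have [measurable]: "(\<lambda>z. H (fst z, - snd z)) \<in> borel_measurable borel"
    by (rule measurable_compose) measurable
  have "AE K in lborel. AE x in lborel. P (x, K) = H (x, - K)"
    using AE_lborel_pair_swap[OF _ P_AE] by simp
  \<comment> \<open>Translating x by half of epsilon K places the second argument on x and leaves
    the full offset - epsilon K in the first, so \<open>N K\<close> is an integral along a shifted
    diagonal.\<close>
  then have N_AE: "AE K in lborel. N K = (\<integral>\<^sup>+x. ennreal (cmod (kernel (x + - \<epsilon> *\<^sub>R K, x))) \<partial>lborel)"
  proof eventually_elim
    case (elim K)
    have half: "- (\<epsilon> *\<^sub>R K) = - (\<epsilon> *\<^sub>R (K /\<^sub>R 2)) - \<epsilon> *\<^sub>R (K /\<^sub>R 2)"
      using scaleR_add_left[of "\<epsilon> / 2" "\<epsilon> / 2" K] by simp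
    have "N K = (\<integral>\<^sup>+x. ennreal (cmod (kernel ((x + \<epsilon> *\<^sub>R (K /\<^sub>R 2)) + - \<epsilon> *\<^sub>R K, x + \<epsilon> *\<^sub>R (K /\<^sub>R 2)))) \<partial>lborel)"
      unfolding N_def
    proof (rule nn_integral_cong_AE, use elim in eventually_elim)
      case (elim x)
      have eq: "(x + \<epsilon> *\<^sub>R (K /\<^sub>R 2)) + - \<epsilon> *\<^sub>R K = x - \<epsilon> *\<^sub>R (K /\<^sub>R 2)"
        using half by (simp add: algebra_simps)
      show ?case
        unfolding eq using elim by (simp add: H_def rotate_def)
    qed
    also have "\<dots> = (\<integral>\<^sup>+x. ennreal (cmod (kernel (x + - \<epsilon> *\<^sub>R K, x))) \<partial>lborel)"
      by (rule nn_integral_lborel_shift[where f="\<lambda>x. ennreal (cmod (kernel (x + - \<epsilon> *\<^sub>R K, x)))"]) measurable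
    finally show ?case .
  qed
  have upper: "esssup lborel N \<le> ennreal (trace_norm D)"
    using N_meas
  proof (rule esssup_I)
    show "AE K in lborel. N K \<le> ennreal (trace_norm D)"
      using N_AE by eventually_elim (simp only: nn_integral_kernel_shift_le)
  qed
  have lower: "ennreal (trace_norm D) \<le> esssup lborel N" if "positive_op D"
  proof -
    have "AE K in lborel. (\<integral>\<^sup>+x. ennreal (cmod (kernel (x + - \<epsilon> *\<^sub>R K, x))) \<partial>lborel) \<le> esssup lborel N"
      using N_AE esssup_AE[of N lborel] by eventually_elim simp
    \<comment> \<open>The comparison with the essential supremum holds only for almost every K, so
      the value at 0 cannot be used; points satisfying it are picked from balls shrinking to
      0.\<close>
    then have "\<exists>K\<in>ball 0 (1 / real (Suc j)). (\<integral>\<^sup>+x. ennreal (cmod (kernel (x + - \<epsilon> *\<^sub>R K, x))) \<partial>lborel) \<le> esssup lborel N" for j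
      by (rule AE_in_ball) simp
    then have "\<forall>j. \<exists>K. K \<in> ball 0 (1 / real (Suc j)) \<and> (\<integral>\<^sup>+x. ennreal (cmod (kernel (x + - \<epsilon> *\<^sub>R K, x))) \<partial>lborel) \<le> esssup lborel N"
      by blast
    from choice[OF this] obtain K where K: "\<And>j. K j \<in> ball 0 (1 / real (Suc j))"
        and le: "\<And>j. (\<integral>\<^sup>+x. ennreal (cmod (kernel (x + - \<epsilon> *\<^sub>R K j, x))) \<partial>lborel) \<le> esssup lborel N"
      by blast
    have "K \<longlonglongrightarrow> 0"
    proof (rule Lim_null_comparison)
      have "norm (K j) \<le> 1 / real (Suc j)" for j
        using K[of j] by (simp only: mem_ball_0 less_imp_le)
      then show "\<forall>\<^sub>F j in sequentially. norm (K j) \<le> 1 / real (Suc j)"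
        by (rule always_eventually[OF allI])
      show "(\<lambda>j. 1 / real (Suc j)) \<longlonglongrightarrow> 0"
        by (rule LIMSEQ_Suc[OF lim_1_over_n])
    qed
    then have "(\<lambda>j. - \<epsilon> *\<^sub>R K j) \<longlonglongrightarrow> - \<epsilon> *\<^sub>R 0"
      by (intro tendsto_intros)
    then have "(\<lambda>j. \<integral>x. kernel (x + - \<epsilon> *\<^sub>R K j, x) \<partial>lborel) \<longlonglongrightarrow> of_real (trace_norm D)"
      by (intro kernel_trace_tendsto pos that) simp
    then have lim: "(\<lambda>j. ennreal (cmod (\<integral>x. kernel (x + - \<epsilon> *\<^sub>R K j, x) \<partial>lborel))) \<longlonglongrightarrow> ennreal (cmod (of_real (trace_norm D)))"
      by (intro tendsto_ennrealI tendsto_norm)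
    have "ennreal (cmod (\<integral>x. kernel (x + - \<epsilon> *\<^sub>R K j, x) \<partial>lborel)) \<le> esssup lborel N" for j
      using integral_norm_bound_ennreal[OF integrable_kernel_shift] le[of j] by (rule order_trans)
    then have "ennreal (cmod (of_real (trace_norm D))) \<le> esssup lborel N"
      by (intro LIMSEQ_le_const2[OF lim] exI allI impI)
    then show ?thesis
      using t_nonneg by simp
  qed
  have trace: "complex_of_real (trace_norm D) = op_trace (op_abs D)"
    using trace_class_sqrt[OF assms(2)] by blast
  show ?thesis
    using upper lower trace op_trace_positive[OF assms(2)] by (auto simp: norm_eq intro: antisym)
qed

end
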